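(* Let $q$ be a power of an odd prime, $P=\{(x_1,\dots,x_d)\in\mathbb F_q^d: x_d=x_1^2+\cdots+x_{d-1}^2\}$, $A\subset P$, and $B\subset\mathbb F_q^d$ arbitrary. (i) If $d=4k-1$ with $k$ a positive integer, $q\equiv3\pmod4$, and $|A||B|\ge4q^d$, then $|\Delta(A,B)|\ge q/3$. (ii) If $d\ge4$ is even, $|A||B|\ge16q^d$, and either $|A|\le q^{(d-1)/2}$ or $|A|\ge q^{d/2}$, then $|\Delta(A,B)|\ge q/144$.
   Context: For $x,y\in\mathbb F_q^d$, $\|x-y\|=\sum_{i=1}^d(x_i-y_i)^2$, and $\Delta(A,B)=\{\|a-b\|: a\in A, b\in B\}$. *)

theory Defs imports Complex_Main "HOL-Library.Cardinality" "HOL-Computational_Algebra.Primes" begin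

text \<open>Vectors of F_q^d are represented as functions nat => 'a supported on {0..<d};
coordinate x_i of the paper is x (i-1).\<close>

definition fvecs :: "nat \<Rightarrow> (nat \<Rightarrow> 'a::zero) set" where
  "fvecs d = {x. \<forall>i\<ge>d. x i = 0}"

definition qnorm :: "nat \<Rightarrow> (nat \<Rightarrow> 'a::comm_ring_1) \<Rightarrow> 'a" where
  "qnorm d x = (\<Sum>i<d. (x i)^2)"

definition dist_set :: "nat \<Rightarrow> (nat \<Rightarrow> 'a::comm_ring_1) set \<Rightarrow> (nat \<Rightarrow> 'a) set \<Rightarrow> 'a set" where
  "dist_set d A B = {qnorm d (\<lambda>i. a i - b i) | a b. a \<in> A \<and> b \<in> B}"

definition paraboloid :: "nat \<Rightarrow> (nat \<Rightarrow> 'a::comm_ring_1) set" where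
  "paraboloid d = {x \<in> fvecs d. x (d - 1) = (\<Sum>i<d - 1. (x i)^2)}"

end

theory Submission
  imports Defs "HOL-Library.FuncSet" "HOL-Algebra.Algebraic_Closure_Type"
begin

text \<open>
  Let \<open>n = d - 1\<close> and let \<open>\<chi>\<close> be a nontrivial additive character of \<open>F\<^sub>q\<close>.

  If \<open>A\<close> is large, fix the point \<open>a\<close>. The number of \<open>(a, b, b')\<close> with \<open>\<parallel>a - b\<parallel> = \<parallel>a - b'\<parallel>\<close> is
  \<open>(1/q) \<Sum>\<^sub>s \<Sum>\<^sub>a \<bar>\<Sum>\<^sub>b \<chi>(s \<parallel>a - b\<parallel>)\<bar>\<^sup>2\<close>, and for \<open>s \<noteq> 0\<close> the sum over \<open>a\<close> may be extended to the whole paraboloid.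
  There it is a Gauss sum in \<open>n\<close> variables times a phase linear in \<open>s\<close>. For odd \<open>n\<close> the summation over \<open>s\<close> is
  again a Gauss sum and saves \<open>\<surd>q\<close>; for \<open>n = 4k - 2\<close> and \<open>q \<equiv> 3 mod 4\<close> the Gauss factor is negative, so only
  pairs that miss a hyperplane contribute positively.

  If \<open>A\<close> is small, let \<open>g\<close> be the indicator of \<open>\<Delta>(A,B)\<close> minus its mean. The function
  \<open>b \<mapsto> \<Sum>\<^sub>a g(\<parallel>a - b\<parallel>)\<close> is constant on \<open>B\<close>, and its second moment over the whole space is a sum of convolution
  forms whose eigenvalues are Salie sums (\<open>d\<close> odd) or Kloosterman sums (\<open>d\<close> even), of size at most \<open>2 \<surd>q\<close>
  apart from the zero frequency for even \<open>d\<close>, where \<open>g\<close> has transform \<open>q g(0)\<close>.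

  The bound for Kloosterman sums is proved by lifting to the fields with \<open>Q = q^(2^j)\<close> elements: the identity
  \<open>Kl(Q\<^sup>2) = 2 Q - Kl(Q)\<^sup>2\<close> makes a violation of the bound grow, while Stepanov's method applied to
  \<open>w\<^sup>2 = (y\<^sup>q - y)\<^sup>2 - 4 a\<close> bounds the sum over all characters of \<open>F\<^sub>q\<close>.
\<close>

section \<open>Stepanov's method\<close>

hide_const (open) UnivPoly.monom UnivPoly.coeff Polynomials.degree Divisibility.prime

text \<open>The two regimes are limited by different error terms. For small A the pairs of A cost
  about |A| q^((d+1)/2) against a main term of order q^d, which is affordable up to |A| =
  q^((d-1)/2); for even d the trivial bound q on Kloosterman sums would reach only q^((d-2)/2),
  hence the effort spent on square-root cancellation. For large A each pair of B costs an amount Y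
  that must not exceed |A|: Y = q^(d/2) for even d, but Y = q^((d-1)/2) in case (i). So in (i) the
  two ranges meet, and in (ii) they leave open exactly the gap excluded by the hypothesis. The cost
  Y is an upper bound for a real part, not for a modulus; this one-sidedness is what makes the
  negative Gauss factor in (i) profitable. In the bound for Kloosterman sums, Stepanov's method
  controls only a sum over all twists, from one side. Doubling the degree repairs this: the identity
  bounds every other twist on the side that is needed, amplifies a violation, and provides fields of
  square order, the shape which the auxiliary polynomial requires.\<close>

definition coeffs_in :: "'a set \<Rightarrow> 'a::zero poly \<Rightarrow> bool" where
  "coeffs_in F p \<longleftrightarrow> (\<forall>i. coeff p i \<in> F)"

definition is_subring :: "'a::comm_ring_1 set \<Rightarrow> bool" where
  "is_subring F \<longleftrightarrow> 0 \<in> F \<and> 1 \<in> F \<and> (\<forall>x\<in>F. \<forall>y\<in>F. x + y \<in> F \<and> x * y \<in> F) \<and> (\<forall>x\<in>F. - x \<in> F)"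

lemma is_subring_sum: "is_subring F \<Longrightarrow> (\<And>i. i \<in> I \<Longrightarrow> g i \<in> F) \<Longrightarrow> sum g I \<in> F"
  by (induction I rule: infinite_finite_induct) (auto simp: is_subring_def)

lemma coeffs_in_add: "is_subring F \<Longrightarrow> coeffs_in F p \<Longrightarrow> coeffs_in F r \<Longrightarrow> coeffs_in F (p + r)"
  by (auto simp: coeffs_in_def is_subring_def)

lemma coeffs_in_mult: "is_subring F \<Longrightarrow> coeffs_in F p \<Longrightarrow> coeffs_in F r \<Longrightarrow> coeffs_in F (p * r)"
  unfolding coeffs_in_def coeff_mult
  by (intro allI is_subring_sum) (auto simp: is_subring_def)

lemma coeffs_in_power: "is_subring F \<Longrightarrow> coeffs_in F p \<Longrightarrow> coeffs_in F (p ^ n)"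
proof (induction n)
  case 0
  then show ?case by (auto simp: coeffs_in_def is_subring_def coeff_1)
next
  case (Suc n)
  then show ?case by (simp add: coeffs_in_mult)
qed

lemma coeffs_in_sum:
  "is_subring F \<Longrightarrow> (\<And>i. i \<in> I \<Longrightarrow> coeffs_in F (g i)) \<Longrightarrow> coeffs_in F (sum g I)"
  by (induction I rule: infinite_finite_induct) (auto simp: coeffs_in_add, auto simp: coeffs_in_def is_subring_def)

lemma coeffs_in_monom: "is_subring F \<Longrightarrow> c \<in> F \<Longrightarrow> coeffs_in F (monom c n)"
  by (auto simp: coeffs_in_def is_subring_def)

lemma frobenius_diff:
  fixes a b :: "'a::comm_ring_1"
  assumes "prime CHAR('a)" "R = CHAR('a) ^ e"
  shows "(a - b) ^ R = a ^ R - b ^ R"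
  using freshmans_dream'[OF assms, of "a - b" b] by simp

text \<open>Pigeonhole takes the place of linear algebra: in the application \<open>T\<close>
  involves R-th powers of the unknowns, so it is additive without being linear over
  \<open>F\<close>. The difference of two colliding vectors then acts as a kernel element.\<close>

lemma exists_collision:
  fixes F :: "'a set" and T :: "('i \<Rightarrow> 'a) \<Rightarrow> nat \<Rightarrow> 'a"
  assumes F: "finite F" "card F \<ge> 2" and I: "finite I" "card I > D"
    and T: "\<And>v k. v \<in> I \<rightarrow>\<^sub>E F \<Longrightarrow> k < D \<Longrightarrow> T v k \<in> F"
  obtains v w where "v \<in> I \<rightarrow>\<^sub>E F" "w \<in> I \<rightarrow>\<^sub>E F" "v \<noteq> w" "\<And>k. k < D \<Longrightarrow> T v k = T w k"
proof -
  define Q where "Q v = restrict (T v) {..<D}" for v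
  have sub: "Q ` (I \<rightarrow>\<^sub>E F) \<subseteq> {..<D} \<rightarrow>\<^sub>E F"
    using T unfolding Q_def restrict_PiE_iff image_subset_iff by auto
  have "card (Q ` (I \<rightarrow>\<^sub>E F)) \<le> card ({..<D} \<rightarrow>\<^sub>E F)"
    by (rule card_mono[OF _ sub]) (use F in \<open>auto intro!: finite_PiE\<close>)
  also have "\<dots> = card F ^ D" by (simp add: card_PiE)
  also have "\<dots> < card F ^ card I" using F(2) I(2) by (intro power_strict_increasing) auto
  also have "\<dots> = card (I \<rightarrow>\<^sub>E F)" using I by (simp add: card_PiE)
  finally have "\<not> inj_on Q (I \<rightarrow>\<^sub>E F)"
    using card_image by fastforce
  then obtain v w where vw: "v \<in> I \<rightarrow>\<^sub>E F" "w \<in> I \<rightarrow>\<^sub>E F" "v \<noteq> w" "Q v = Q w"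
    by (auto simp: inj_on_def)
  have "T v k = T w k" if "k < D" for k
    using fun_cong[OF vw(4), of k] that by (simp add: Q_def)
  with vw that show thesis by blast
qed

lemma degree_sum_monom_le: "n > 0 \<Longrightarrow> degree (\<Sum>j<n. monom (c j) j) \<le> n - 1"
  by (rule degree_sum_le) (auto intro!: order.trans[OF degree_monom_le])

lemma coeff_sum_monom: "coeff (\<Sum>j<n. monom (c j) j) i = (if i < n then c i else 0)"
  by (simp add: coeff_sum)

text \<open>At the lowest index that could be nonzero, cancel \<open>X^(i R)\<close> and isolate the
  term with \<open>f^h\<close>. Squaring removes \<open>\<epsilon>\<close> and turns
  \<open>f^(2h)\<close> into \<open>f^R f\<close>, and \<open>f^R\<close> is constant modulo
  \<open>X^R\<close>. The degrees are small enough for the resulting congruence between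
  \<open>r^2\<close> and \<open>c^R s^2 f\<close> to be an equality, which \<open>nosq\<close>
  forbids unless both vanish.\<close>

lemma stepanov_nonzero:
  fixes f :: "'a::field poly" and r s :: "nat \<Rightarrow> 'a poly"
  assumes char: "prime CHAR('a)" and R: "R = CHAR('a) ^ e" "R = 2 * h - 1" "h > 0"
    and f0: "poly f 0 \<noteq> 0"
    and nosq: "\<And>\<kappa> u v. \<kappa> \<noteq> 0 \<Longrightarrow> u\<^sup>2 = smult \<kappa> (v\<^sup>2 * f) \<Longrightarrow> u = 0 \<and> v = 0"
    and deg: "\<And>i. 2 * degree (r i) < R" "\<And>i. 2 * degree (s i) + degree f < R"
    and eps: "\<epsilon>\<^sup>2 = 1"
    and zero: "(\<Sum>i<b. monom 1 (i * R) * (r i + smult \<epsilon> (s i * f ^ h))) = 0"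
  shows "i < b \<Longrightarrow> r i = 0 \<and> s i = 0"
proof (induction i rule: less_induct)
  case (less i0)
  define Xr :: "'a poly" where "Xr = monom 1 R"
  have Xri: "monom 1 (i * R) = Xr ^ i" for i
    by (simp add: Xr_def monom_power mult.commute)
  have Xr0: "Xr \<noteq> 0" by (simp add: Xr_def)
  have split: "\<exists>V. (\<Sum>i<b. Xr ^ i * u i) = Xr ^ i0 * (u i0 + Xr * V)"
    if u: "\<And>i. i < i0 \<Longrightarrow> u i = 0" for u :: "nat \<Rightarrow> 'a poly"
  proof -
    have "(\<Sum>i<b. Xr ^ i * u i) = (\<Sum>i\<in>{i0..<b}. Xr ^ i * u i)"
      by (rule sum.mono_neutral_right) (auto simp: u not_less)
    also have "\<dots> = Xr ^ i0 * u i0 + (\<Sum>i\<in>{Suc i0..<b}. Xr ^ i * u i)"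
      using less.prems by (simp add: sum.atLeast_Suc_lessThan)
    also have "(\<Sum>i\<in>{Suc i0..<b}. Xr ^ i * u i) = (\<Sum>i\<in>{Suc i0..<b}. Xr ^ i0 * (Xr * (Xr ^ (i - Suc i0) * u i)))"
    proof (rule sum.cong)
      fix i assume "i \<in> {Suc i0..<b}"
      then have "i = Suc i0 + (i - Suc i0)" by simp
      then have "Xr ^ i = Xr ^ (Suc i0 + (i - Suc i0))" by simp
      then show "Xr ^ i * u i = Xr ^ i0 * (Xr * (Xr ^ (i - Suc i0) * u i))"
        by (simp add: power_add algebra_simps)
    qed auto
    finally show ?thesis
      by (intro exI[of _ "\<Sum>i\<in>{Suc i0..<b}. Xr ^ (i - Suc i0) * u i"])
        (simp add: distrib_left sum_distrib_left)
  qed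
  obtain V where V: "(\<Sum>i<b. Xr ^ i * r i) = Xr ^ i0 * (r i0 + Xr * V)"
    using split[of r] less by fastforce
  obtain W where W: "(\<Sum>i<b. Xr ^ i * s i) = Xr ^ i0 * (s i0 + Xr * W)"
    using split[of s] less by fastforce
  have "(\<Sum>i<b. Xr ^ i * r i) + smult \<epsilon> (f ^ h * (\<Sum>i<b. Xr ^ i * s i)) = 0"
  proof -
    have sm: "smult \<epsilon> u = [:\<epsilon>:] * u" for u by simp
    show ?thesis
      using zero unfolding Xri sm
      by (simp add: algebra_simps sum.distrib sum_distrib_left del: mult_pCons_left mult_pCons_right)
  qed
  then have "Xr ^ i0 * ((r i0 + Xr * V) + smult \<epsilon> (f ^ h * (s i0 + Xr * W))) = 0"
    unfolding V W by (simp add: algebra_simps smult_add_right)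
  then have "r i0 + Xr * V = - smult \<epsilon> (f ^ h * (s i0 + Xr * W))"
    using Xr0 by (simp add: eq_neg_iff_add_eq_0)
  then have "(r i0 + Xr * V)\<^sup>2 = (smult \<epsilon> (f ^ h * (s i0 + Xr * W)))\<^sup>2"
    by simp
  also have "\<dots> = smult (\<epsilon>\<^sup>2) ((f ^ h)\<^sup>2 * (s i0 + Xr * W)\<^sup>2)"
    by (simp add: smult_power power_mult_distrib)
  also have "(f ^ h)\<^sup>2 = f ^ R * f"
  proof -
    have "h * 2 = Suc R" using R by simp
    then show ?thesis by (metis power_Suc2 power_mult)
  qed
  finally have sq: "(r i0 + Xr * V)\<^sup>2 = f ^ R * f * (s i0 + Xr * W)\<^sup>2"
    using eps by simp
  define c where "c = poly f 0"
  obtain g where g: "f = [:c:] + monom 1 1 * g"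
  proof (cases f)
    case (pCons a p)
    have "f = [:c:] + monom 1 1 * p"
      by (simp add: c_def pCons monom_altdef)
    then show thesis by (rule that)
  qed
  have chp: "prime CHAR('a poly)" "R = CHAR('a poly) ^ e" using char R by auto
  \<comment> \<open>Frobenius leaves only the constant term of \<open>f\<close> below degree
    \<open>R\<close>.\<close>
  have fR: "f ^ R = [:c ^ R:] + Xr * g ^ R"
  proof -
    have "f ^ R = ([:c:] + monom 1 1 * g) ^ R" using g by simp
    also have "\<dots> = [:c:] ^ R + (monom 1 1 * g) ^ R"
      by (rule freshmans_dream'[OF chp])
    also have "\<dots> = [:c ^ R:] + Xr * g ^ R"
      by (simp add: power_mult_distrib Xr_def monom_power poly_const_pow)
    finally show ?thesis .
  qed
  define EE where "EE = (r i0)\<^sup>2 - smult (c ^ R) ((s i0)\<^sup>2 * f)"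
  have "Xr dvd EE"
  proof -
    have "EE = Xr * (g ^ R * f * (s i0 + Xr * W)\<^sup>2 + smult (c ^ R) (f * (2 * s i0 * W + Xr * W\<^sup>2))
        - (2 * r i0 * V + Xr * V\<^sup>2)) + ((r i0 + Xr * V)\<^sup>2 - f ^ R * f * (s i0 + Xr * W)\<^sup>2)"
      unfolding EE_def fR by (simp add: algebra_simps power2_eq_square smult_add_right)
    then show ?thesis unfolding sq by simp
  qed
  moreover have "degree EE < R"
  proof -
    have "degree ((r i0)\<^sup>2) < R"
      using degree_power_le[of "r i0" 2] deg(1)[of i0] by simp
    moreover have "degree (smult (c ^ R) ((s i0)\<^sup>2 * f)) < R"
      using degree_smult_le[of "c ^ R" "(s i0)\<^sup>2 * f"] degree_mult_le[of "(s i0)\<^sup>2" f]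
        degree_power_le[of "s i0" 2] deg(2)[of i0] by simp
    ultimately show ?thesis
      unfolding EE_def by (rule degree_diff_less)
  qed
  ultimately have "EE = 0"
    using dvd_imp_degree_le[of Xr EE] by (auto simp: Xr_def degree_monom_eq)
  then have "(r i0)\<^sup>2 = smult (c ^ R) ((s i0)\<^sup>2 * f)" by (simp add: EE_def)
  from nosq[OF _ this] show ?case using f0 by (simp add: c_def)
qed

text \<open>Bombieri's form of Stepanov's method: the auxiliary polynomial \<open>H\<close> constructed in the proof satisfies
  \<open>H(y)\<^sup>R = G(y)\<close> at every \<open>y\<close> counted, where \<open>G\<close> has been made to vanish identically by a pigeonhole
  argument on the coefficients.\<close>
theorem stepanov_bound:
  fixes f :: "'a::field poly" and F :: "'a set"
  assumes char: "prime CHAR('a)" and R: "R = CHAR('a) ^ e" "R = 2 * h - 1"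
    and F: "finite F" "is_subring F" "coeffs_in F f"
    and f: "poly f 0 \<noteq> 0" "degree f = m" "m > 0" "m < h"
    and nosq: "\<And>\<kappa> u v. \<kappa> \<noteq> 0 \<Longrightarrow> u\<^sup>2 = smult \<kappa> (v\<^sup>2 * f) \<Longrightarrow> u = 0 \<and> v = 0"
    and eps: "\<epsilon>\<^sup>2 = 1"
  shows "2 * card {y. y ^ (R * R) = y \<and> poly f y ^ ((R * R - 1) div 2) = \<epsilon>} \<le> R * R + 4 * m * R"
    (is "2 * card ?Z \<le> _")
proof -
  \<comment> \<open>With this \<open>b\<close> the unknowns outnumber the coefficients of
    \<open>G\<close> by exactly m (h - m), positive because m < h, while the degree of
    \<open>H\<close> stays near R^2/2.\<close>
  define b where "b = h - 1 + m"
  have h0: "h > 0" "odd R" "R > 0" "R \<ge> h" using f R(2) by auto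
  \<comment> \<open>For each i < b, a block of 2h - m entries stores the h coefficients of
    \<open>r i\<close> followed by the h - m coefficients of \<open>s i\<close>. These lengths meet
    the degree conditions of \<open>stepanov_nonzero\<close> and keep the degree of \<open>G\<close>
    below \<open>D\<close>.\<close>
  define I where "I = {..<b} \<times> {..<2 * h - m}"
  define rr where "rr v i = (\<Sum>j<h. monom (v (i, j)) j)" for v :: "nat \<times> nat \<Rightarrow> 'a" and i
  define ss where "ss v i = (\<Sum>j<h - m. monom (v (i, h + j)) j)" for v :: "nat \<times> nat \<Rightarrow> 'a" and i
  define G where "G r s = (\<Sum>i<b. monom 1 i * (r i ^ R + s i ^ R * f ^ h))" for r s :: "nat \<Rightarrow> 'a poly"
  define D where "D = b + R * (h - 1)"
  have chp: "prime CHAR('a poly)" "R = CHAR('a poly) ^ e" using char R by auto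
  have degr: "degree (rr v i) \<le> h - 1" for v i
    unfolding rr_def by (rule degree_sum_monom_le) (use h0 in auto)
  have degs: "degree (ss v i) \<le> h - m - 1" for v i
    unfolding ss_def by (rule degree_sum_monom_le) (use f in auto)
  have G_diff: "G (\<lambda>i. r i - r' i) (\<lambda>i. s i - s' i) = G r s - G r' s'" for r s r' s'
    unfolding G_def frobenius_diff[OF chp]
    by (simp add: algebra_simps sum_subtractf)
  have degG: "degree (G (rr v) (ss v)) < D" for v
  proof -
    have le: "degree (monom 1 i * (rr v i ^ R + ss v i ^ R * f ^ h)) \<le> D - 1" if "i < b" for i
    proof -
      have 1: "degree (rr v i ^ R) \<le> R * (h - 1)"
        using degree_power_le[of "rr v i" R] mult_le_mono2[OF degr[of v i], of R] by (metis mult.commute le_trans)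
      have "degree (ss v i ^ R * f ^ h) \<le> degree (ss v i ^ R) + degree (f ^ h)"
        by (rule degree_mult_le)
      also have "\<dots> \<le> R * (h - m - 1) + m * h"
        using degree_power_le[of "ss v i" R] mult_le_mono2[OF degs[of v i], of R]
          degree_power_le[of f h] f(2) by (metis add_mono mult.commute le_trans)
      also have "\<dots> \<le> R * (h - m - 1) + R * m"
        using h0 by (simp add: mult.commute)
      also have "\<dots> = R * (h - 1)"
        using f by (metis Suc_pred' add.commute add_mult_distrib2 diff_diff_left diff_commute le_add_diff_inverse less_imp_le_nat less_Suc_eq_le zero_less_diff h0(1))
      finally have "degree (rr v i ^ R + ss v i ^ R * f ^ h) \<le> R * (h - 1)"
        using 1 by (simp add: degree_add_le)
      then have "degree (monom 1 i * (rr v i ^ R + ss v i ^ R * f ^ h)) \<le> i + R * (h - 1)"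
        using degree_mult_le[of "monom 1 i" "rr v i ^ R + ss v i ^ R * f ^ h"]
          degree_monom_le[of "1::'a" i] by linarith
      then show ?thesis using that by (simp add: D_def)
    qed
    have "degree (G (rr v) (ss v)) \<le> D - 1"
      unfolding G_def by (rule degree_sum_le) (use le in auto)
    moreover have "D > 0" using f by (simp add: D_def b_def)
    ultimately show ?thesis by simp
  qed
  have GF: "coeff (G (rr v) (ss v)) k \<in> F" if v: "v \<in> I \<rightarrow>\<^sub>E F" for v k
  proof -
    have vF: "v (i, j) \<in> F" if "i < b" "j < 2 * h - m" for i j
      using v that by (auto simp: I_def)
    have "coeffs_in F (rr v i)" "coeffs_in F (ss v i)" if "i < b" for i
      unfolding rr_def ss_def using f that
      by (auto intro!: coeffs_in_sum coeffs_in_monom F vF)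
    then have "coeffs_in F (G (rr v) (ss v))"
      unfolding G_def using F
      by (auto intro!: coeffs_in_sum coeffs_in_monom coeffs_in_mult coeffs_in_add coeffs_in_power simp: is_subring_def)
    then show ?thesis by (simp add: coeffs_in_def)
  qed
  have cardF: "card F \<ge> 2"
  proof -
    have "{0, 1} \<subseteq> F" using F by (auto simp: is_subring_def)
    from card_mono[OF F(1) this] show ?thesis by simp
  qed
  have cardI: "card I > D"
  proof -
    obtain t where t: "h = m + Suc t" using f less_iff_Suc_add by auto
    obtain m' where m': "m = Suc m'" using f by (cases m) auto
    show ?thesis unfolding I_def D_def b_def R(2) t m' by (simp add: algebra_simps)
  qed
  have "finite I" by (simp add: I_def)
  from exists_collision[OF F(1) cardF this cardI, of "\<lambda>v. coeff (G (rr v) (ss v))"] GF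
  obtain v w where vw: "v \<in> I \<rightarrow>\<^sub>E F" "w \<in> I \<rightarrow>\<^sub>E F" "v \<noteq> w"
    and eq: "\<And>k. k < D \<Longrightarrow> coeff (G (rr v) (ss v)) k = coeff (G (rr w) (ss w)) k"
    by blast
  have "coeff (G (rr v) (ss v)) k = coeff (G (rr w) (ss w)) k" for k
    using eq[of k] degG[of v] degG[of w] by (cases "k < D") (auto simp: coeff_eq_0)
  then have Geq: "G (rr v) (ss v) = G (rr w) (ss w)" by (simp add: poly_eq_iff)
  define r where "r i = rr v i - rr w i" for i
  define s where "s i = ss v i - ss w i" for i
  have G0: "G r s = 0"
    unfolding r_def s_def G_diff using Geq by simp
  have dr: "degree (r i) \<le> h - 1" and ds: "degree (s i) \<le> h - m - 1" for i
    unfolding r_def s_def using degr degs by (auto intro!: degree_diff_le)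
  define H where "H = (\<Sum>i<b. monom 1 (i * R) * (r i + smult \<epsilon> (s i * f ^ h)))"
  have "H \<noteq> 0"
  proof
    assume "H = 0"
    have "r i = 0 \<and> s i = 0" if "i < b" for i
    proof (rule stepanov_nonzero[OF char R h0(1) f(1) nosq])
      show "2 * degree (r i) < R" for i using dr[of i] R h0 by linarith
      show "2 * degree (s i) + degree f < R" for i using ds[of i] R f by linarith
      show "\<epsilon>\<^sup>2 = 1" by fact
      show "(\<Sum>i<b. monom 1 (i * R) * (r i + smult \<epsilon> (s i * f ^ h))) = 0"
        using \<open>H = 0\<close> by (simp add: H_def)
    qed (use that in auto)
    then have z: "rr v i = rr w i" "ss v i = ss w i" if "i < b" for i
      using that by (auto simp: r_def s_def)
    have "v x = w x" for x
    proof (cases "x \<in> I")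
      case False
      then show ?thesis using vw by (metis PiE_arb)
    next
      case True
      then obtain i j where x: "x = (i, j)" "i < b" "j < 2 * h - m" by (auto simp: I_def)
      show ?thesis
      proof (cases "j < h")
        case True
        have "coeff (rr v i) j = coeff (rr w i) j" using z x by simp
        then show ?thesis unfolding rr_def coeff_sum_monom using True x by simp
      next
        case False
        have "coeff (ss v i) (j - h) = coeff (ss w i) (j - h)" using z x by simp
        then show ?thesis unfolding ss_def coeff_sum_monom using False x f by (simp split: if_splits)
      qed
    qed
    with vw show False by blast
  qed
  have "?Z \<subseteq> {y. poly H y = 0}"
  proof (intro subsetI CollectI)
    fix y assume "y \<in> ?Z"
    then have y: "y ^ (R * R) = y" "poly f y ^ ((R * R - 1) div 2) = \<epsilon>" by auto
    \<comment> \<open>Since h = (R + 1)/2, the product R h exceeds (R^2 - 1)/2 by exactly h, so at a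
      counted y the R-th power of \<open>f^h\<close> is \<open>\<epsilon>\<close> times
      \<open>f^h\<close>. This sign cancels against \<open>\<epsilon>^R\<close> because R + 1 is
      even, which is why \<open>G\<close> does not involve \<open>\<epsilon>\<close>.\<close>
    have R': "R * h = (R * R - 1) div 2 + h"
    proof -
      have "R * R - 1 = 2 * ((R - 1) * h)" unfolding R(2) using h0(1)
        by (cases h) (auto simp: algebra_simps)
      then have "(R * R - 1) div 2 = (R - 1) * h" by simp
      then show ?thesis using h0 by (cases R) auto
    qed
    have eR: "\<epsilon> ^ R * \<epsilon> = 1"
      using eps h0 by (metis R(2) Suc_pred' add_gr_0 h0(3) mult_2 one_power2 power_Suc2 power_mult power_one mult.commute Suc_diff_1)
    have "poly H y ^ R = (\<Sum>i<b. y ^ (i * R) * (poly (r i) y + \<epsilon> * (poly (s i) y * poly f y ^ h))) ^ R"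
      by (simp add: H_def poly_sum poly_monom)
    also have "\<dots> = (\<Sum>i<b. (y ^ (i * R) * (poly (r i) y + \<epsilon> * (poly (s i) y * poly f y ^ h))) ^ R)"
      by (rule freshmans_dream_sum'[OF char R(1)])
    also have "\<dots> = (\<Sum>i<b. y ^ i * (poly (r i) y ^ R + poly (s i) y ^ R * poly f y ^ h))"
    proof (rule sum.cong)
      fix i
      have 1: "(y ^ (i * R)) ^ R = y ^ i"
      proof -
        have "(y ^ (i * R)) ^ R = (y ^ (R * R)) ^ i"
          by (simp add: mult_ac flip: power_mult)
        then show ?thesis using y by simp
      qed
      have 2: "(poly f y ^ h) ^ R = \<epsilon> * poly f y ^ h"
      proof -
        have "(poly f y ^ h) ^ R = poly f y ^ (R * h)"
          by (simp add: mult.commute flip: power_mult)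
        then show ?thesis unfolding R' by (simp only: power_add y(2))
      qed
      have 3: "\<epsilon> ^ R * ((x ^ R) * (\<epsilon> * z)) = x ^ R * z" for x z :: 'a
        using eR by (metis (no_types, lifting) mult.assoc mult.commute mult.right_neutral)
      show "(y ^ (i * R) * (poly (r i) y + \<epsilon> * (poly (s i) y * poly f y ^ h))) ^ R
          = y ^ i * (poly (r i) y ^ R + poly (s i) y ^ R * poly f y ^ h)"
        by (simp add: power_mult_distrib freshmans_dream'[OF char R(1)] 1 2 3)
    qed auto
    also have "\<dots> = poly (G r s) y"
      by (simp add: G_def poly_sum poly_monom)
    finally show "poly H y = 0" using G0 h0 by simp
  qed
  then have "card ?Z \<le> card {y. poly H y = 0}"
    by (intro card_mono poly_roots_finite \<open>H \<noteq> 0\<close>)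
  also have "\<dots> \<le> degree H" using \<open>H \<noteq> 0\<close> by (rule card_poly_roots_bound)
  also have "\<dots> \<le> (b - 1) * R + (h + m * h)"
    unfolding H_def
  proof (rule degree_sum_le)
    fix i assume i: "i \<in> {..<b}"
    have "degree (smult \<epsilon> (s i * f ^ h)) \<le> h + m * h"
      using degree_smult_le[of \<epsilon> "s i * f ^ h"] degree_mult_le[of "s i" "f ^ h"] ds[of i]
        degree_power_le[of f h] f(2) by simp
    then have "degree (r i + smult \<epsilon> (s i * f ^ h)) \<le> h + m * h"
      using dr[of i] by (intro degree_add_le) auto
    then have "degree (monom 1 (i * R) * (r i + smult \<epsilon> (s i * f ^ h))) \<le> i * R + (h + m * h)"
      using degree_mult_le[of "monom 1 (i * R)" "r i + smult \<epsilon> (s i * f ^ h)"]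
          degree_monom_le[of "1::'a" "i * R"] by linarith
    also have "i * R \<le> (b - 1) * R" using i by (intro mult_le_mono1) auto
    finally show "degree (monom 1 (i * R) * (r i + smult \<epsilon> (s i * f ^ h))) \<le> (b - 1) * R + (h + m * h)"
      by simp
  qed auto
  finally have "2 * card ?Z \<le> 2 * ((b - 1) * R + (h + m * h))" by simp
  \<comment> \<open>The left side equals R^2 + (3m - 2) R + m + 1.\<close>
  also have "\<dots> \<le> R * R + 4 * m * R"
  proof -
    obtain t where t: "h = m + Suc t" using f less_iff_Suc_add by auto
    obtain m' where m': "m = Suc m'" using f by (cases m) auto
    show ?thesis unfolding b_def R(2) t m' by (simp add: algebra_simps)
  qed
  finally show ?thesis .
qed

section \<open>Finite subfields of an algebraically closed field\<close>

text \<open>Fixed points of an iterate of Frobenius: the field with p^n elements for n > 0, but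
  everything for n = 0. Keeping all levels inside one algebraically closed field makes the passage
  between degrees an inclusion.\<close>

definition gf :: "nat \<Rightarrow> 'k::field set" where
  "gf n = {x. x ^ (CHAR('k) ^ n) = x}"

definition gf_trace :: "nat \<Rightarrow> 'k::field \<Rightarrow> 'k" where
  "gf_trace n z = (\<Sum>i<n. z ^ (CHAR('k) ^ i))"

text \<open>The phase depends only on k modulo the characteristic, so any representative serves.
  Outside the prime field there is no representative and the value is arbitrary, though still of
  modulus 1.\<close>

definition prime_field_char :: "'k::field \<Rightarrow> complex" where
  "prime_field_char t = cis (2 * pi * real (SOME k. of_nat k = t) / real CHAR('k))"

definition gf_char :: "nat \<Rightarrow> 'k::field \<Rightarrow> complex" where
  "gf_char n z = prime_field_char (gf_trace n z)"

text \<open>Splitting off a linear factor preserves the hypothesis, and the derivative condition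
  keeps the removed root from being a root of the cofactor. Its use is to give \<open>gf n\<close>
  the right number of elements.\<close>

lemma card_roots_separable:
  fixes f :: "'a::alg_closed_field poly"
  assumes "f \<noteq> 0" "\<And>x. poly f x = 0 \<Longrightarrow> poly (pderiv f) x \<noteq> 0"
  shows "card {x. poly f x = 0} = degree f"
  using assms
proof (induction "degree f" arbitrary: f)
  case 0
  then obtain c where "f = [:c:]" "c \<noteq> 0" by (metis degree_eq_zeroE pCons_0_0)
  then show ?case by simp
next
  case (Suc n)
  then obtain a where a: "poly f a = 0" using alg_closed_imp_poly_has_root[of f] by auto
  then obtain g where g: "f = [:-a, 1:] * g" by (auto simp: poly_eq_0_iff_dvd)
  have g0: "g \<noteq> 0" using Suc g by auto
  have deg: "degree f = Suc (degree g)" unfolding g using g0 by (simp add: degree_mult_eq del: mult_pCons_left)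
  have der: "poly (pderiv f) x = poly g x + (x - a) * poly (pderiv g) x" for x
    unfolding g by (simp add: pderiv_mult pderiv_pCons del: mult_pCons_left)
  have ga: "poly g a \<noteq> 0" using Suc.prems(2)[OF a] der[of a] by simp
  have "card {x. poly g x = 0} = degree g"
  proof (rule Suc.hyps(1))
    show "n = degree g" using Suc.hyps(2) deg by simp
    show "g \<noteq> 0" by fact
    fix x assume x: "poly g x = 0"
    then have "poly f x = 0" unfolding g by simp
    from Suc.prems(2)[OF this] show "poly (pderiv g) x \<noteq> 0" using der[of x] x by auto
  qed
  moreover have "{x. poly f x = 0} = insert a {x. poly g x = 0}"
    unfolding g by (auto simp del: mult_pCons_left)
  ultimately show ?case using deg ga poly_roots_finite[OF g0] by simp
qed

locale odd_char_field =
  fixes p :: nat and field_type :: "'k::alg_closed_field itself"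
  assumes p: "CHAR('k) = p" "prime p" "odd p"
begin

lemma p_gt: "p > 2"
  using p prime_gt_1_nat[of p] by (cases "p = 2") auto

lemma primeCHAR: "prime CHAR('k)" using p by simp

lemma of_nat_p: "of_nat p = (0::'k)" using of_nat_CHAR[where 'a='k] p by simp

lemma two_neq_zero: "(2::'k) \<noteq> 0"
proof
  assume "(2::'k) = 0"
  then have "of_nat 2 = (0::'k)" by simp
  then have "p dvd 2" unfolding of_nat_eq_0_iff_char_dvd p .
  then show False using p_gt by (auto dest: dvd_imp_le)
qed

lemma four_neq_zero: "(4::'k) \<noteq> 0"
  using two_neq_zero by (metis mult_eq_0_iff numeral_Bit0_eq_double numeral_Bit0 one_add_one mult_2)

lemma frob_add: "((x::'k) + y) ^ (p ^ n) = x ^ (p ^ n) + y ^ (p ^ n)"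
  using freshmans_dream'[OF primeCHAR, of "p ^ n" n] p by simp

lemma frob_diff: "((x::'k) - y) ^ (p ^ n) = x ^ (p ^ n) - y ^ (p ^ n)"
  using frobenius_diff[OF primeCHAR, of "p ^ n" n] p by simp

lemma frob_minus: "(- (x::'k)) ^ (p ^ n) = - (x ^ (p ^ n))"
  using frob_diff[of 0 x n] p_gt by simp

lemma frob_sum: "(sum f I :: 'k) ^ (p ^ n) = (\<Sum>i\<in>I. f i ^ (p ^ n))"
  using freshmans_dream_sum'[OF primeCHAR, of "p ^ n" n f I] p by simp

lemma gf_iff: "(x::'k) \<in> gf n \<longleftrightarrow> x ^ (p ^ n) = x"
  by (simp add: gf_def p)

lemma gf_add: "(x::'k) \<in> gf n \<Longrightarrow> y \<in> gf n \<Longrightarrow> x + y \<in> gf n"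
  by (simp add: gf_iff frob_add)

lemma gf_diff: "(x::'k) \<in> gf n \<Longrightarrow> y \<in> gf n \<Longrightarrow> x - y \<in> gf n"
  by (simp add: gf_iff frob_diff)

lemma gf_minus: "(x::'k) \<in> gf n \<Longrightarrow> - x \<in> gf n"
  by (simp add: gf_iff frob_minus)

lemma gf_mult: "(x::'k) \<in> gf n \<Longrightarrow> y \<in> gf n \<Longrightarrow> x * y \<in> gf n"
  by (simp add: gf_iff power_mult_distrib)

lemma gf_divide: "(x::'k) \<in> gf n \<Longrightarrow> y \<in> gf n \<Longrightarrow> x / y \<in> gf n"
  by (simp add: gf_iff power_divide)

lemma gf_0: "(0::'k) \<in> gf n" and gf_1: "(1::'k) \<in> gf n"
  using p_gt by (auto simp: gf_iff)

lemma gf_of_nat: "(of_nat k::'k) \<in> gf n"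
  by (induction k) (auto intro: gf_add gf_0 gf_1)

lemma gf_numeral: "(numeral k::'k) \<in> gf n"
  using gf_of_nat[of "numeral k"] by simp

lemma gf_power: "(x::'k) \<in> gf n \<Longrightarrow> x ^ i \<in> gf n"
  by (induction i) (auto intro: gf_mult gf_1)

lemma gf_frob: "(x::'k) \<in> gf n \<Longrightarrow> x ^ (p ^ n) = x"
  by (simp add: gf_iff)

lemma is_subring_gf: "is_subring (gf n :: 'k set)"
  by (auto simp: is_subring_def gf_0 gf_1 intro: gf_add gf_mult gf_minus)

lemma gf_card: 
  assumes "n > 0"
  shows "finite (gf n :: 'k set)" "card (gf n :: 'k set) = p ^ n"
proof -
  have pn: "p ^ n > 1" by (rule one_less_power) (use p_gt assms in auto)
  define f :: "'k poly" where "f = monom 1 (p ^ n) - monom 1 1"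
  have pf: "poly f x = x ^ (p ^ n) - x" for x by (simp add: f_def poly_monom)
  have "coeff f (p ^ n) = 1" using pn by (simp add: f_def coeff_monom)
  then have f0: "f \<noteq> 0" by auto
  have deg: "degree f = p ^ n"
  proof (rule antisym)
    show "degree f \<le> p ^ n" unfolding f_def using pn
      by (intro degree_diff_le order.trans[OF degree_monom_le]) auto
    show "p ^ n \<le> degree f" using \<open>coeff f (p ^ n) = 1\<close> by (intro le_degree) simp
  qed
  have "poly (pderiv f) x = -1" for x
    using assms of_nat_p by (simp add: f_def pderiv_diff pderiv_monom poly_monom power_0_left)
  then have "card {x. poly f x = 0} = p ^ n"
    using card_roots_separable[OF f0] deg by simp
  moreover have "{x. poly f x = 0} = gf n" by (auto simp: pf gf_iff)
  ultimately show "card (gf n :: 'k set) = p ^ n" "finite (gf n :: 'k set)"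
    using poly_roots_finite[OF f0] by auto
qed

lemma gf_mono: "n dvd n' \<Longrightarrow> (x::'k) \<in> gf n \<Longrightarrow> x \<in> gf n'"
proof -
  assume x: "x \<in> gf n" and "n dvd n'"
  then obtain k where k: "n' = n * k" by auto
  have "x ^ (p ^ (n * k)) = x"
    by (induction k) (use x in \<open>auto simp: gf_iff power_add power_mult\<close>)
  then show ?thesis by (simp add: gf_iff k)
qed

lemma gf_1_eq: "(gf 1 :: 'k set) = of_nat ` {..<p}"
proof -
  have *: "x = y" if "x \<le> y" "y < p" "(of_nat x :: 'k) = of_nat y" for x y
  proof -
    have "(of_nat (y - x) :: 'k) = 0" using that by (simp add: of_nat_diff)
    then have "p dvd y - x" unfolding of_nat_eq_0_iff_char_dvd p .
    then show ?thesis using that by (auto dest: dvd_imp_le)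
  qed
  have "inj_on (of_nat :: nat \<Rightarrow> 'k) {..<p}"
    by (rule inj_onI) (metis * lessThan_iff nat_le_linear)
  then have "card (of_nat ` {..<p} :: 'k set) = p" by (simp add: card_image)
  moreover have "(of_nat ` {..<p} :: 'k set) \<subseteq> gf 1" by (auto intro: gf_of_nat)
  ultimately show ?thesis
    using gf_card[of 1] by (metis card_subset_eq power_one_right zero_less_one)
qed

section \<open>Additive characters of the finite subfields\<close>

lemma prime_field_char_of_nat:
  "prime_field_char (of_nat k :: 'k) = cis (2 * pi * real k / real p)"
proof -
  define k' where "k' = (SOME j. of_nat j = (of_nat k :: 'k))"
  have "of_nat k' = (of_nat k :: 'k)" unfolding k'_def by (rule someI[of _ k]) simp
  have "\<exists>j::int. int k' = int k + int p * j"
  proof (cases "k \<le> k'")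
    case True
    then have "(of_nat (k' - k) :: 'k) = 0" using \<open>of_nat k' = of_nat k\<close> by (simp add: of_nat_diff)
    then have "p dvd k' - k" unfolding of_nat_eq_0_iff_char_dvd p .
    then obtain j where "k' - k = p * j" by auto
    then show ?thesis using True by (intro exI[of _ "int j"]) (simp flip: of_nat_mult)
  next
    case False
    then have "(of_nat (k - k') :: 'k) = 0" using \<open>of_nat k' = of_nat k\<close> by (simp add: of_nat_diff)
    then have "p dvd k - k'" unfolding of_nat_eq_0_iff_char_dvd p .
    then obtain j where "k - k' = p * j" by auto
    then show ?thesis using False by (intro exI[of _ "- int j"]) (simp flip: of_nat_mult)
  qed
  then obtain j :: int where "int k' = int k + int p * j" by blast
  then have "real k' = real k + real p * of_int j"
    by (metis of_int_add of_int_mult of_int_of_nat_eq)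
  then have "2 * pi * real k' / real p = 2 * pi * real k / real p + 2 * pi * of_int j"
    using p_gt by (simp add: field_simps)
  then have "cis (2 * pi * real k' / real p) = cis (2 * pi * real k / real p) * cis (2 * pi * of_int j)"
    by (simp only: cis_mult)
  also have "cis (2 * pi * of_int j) = 1" by (rule cis_multiple_2pi) simp
  finally show ?thesis by (simp add: prime_field_char_def k'_def p)
qed

lemma prime_field_char_add:
  assumes "(x::'k) \<in> gf 1" "y \<in> gf 1"
  shows "prime_field_char (x + y) = prime_field_char x * prime_field_char y"
proof -
  obtain k l where "x = of_nat k" "y = of_nat l" using assms unfolding gf_1_eq by auto
  then show ?thesis
    using prime_field_char_of_nat[of "k + l"]
    by (simp add: prime_field_char_of_nat cis_mult add_divide_distrib distrib_left)
qed

lemma prime_field_char_eq_1: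
  assumes "(x::'k) \<in> gf 1" "x \<noteq> 0"
  shows "\<exists>k. prime_field_char (of_nat k * x) \<noteq> 1"
proof -
  have "1 / x \<in> gf 1" using assms by (intro gf_divide gf_1)
  then obtain k where k: "1 / x = of_nat k" unfolding gf_1_eq by auto
  then have "of_nat k * x = of_nat 1" using assms by (simp add: field_simps)
  then have 1: "prime_field_char (of_nat k * x) = cis (2 * pi / real p)"
    using prime_field_char_of_nat[of 1] by simp
  have "cis (2 * pi / real p) \<noteq> 1"
  proof
    assume "cis (2 * pi / real p) = 1"
    then have "cos (2 * pi / real p) = 1" by (simp add: cis.ctr complex_eq_iff)
    moreover have "cos (2 * pi / real p) < cos 0"
      using p_gt pi_gt_zero by (intro cos_monotone_0_pi) (auto simp: field_simps)
    ultimately show False by simp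
  qed
  with 1 show ?thesis by metis
qed

lemma trace_add: "gf_trace n ((x::'k) + y) = gf_trace n x + gf_trace n y"
  by (simp add: gf_trace_def p frob_add sum.distrib)

lemma trace_frob:
  assumes "(z::'k) \<in> gf n"
  shows "gf_trace n (z ^ p) = gf_trace n z"
proof -
  have "gf_trace n (z ^ p) = (\<Sum>i<n. z ^ (p ^ Suc i))"
    by (simp add: gf_trace_def p flip: power_mult)
  also have "\<dots> = (\<Sum>i<Suc n. z ^ (p ^ i)) - z"
    by (subst sum.lessThan_Suc_shift) simp
  also have "\<dots> = gf_trace n z" using gf_frob[OF assms] by (simp add: gf_trace_def p)
  finally show ?thesis .
qed

lemma trace_in_gf_1: "(z::'k) \<in> gf n \<Longrightarrow> gf_trace n z \<in> gf 1"
proof -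
  assume z: "z \<in> gf n"
  have "gf_trace n z ^ p = gf_trace n (z ^ p)"
    using frob_sum[of "\<lambda>i. z ^ p ^ i" "{..<n}" 1]
    by (simp add: gf_trace_def p mult.commute flip: power_mult)
  then show ?thesis using trace_frob[OF z] by (simp add: gf_iff)
qed

lemma trace_frob_pow:
  assumes "(z::'k) \<in> gf n"
  shows "gf_trace n (z ^ (p ^ k)) = gf_trace n z"
proof (induction k)
  case (Suc k)
  have "z ^ (p ^ Suc k) = (z ^ (p ^ k)) ^ p" by (simp add: mult.commute flip: power_mult)
  then show ?case using trace_frob[OF gf_power[OF assms, of "p ^ k"]] Suc by simp
qed auto

text \<open>The trace is a nonzero polynomial of degree at most p^(n-1), too low to vanish at p^n
  points.\<close>

lemma trace_nontrivial:
  assumes "n > 0"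
  shows "\<exists>z\<in>gf n. gf_trace n z \<noteq> (0::'k)"
proof (rule ccontr)
  assume "\<not> ?thesis"
  then have z: "gf_trace n z = 0" if "z \<in> gf n" for z :: 'k using that by auto
  define f :: "'k poly" where "f = (\<Sum>i<n. monom 1 (p ^ i))"
  have "coeff f (p ^ (n - 1)) = (\<Sum>i<n. if i = n - 1 then 1 else 0)"
    unfolding f_def coeff_sum coeff_monom
    by (intro sum.cong) (use p_gt in \<open>auto simp: power_inject_exp\<close>)
  also have "\<dots> = 1" using assms by simp
  finally have f0: "f \<noteq> 0" by auto
  have "degree f \<le> p ^ (n - 1)"
    unfolding f_def
    by (intro degree_sum_le order.trans[OF degree_monom_le]) (use p_gt in \<open>auto intro!: power_increasing\<close>)
  also have "\<dots> < p ^ n" using p_gt assms by (intro power_strict_increasing) auto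
  also have "p ^ n = card (gf n :: 'k set)" using gf_card assms by simp
  also have "\<dots> \<le> card {x. poly f x = 0}"
    by (intro card_mono poly_roots_finite[OF f0]) (use z in \<open>auto simp: f_def poly_sum poly_monom gf_trace_def p\<close>)
  also have "\<dots> \<le> degree f" by (rule card_poly_roots_bound[OF f0])
  finally show False by simp
qed

lemma gf_char_add:
  "(x::'k) \<in> gf n \<Longrightarrow> y \<in> gf n \<Longrightarrow> gf_char n (x + y) = gf_char n x * gf_char n y"
  using prime_field_char_add[OF trace_in_gf_1 trace_in_gf_1] by (simp add: gf_char_def trace_add)

lemma gf_char_0: "gf_char n (0::'k) = 1"
proof -
  have "gf_trace n (0::'k) = of_nat 0" using p_gt by (simp add: gf_trace_def p power_0_left)
  then show ?thesis unfolding gf_char_def using prime_field_char_of_nat[of 0] by simp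
qed

lemma norm_gf_char: "norm (gf_char n (x::'k)) = 1"
  by (simp add: gf_char_def prime_field_char_def)

lemma gf_char_minus: "(x::'k) \<in> gf n \<Longrightarrow> gf_char n (- x) = cnj (gf_char n x)"
proof -
  assume x: "x \<in> gf n"
  have "gf_char n x * gf_char n (- x) = 1"
    using gf_char_add[OF x gf_minus[OF x]] gf_char_0 by simp
  moreover have "gf_char n x * cnj (gf_char n x) = 1"
    by (simp add: complex_norm_square[symmetric] norm_gf_char)
  moreover have "gf_char n x \<noteq> 0" using norm_gf_char[of n x] by auto
  ultimately show ?thesis by (metis mult_cancel_left)
qed

lemma gf_char_nontrivial:
  assumes "n > 0" "(c::'k) \<in> gf n" "c \<noteq> 0"
  shows "\<exists>x\<in>gf n. gf_char n (c * x) \<noteq> 1"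
proof -
  obtain z where z: "z \<in> gf n" "gf_trace n z \<noteq> (0::'k)" using trace_nontrivial assms by blast
  obtain k where k: "prime_field_char (of_nat k * gf_trace n z) \<noteq> 1"
    using prime_field_char_eq_1[OF trace_in_gf_1[OF z(1)] z(2)] by blast
  have "gf_trace n (of_nat k * z) = of_nat k * gf_trace n z"
    by (simp add: gf_trace_def p power_mult_distrib sum_distrib_left gf_frob[OF gf_of_nat])
  then have "gf_char n (of_nat k * z) \<noteq> 1" using k by (simp add: gf_char_def)
  moreover have "of_nat k * z / c \<in> gf n" using assms z by (intro gf_divide gf_mult gf_of_nat)
  ultimately show ?thesis using assms by (intro bexI[of _ "of_nat k * z / c"]) auto
qed

lemma gf_char_orth:
  assumes "n > 0" "(c::'k) \<in> gf n"
  shows "(\<Sum>x\<in>gf n. gf_char n (c * x)) = (if c = 0 then of_nat (p ^ n) else 0)"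
proof (cases "c = 0")
  case True
  then show ?thesis using gf_card[of n] assms by (simp add: gf_char_0)
next
  case False
  obtain y where y: "y \<in> gf n" "gf_char n (c * y) \<noteq> 1" using gf_char_nontrivial[OF assms False] by blast
  have "(\<Sum>x\<in>gf n. gf_char n (c * x)) = (\<Sum>x\<in>gf n. gf_char n (c * (x + y)))"
    by (rule sum.reindex_bij_witness[of _ "\<lambda>x. x + y" "\<lambda>x. x - y"]) (use y in \<open>auto intro: gf_add gf_diff\<close>)
  also have "\<dots> = (\<Sum>x\<in>gf n. gf_char n (c * x)) * gf_char n (c * y)"
    unfolding sum_distrib_right
    by (intro sum.cong) (use y assms in \<open>auto simp: distrib_left gf_char_add gf_mult\<close>)
  finally show ?thesis using y False by auto
qed

text \<open>Transitivity of the trace: the 2n Frobenius powers split into two halves, so the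
  absolute trace factors through the relative trace z + z^Q with Q = p^n.\<close>

lemma gf_char_double:
  "gf_char (2 * n) (z::'k) = gf_char n (z + z ^ (p ^ n))"
proof -
  have "gf_trace (2 * n) z = (\<Sum>i<n. z ^ (p ^ i)) + (\<Sum>i<n. z ^ (p ^ (n + i)))"
    using sum.atLeastLessThan_concat[of 0 n "2 * n" "\<lambda>i. z ^ (p ^ i)"]
      sum.shift_bounds_nat_ivl[of "\<lambda>i. z ^ (p ^ i)" 0 n n]
    by (simp add: gf_trace_def p mult_2 atLeast0LessThan add.commute)
  also have "(\<Sum>i<n. z ^ (p ^ (n + i))) = gf_trace n (z ^ (p ^ n))"
    by (simp add: gf_trace_def p power_add flip: power_mult)
  finally have "gf_trace (2 * n) z = gf_trace n z + gf_trace n (z ^ (p ^ n))"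
    by (simp add: gf_trace_def p)
  then show ?thesis by (simp add: gf_char_def trace_add)
qed

section \<open>Kloosterman sums\<close>

text \<open>The factor \<open>\<kappa>\<close> runs through the twists of one fixed character; at
  \<open>\<kappa> = 0\<close> the sum is just the number of nonzero elements.\<close>

definition kloosterman :: "nat \<Rightarrow> 'k \<Rightarrow> 'k \<Rightarrow> complex" where
  "kloosterman n \<kappa> a = (\<Sum>x\<in>gf n - {0}. gf_char n (\<kappa> * (x + a / x)))"

lemma kloosterman_real:
  assumes "n > 0" "\<kappa> \<in> gf n" "a \<in> gf n"
  shows "kloosterman n \<kappa> a = of_real (Re (kloosterman n \<kappa> a))"
proof -
  have "cnj (kloosterman n \<kappa> a) = (\<Sum>x\<in>gf n - {0}. gf_char n (- (\<kappa> * (x + a / x))))"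
    unfolding kloosterman_def cnj_sum
    by (intro sum.cong refl gf_char_minus[symmetric]) (use assms in \<open>auto intro!: gf_mult gf_add gf_divide\<close>)
  also have "\<dots> = kloosterman n \<kappa> a"
    unfolding kloosterman_def
  proof (rule sum.reindex_bij_witness[of _ uminus uminus])
    fix x :: 'k assume "x \<in> gf n - {0}"
    then show "- x \<in> gf n - {0}" using gf_minus[of x n] by simp
    have "- x + a / - x = - (x + a / x)" by simp
    then show "gf_char n (\<kappa> * (- x + a / - x)) = gf_char n (- (\<kappa> * (x + a / x)))"
      by (simp only: mult_minus_right)
  next
    fix x :: 'k assume "x \<in> gf n - {0}"
    then show "- x \<in> gf n - {0}" using gf_minus[of x n] by simp
  qed auto
  finally show ?thesis by (metis Reals_cnj_iff of_real_Re)
qed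

lemma quadratic_roots:
  obtains z w :: 'k where "z + w = s" "z * w = P"
proof -
  have "degree [:P, -s, 1:] > 0" by simp
  then obtain z where "poly [:P, -s, 1:] z = 0" using alg_closed_imp_poly_has_root by blast
  then have "z * (s - z) = P" by (simp add: algebra_simps)
  then show thesis by (intro that[of z "s - z"]) auto
qed

text \<open>Either both roots of a quadratic lie in the small field or Frobenius swaps them.\<close>
lemma quadratic_count:
  fixes s P :: 'k
  assumes n: "n > 0" and sP: "s \<in> gf n" "P \<in> gf n" "P \<noteq> 0"
  shows "card {x \<in> (gf n - {0}) \<times> (gf n - {0}). (fst x + snd x, fst x * snd x) = (s, P)}
    + card {z \<in> gf (2 * n) - {0}. (z + z ^ (p ^ n), z * z ^ (p ^ n)) = (s, P)} = 2" (is "card ?A + card ?B = 2")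
proof -
  define fr where "fr = (\<lambda>z::'k. z ^ (p ^ n))"
  have frs: "fr s = s" "fr P = P" using sP by (auto simp: fr_def gf_iff)
  have fr_diff: "fr (x - y) = fr x - fr y" for x y by (simp add: fr_def frob_diff)
  have gff: "x \<in> gf n \<longleftrightarrow> fr x = x" for x by (simp add: gf_iff fr_def)
  have gf2: "x \<in> gf (2 * n) \<longleftrightarrow> fr (fr x) = x" for x
    by (simp add: gf_iff fr_def mult_2 power_add flip: power_mult)
  obtain z w where zw: "z + w = s" "z * w = P" by (rule quadratic_roots)
  have w: "w = s - z" using zw by (auto simp: algebra_simps)
  have zw0: "z \<noteq> 0" "w \<noteq> 0" using zw sP by auto
  have roots: "x = z \<or> x = w" if "x + y = s" "x * y = P" for x y
  proof -
    have "(x - z) * (x - w) = x * x - (z + w) * x + z * w" by (simp add: algebra_simps)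
    also have "\<dots> = 0" unfolding zw using that by (auto simp: algebra_simps)
    finally show ?thesis by auto
  qed
  have "fr z + fr w = s" by (simp add: w fr_diff frs)
  moreover have "fr z * fr w = P"
    using frs(2) zw(2) by (metis fr_def power_mult_distrib)
  ultimately have frz: "fr z = z \<or> fr z = w" by (rule roots)
  have A: "?A = {(x, s - x) | x. x \<in> {z, w} \<and> fr x = x}"
  proof (rule Set.set_eqI, rule iffI)
    fix q assume "q \<in> ?A"
    then show "q \<in> {(x, s - x) | x. x \<in> {z, w} \<and> fr x = x}"
      using roots[of "fst q" "snd q"] by (cases q) (auto simp: gff)
  next
    fix q assume "q \<in> {(x, s - x) | x. x \<in> {z, w} \<and> fr x = x}"
    then obtain x where x: "q = (x, s - x)" "x \<in> {z, w}" "fr x = x" by blast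
    have "fr (s - x) = s - x" using x frs by (simp add: fr_diff)
    moreover have "x * (s - x) = P" "x \<noteq> 0" "s - x \<noteq> 0" using x(2) zw(2) zw0 zw(1) by (auto simp: mult.commute)
    ultimately show "q \<in> ?A" using x by (simp add: gff)
  qed
  have B: "?B = {x \<in> {z, w}. fr x = s - x}"
  proof (rule Set.set_eqI, rule iffI)
    fix x assume "x \<in> ?B"
    then show "x \<in> {x \<in> {z, w}. fr x = s - x}"
      using roots[of x "fr x"] by (auto simp: fr_def algebra_simps)
  next
    fix x assume x: "x \<in> {x \<in> {z, w}. fr x = s - x}"
    then have "fr (fr x) = x" by (auto simp: fr_diff frs)
    moreover have "x * fr x = P" using x zw by (auto simp: w algebra_simps)
    moreover have "x + fr x = s" using x by auto
    ultimately show "x \<in> ?B" using x zw0 gf2[of x] by (auto simp: fr_def)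
  qed
  show ?thesis
  proof (cases "fr z = z")
    case True
    then have "fr w = w" by (simp add: w fr_diff frs)
    show ?thesis
    \<comment> \<open>A double root is counted once on each side; two distinct roots in the small
      field are counted twice as ordered pairs and never on the other side.\<close>
    proof (cases "z = w")
      case True
      then have AB: "?A = {(z, s - z)}" "?B = {z}" unfolding A B using \<open>fr z = z\<close> w by auto
      show ?thesis unfolding AB by simp
    next
      case False
      then have AB: "?A = {(z, s - z), (w, s - w)}" "?B = {}"
        unfolding A B using \<open>fr z = z\<close> \<open>fr w = w\<close> w zw(1) by auto
      show ?thesis unfolding AB using False by simp
    qed
  next
    case False
    then have "fr z = w" using frz by simp
    then have "z \<noteq> w" "fr w = z" using False by (auto simp: w fr_diff frs)
    then have AB: "?A = {}" "?B = {z, w}"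
      unfolding A B using \<open>fr z = w\<close> w zw(1) by auto
    show ?thesis unfolding AB using \<open>z \<noteq> w\<close> by simp
  qed
qed

text \<open>Behind this is the factorisation Kl(Q) = -(\<alpha> + \<beta>), Kl(Q^2) = -(\<alpha>^2 +
  \<beta>^2) with \<alpha>\<beta> = Q. The direct argument writes Kl(Q)^2 and Kl(Q^2) as sums of the
  same function of (s, P), where s is a sum or relative trace and P a product or norm. By
  \<open>quadratic_count\<close> the multiplicities add up to 2 for every (s, P), and the sum over
  the now free s leaves only P = -a.\<close>

theorem kloosterman_double:
  assumes n: "n > 0" and k: "\<kappa> \<in> gf n" "\<kappa> \<noteq> 0" and a: "a \<in> gf n" "a \<noteq> 0"
  shows "kloosterman (2 * n) \<kappa> a + (kloosterman n \<kappa> a)\<^sup>2 = 2 * of_nat (p ^ n)"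
proof -
  define g where "g = (\<lambda>(s, P). gf_char n (\<kappa> * (s + a * s / P)))"
  define F where "F = (gf n - {0} :: 'k set)"
  have fin: "finite F" "finite (gf n :: 'k set)" "finite (gf (2 * n) :: 'k set)"
    using gf_card n by (auto simp: F_def)
  have n2: "2 * n > 0" using n by simp
  have k2: "\<kappa> ^ (p ^ n) = \<kappa>" "a ^ (p ^ n) = a" using k a by (auto simp: gf_iff)
  have "(kloosterman n \<kappa> a)\<^sup>2 = (\<Sum>x\<in>F. \<Sum>y\<in>F. gf_char n (\<kappa> * (x + a / x)) * gf_char n (\<kappa> * (y + a / y)))"
    by (simp add: kloosterman_def power2_eq_square sum_product F_def)
  also have "\<dots> = (\<Sum>x\<in>F. \<Sum>y\<in>F. g (x + y, x * y))"
  proof (intro sum.cong refl)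
    fix x y assume xy: "x \<in> F" "y \<in> F"
    have "gf_char n (\<kappa> * (x + a / x)) * gf_char n (\<kappa> * (y + a / y)) = gf_char n (\<kappa> * (x + a / x) + \<kappa> * (y + a / y))"
      using xy k a by (intro gf_char_add[symmetric] gf_mult gf_add gf_divide) (auto simp: F_def)
    also have "\<kappa> * (x + a / x) + \<kappa> * (y + a / y) = \<kappa> * ((x + y) + a * (x + y) / (x * y))"
      using xy by (auto simp: F_def field_simps)
    finally show "gf_char n (\<kappa> * (x + a / x)) * gf_char n (\<kappa> * (y + a / y)) = g (x + y, x * y)"
      by (simp add: g_def)
  qed
  also have "\<dots> = (\<Sum>x\<in>F \<times> F. g (fst x + snd x, fst x * snd x))"
    by (simp add: sum.cartesian_product case_prod_beta)
  also have "\<dots> = (\<Sum>sP\<in>gf n \<times> F. \<Sum>x\<in>{x \<in> F \<times> F. (fst x + snd x, fst x * snd x) = sP}. g (fst x + snd x, fst x * snd x))"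
    by (rule sum.group[symmetric]) (use fin in \<open>auto simp: F_def intro: gf_add gf_mult\<close>)
  also have "\<dots> = (\<Sum>sP\<in>gf n \<times> F. of_nat (card {x \<in> F \<times> F. (fst x + snd x, fst x * snd x) = sP}) * g sP)"
    by (intro sum.cong refl) simp
  finally have 1: "(kloosterman n \<kappa> a)\<^sup>2 = \<dots>" .
  have "kloosterman (2 * n) \<kappa> a = (\<Sum>z\<in>gf (2 * n) - {0}. g (z + z ^ (p ^ n), z * z ^ (p ^ n)))"
    unfolding kloosterman_def
  proof (intro sum.cong refl)
    fix z :: 'k assume z: "z \<in> gf (2 * n) - {0}"
    have "\<kappa> * (z + a / z) + (\<kappa> * (z + a / z)) ^ (p ^ n) = \<kappa> * ((z + a / z) + (z ^ (p ^ n) + a / z ^ (p ^ n)))"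
      by (simp add: power_mult_distrib frob_add power_divide k2 algebra_simps)
    also have "\<dots> = \<kappa> * ((z + z ^ (p ^ n)) + a * (z + z ^ (p ^ n)) / (z * z ^ (p ^ n)))"
      using z by (simp add: field_simps)
    finally show "gf_char (2 * n) (\<kappa> * (z + a / z)) = g (z + z ^ (p ^ n), z * z ^ (p ^ n))"
      by (simp add: gf_char_double g_def)
  qed
  also have "\<dots> = (\<Sum>sP\<in>gf n \<times> F. \<Sum>z\<in>{z \<in> gf (2 * n) - {0}. (z + z ^ (p ^ n), z * z ^ (p ^ n)) = sP}. g (z + z ^ (p ^ n), z * z ^ (p ^ n)))"
  proof (rule sum.group[symmetric])
    show "(\<lambda>z. (z + z ^ (p ^ n), z * z ^ (p ^ n))) ` (gf (2 * n) - {0}) \<subseteq> gf n \<times> F"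
    proof safe
      fix z :: 'k assume z: "z \<in> gf (2 * n)" "z \<noteq> 0"
      then have zz: "(z ^ (p ^ n)) ^ (p ^ n) = z"
        by (simp add: gf_iff mult_2 power_add flip: power_mult)
      show "z + z ^ (p ^ n) \<in> gf n" by (simp add: gf_iff frob_add zz)
      show "z * z ^ (p ^ n) \<in> F" using z by (simp add: gf_iff F_def power_mult_distrib zz mult.commute)
    qed
  qed (use fin in auto)
  also have "\<dots> = (\<Sum>sP\<in>gf n \<times> F. of_nat (card {z \<in> gf (2 * n) - {0}. (z + z ^ (p ^ n), z * z ^ (p ^ n)) = sP}) * g sP)"
    by (intro sum.cong refl) simp
  finally have 2: "kloosterman (2 * n) \<kappa> a = \<dots>" .
  have "kloosterman (2 * n) \<kappa> a + (kloosterman n \<kappa> a)\<^sup>2 = (\<Sum>sP\<in>gf n \<times> F. 2 * g sP)"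
    unfolding 1 2 sum.distrib[symmetric]
  proof (intro sum.cong refl)
    fix sP :: "'k \<times> 'k" assume "sP \<in> gf n \<times> F"
    then obtain s P where sP: "sP = (s, P)" "s \<in> gf n" "P \<in> gf n" "P \<noteq> 0" by (auto simp: F_def)
    define c1 where "c1 = card {x \<in> F \<times> F. (fst x + snd x, fst x * snd x) = sP}"
    define c2 where "c2 = card {z \<in> gf (2 * n) - {0}. (z + z ^ (p ^ n), z * z ^ (p ^ n)) = sP}"
    have "c1 + c2 = 2" unfolding c1_def c2_def sP(1) F_def by (rule quadratic_count[OF n sP(2-)])
    then have "of_nat (c2 + c1) = (2::complex)" by (metis add.commute of_nat_numeral)
    then have "of_nat c2 * g sP + of_nat c1 * g sP = 2 * g sP" by (simp only: of_nat_add distrib_right[symmetric])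
    then show "of_nat (card {z \<in> gf (2 * n) - {0}. (z + z ^ (p ^ n), z * z ^ (p ^ n)) = sP}) * g sP +
         of_nat (card {x \<in> F \<times> F. (fst x + snd x, fst x * snd x) = sP}) * g sP = 2 * g sP"
      unfolding c1_def c2_def .
  qed
  also have "\<dots> = (\<Sum>P\<in>F. \<Sum>s\<in>gf n. 2 * g (s, P))"
  proof -
    have "(\<Sum>sP\<in>gf n \<times> F. 2 * g sP) = (\<Sum>s\<in>gf n. \<Sum>P\<in>F. 2 * g (s, P))"
      by (simp add: sum.cartesian_product)
    then show ?thesis by (simp only: sum.swap[of _ F])
  qed
  also have "\<dots> = (\<Sum>P\<in>F. 2 * (if P = - a then of_nat (p ^ n) else 0))"
  proof (intro sum.cong refl)
    fix P assume P: "P \<in> F"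
    have c: "\<kappa> * (1 + a / P) \<in> gf n" using P k a by (intro gf_mult gf_add gf_divide gf_1) (auto simp: F_def)
    have "(\<Sum>s\<in>gf n. g (s, P)) = (\<Sum>s\<in>gf n. gf_char n (\<kappa> * (1 + a / P) * s))"
      by (intro sum.cong refl) (simp add: g_def algebra_simps)
    also have "\<dots> = (if \<kappa> * (1 + a / P) = 0 then of_nat (p ^ n) else 0)"
      by (rule gf_char_orth[OF n c])
    also have "\<kappa> * (1 + a / P) = 0 \<longleftrightarrow> P = - a"
    proof -
      have "1 + a / P = (P + a) / P" using P by (simp add: F_def add_divide_distrib)
      then show ?thesis using P k by (auto simp: F_def eq_neg_iff_add_eq_0)
    qed
    finally show "(\<Sum>s\<in>gf n. 2 * g (s, P)) = 2 * (if P = - a then of_nat (p ^ n) else 0)"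
      by (simp add: sum_distrib_left[symmetric])
  qed
  also have "\<dots> = 2 * of_nat (p ^ n)"
    using fin a by (simp add: sum_distrib_left[symmetric] sum.delta F_def gf_minus)
  finally show ?thesis .
qed

text \<open>If t = y^q - y with q = p^m, then every \<open>\<kappa>\<close> in the subfield gives
  \<open>\<kappa> t\<close> trace zero, so the sum is q, and the solutions lie in one translate of
  the subfield. If there is no solution, it suffices that the sum of a character over a finite group
  is never negative.\<close>

lemma subfield_char_sum:
  fixes t :: 'k
  assumes "m > 0" "m dvd n" "t \<in> gf n"
  shows "real (card {y \<in> gf n. y ^ (p ^ m) - y = t}) \<le> Re (\<Sum>\<kappa>\<in>gf m. gf_char n (\<kappa> * t))"
proof -
  have gfn: "\<kappa> \<in> gf n" if "\<kappa> \<in> gf m" for \<kappa> :: 'k using gf_mono that assms by blast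
  show ?thesis
  proof (cases "\<exists>y\<in>gf n. y ^ (p ^ m) - y = t")
    case True
    then obtain y where y: "y \<in> gf n" "y ^ (p ^ m) - y = t" by auto
    have "gf_char n (\<kappa> * t) = 1" if k: "\<kappa> \<in> gf m" for \<kappa>
    proof -
      have "\<kappa> * t = (\<kappa> * y) ^ (p ^ m) + - (\<kappa> * y)"
        using gf_frob[OF k] by (simp add: power_mult_distrib algebra_simps flip: y(2))
      then have "gf_trace n (\<kappa> * t) = gf_trace n ((\<kappa> * y) ^ (p ^ m) + - (\<kappa> * y))" by simp
      also have "\<dots> = gf_trace n (\<kappa> * y + - (\<kappa> * y))"
        unfolding trace_add using trace_frob_pow[OF gf_mult[OF gfn[OF k] y(1)]] by simp
      finally have "gf_trace n (\<kappa> * t) = gf_trace n 0" by simp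
      then show ?thesis using gf_char_0[of n] by (simp add: gf_char_def)
    qed
    then have S: "(\<Sum>\<kappa>\<in>gf m. gf_char n (\<kappa> * t)) = of_nat (p ^ m)"
      using gf_card[OF assms(1)] by simp
    have "{z \<in> gf n. z ^ (p ^ m) - z = t} \<subseteq> (\<lambda>x. x + y) ` gf m"
    proof
      fix z assume "z \<in> {z \<in> gf n. z ^ (p ^ m) - z = t}"
      then have "z ^ (p ^ m) - z = y ^ (p ^ m) - y" using y by simp
      then have "z - y \<in> gf m" by (simp add: gf_iff frob_diff algebra_simps)
      then show "z \<in> (\<lambda>x. x + y) ` gf m" by (intro image_eqI[of _ _ "z - y"]) auto
    qed
    then have "card {z \<in> gf n. z ^ (p ^ m) - z = t} \<le> card (gf m :: 'k set)"
      by (rule surj_card_le[OF gf_card(1)[OF assms(1)]])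
    then show ?thesis unfolding S using gf_card[OF assms(1)] by simp
  next
    case False
    then have 0: "{y \<in> gf n. y ^ (p ^ m) - y = t} = {}" by auto
    have "0 \<le> Re (\<Sum>\<kappa>\<in>gf m. gf_char n (\<kappa> * t))"
    proof (cases "\<exists>l\<in>gf m. gf_char n (l * t) \<noteq> 1")
      case True
      then obtain l where l: "l \<in> gf m" "gf_char n (l * t) \<noteq> 1" by auto
      have "(\<Sum>\<kappa>\<in>gf m. gf_char n (\<kappa> * t)) = (\<Sum>\<kappa>\<in>gf m. gf_char n ((\<kappa> + l) * t))"
        by (rule sum.reindex_bij_witness[of _ "\<lambda>x. x + l" "\<lambda>x. x - l"]) (use l in \<open>auto intro: gf_add gf_diff\<close>)
      also have "\<dots> = (\<Sum>\<kappa>\<in>gf m. gf_char n (\<kappa> * t)) * gf_char n (l * t)"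
        unfolding sum_distrib_right
        by (intro sum.cong refl) (use l assms gfn in \<open>auto simp: distrib_right gf_char_add gf_mult\<close>)
      finally have "(\<Sum>\<kappa>\<in>gf m. gf_char n (\<kappa> * t)) = 0" using l by auto
      then show ?thesis by simp
    next
      case False
      then have "(\<Sum>\<kappa>\<in>gf m. gf_char n (\<kappa> * t)) = (\<Sum>\<kappa>\<in>(gf m :: 'k set). 1)" by (intro sum.cong) auto
      then show ?thesis by simp
    qed
    then show ?thesis unfolding 0 by simp
  qed
qed

text \<open>This \<open>f\<close> is the discriminant of x^2 - T x + a, that is, of x + a/x = T,
  where T = y^q - y. Its derivative is 2 T T' = -2 T, nonzero at every root of \<open>f\<close>
  because T^2 = 4a there. So the roots are simple, and comparing the parity of the orders at one of
  them rules out \<open>u\<^sup>2 = \<kappa> v\<^sup>2 f\<close>.\<close>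

lemma kloosterman_poly:
  fixes a :: 'k
  assumes a: "a \<noteq> 0" and m: "m > 0"
  defines "f \<equiv> (monom 1 (p ^ m) - monom 1 1)\<^sup>2 - [:4 * a:]"
  shows "poly f y = (y ^ (p ^ m) - y)\<^sup>2 - 4 * a" "degree f = 2 * p ^ m"
    "\<kappa> \<noteq> 0 \<Longrightarrow> u\<^sup>2 = smult \<kappa> (v\<^sup>2 * f) \<Longrightarrow> u = 0 \<and> v = 0"
    "a \<in> gf n \<Longrightarrow> coeffs_in (gf n) f"
proof -
  define q where "q = p ^ m"
  have q: "q > 1" unfolding q_def by (rule one_less_power) (use p_gt m in auto)
  define T :: "'k poly" where "T = monom 1 q - monom 1 1"
  have f: "f = T\<^sup>2 - [:4 * a:]" by (simp add: f_def T_def q_def)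
  have pT: "poly T x = x ^ q - x" for x by (simp add: T_def poly_monom)
  then show pf: "poly f y = (y ^ (p ^ m) - y)\<^sup>2 - 4 * a" for y
    by (simp add: f q_def)
  have "degree T = q"
  proof -
    have "degree (- monom (1::'k) 1) < degree (monom (1::'k) q)" using q by (simp add: degree_monom_eq)
    then show ?thesis unfolding T_def using degree_add_eq_left[of "- monom (1::'k) 1" "monom 1 q"]
      by (simp add: degree_monom_eq)
  qed
  then have "T \<noteq> 0" using q by auto
  then have dT2: "degree (T\<^sup>2) = 2 * q" using \<open>degree T = q\<close> by (simp add: degree_power_eq)
  then have "degree (- [:4 * a:]) < degree (T\<^sup>2)" using q by simp
  then have df: "degree f = 2 * q"
    unfolding f diff_conv_add_uminus using degree_add_eq_left[of "- [:4 * a:]" "T\<^sup>2"] dT2 by simp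
  then show "degree f = 2 * p ^ m" by (simp add: q_def)
  show "coeffs_in (gf n) f" if "a \<in> gf n"
  proof -
    have T: "T = monom 1 q + monom (- 1) 1" by (simp add: T_def minus_monom[symmetric])
    have f': "f = T * T + monom (- (4 * a)) 0" by (simp add: f power2_eq_square monom_0)
    have "coeffs_in (gf n) T"
      unfolding T by (intro coeffs_in_add coeffs_in_monom is_subring_gf gf_1 gf_minus)
    then show ?thesis unfolding f'
      by (intro coeffs_in_add coeffs_in_mult coeffs_in_monom is_subring_gf gf_minus gf_mult gf_numeral that)
  qed
  obtain y1 where y1: "poly f y1 = 0" using alg_closed_imp_poly_has_root[of f] df q by auto
  have f0: "f \<noteq> 0" using df q by auto
  have "order y1 f = 1"
  proof -
    have "poly T y1 \<noteq> 0" using y1 a four_neq_zero pf[of y1] pT[of y1] by (auto simp: q_def)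
    moreover have "poly (pderiv T) y1 = - 1"
      using of_nat_p m by (simp add: T_def pderiv_diff pderiv_monom poly_monom q_def power_0_left)
    ultimately have d: "poly (pderiv f) y1 \<noteq> 0"
      using two_neq_zero by (simp add: f pderiv_diff pderiv_pCons power2_eq_square pderiv_mult)
    have "\<not> 2 \<le> order y1 f"
    proof
      assume "2 \<le> order y1 f"
      then have "[:-y1, 1:] ^ 2 dvd f" by (simp add: order_divides)
      then obtain g where "f = [:-y1, 1:] ^ 2 * g" by (rule dvdE)
      then have g: "f = [:-y1, 1:] * ([:-y1, 1:] * g)" by (simp only: power2_eq_square mult.assoc)
      have "poly (pderiv f) y1 = 0"
        unfolding g pderiv_mult by simp
      with d show False by simp
    qed
    moreover have "order y1 f \<noteq> 0" using y1 f0 by (simp add: order_root)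
    ultimately show ?thesis by simp
  qed
  show "u = 0 \<and> v = 0" if "\<kappa> \<noteq> 0" "u\<^sup>2 = smult \<kappa> (v\<^sup>2 * f)"
  proof -
    have "v = 0"
    proof (rule ccontr)
      assume v: "v \<noteq> 0"
      then have "u \<noteq> 0" using that f0 by auto
      have "order y1 (u * u) = 2 * order y1 u" using \<open>u \<noteq> 0\<close> by (simp add: order_mult)
      moreover have "order y1 (smult \<kappa> (v * v * f)) = 2 * order y1 v + 1"
        using v f0 that(1) \<open>order y1 f = 1\<close> by (simp add: order_smult order_mult)
      ultimately have "2 * order y1 u = 2 * order y1 v + 1" using that(2) by (simp add: power2_eq_square)
      then show False by presburger
    qed
    with that show ?thesis by simp
  qed
qed

text \<open>The sum over \<open>\<kappa>\<close> dominates the number of pairs (x, y) with x + a/x =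
  y^q - y, and there are two such x whenever the discriminant f(y) is a nonzero square. Stepanov's
  bound is applied to the nonsquares, so that the squares are bounded from below. The even degree n
  = 2 n' supplies R = p^n' with R^2 = p^n.\<close>

lemma kloosterman_sum_lower:
  assumes m: "m > 0" "m dvd n'" and a: "a \<in> gf m" "a \<noteq> 0" and big: "4 * p ^ m \<le> p ^ n'"
  defines "n \<equiv> 2 * n'"
  shows "real (p ^ n) - 12 * real (p ^ m) * real (p ^ n') \<le> (\<Sum>\<kappa>\<in>gf m. Re (kloosterman n \<kappa> a))"
proof -
  define R where "R = p ^ n'"
  define q where "q = p ^ m"
  define h where "h = (R + 1) div 2"
  define F where "F = (gf n - {0} :: 'k set)"
  define T where "T y = y ^ q - y" for y :: 'k
  define f where "f = (monom 1 (p ^ m) - monom 1 1)\<^sup>2 - [:4 * a:]"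
  note fp = kloosterman_poly[OF a(2) m(1), folded f_def]
  have q: "q > 1" unfolding q_def by (rule one_less_power) (use p_gt m in auto)
  have n': "n' > 0"
  proof (rule ccontr)
    assume "\<not> n' > 0"
    then have "4 * p ^ m \<le> 1" using big by simp
    then show False using q by (simp add: q_def)
  qed
  then have n: "n > 0" by (simp add: n_def)
  have RQ: "R * R = p ^ n" by (simp add: R_def n_def mult_2 power_add)
  have oddR: "odd R" using p by (simp add: R_def)
  have Rh: "R = 2 * h - 1" "R = CHAR('k) ^ n'" using oddR p by (auto simp: h_def R_def elim!: oddE)
  have qR: "4 * q \<le> R" using big by (simp add: q_def R_def)
  have an: "a \<in> gf n" by (rule gf_mono[OF _ a(1)]) (use m in \<open>simp add: n_def\<close>)
  have fin: "finite (gf n :: 'k set)" "finite F" "finite (gf m :: 'k set)" using gf_card n m by (auto simp: F_def)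
  define Zm where "Zm = {y. y ^ (R * R) = y \<and> poly f y ^ ((R * R - 1) div 2) = - 1}"
  define Z1 where "Z1 = {y \<in> gf n. poly f y ^ ((R * R - 1) div 2) = 1}"
  have "2 * card Zm \<le> R * R + 4 * (2 * q) * R"
    unfolding Zm_def
  proof (rule stepanov_bound[OF primeCHAR Rh(2,1) fin(1) is_subring_gf fp(4)[OF an]])
    show "poly f 0 \<noteq> 0" using a four_neq_zero q p_gt fp(1)[of 0] by (simp add: power_0_left q_def)
    show "degree f = 2 * q" using fp(2) by (simp add: q_def)
    show "2 * q < h" using qR oddR unfolding h_def by presburger
    show "2 * q > 0" using q by simp
    show "u = 0 \<and> v = 0" if "c \<noteq> 0" "u\<^sup>2 = smult c (v\<^sup>2 * f)" for c u v by (rule fp(3)[OF that])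
    show "(- 1 :: 'k)\<^sup>2 = 1" by simp
  qed
  moreover have "p ^ n \<le> card Z1 + card Zm + 2 * q"
  proof -
    have "degree f = 2 * q" using fp(2) q_def by metis
    then have f0: "f \<noteq> 0" using q by auto
    have sub: "gf n \<subseteq> Z1 \<union> (Zm \<inter> gf n) \<union> {y. poly f y = 0}"
    proof
      fix y :: 'k assume y: "y \<in> gf n"
      define u where "u = poly f y"
      have u: "u \<in> gf n" unfolding u_def fp(1)
        by (intro gf_diff gf_mult gf_power gf_numeral y an)
      have "y ^ (R * R) = y" using y by (simp add: RQ gf_iff)
      moreover have "u ^ ((R * R - 1) div 2) = 1 \<or> u ^ ((R * R - 1) div 2) = - 1" if "u \<noteq> 0"
      proof -
        have ev: "(R * R - 1) div 2 * 2 = R * R - 1" using oddR by simp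
        have "u ^ (R * R) = u" using u by (simp add: RQ gf_iff)
        moreover have "R * R = Suc (R * R - 1)" using oddR by (simp add: odd_pos)
        ultimately have "u ^ (R * R - 1) * u = 1 * u" by (metis mult_1 power_Suc2)
        then have "u ^ (R * R - 1) = 1" using that by simp
        then have "(u ^ ((R * R - 1) div 2))\<^sup>2 = 1" by (metis ev power_mult)
        then show ?thesis by (simp add: power2_eq_1_iff)
      qed
      ultimately show "y \<in> Z1 \<union> (Zm \<inter> gf n) \<union> {y. poly f y = 0}"
        using y by (auto simp: Z1_def Zm_def u_def)
    qed
    have "Zm \<subseteq> gf n" by (auto simp: Zm_def RQ gf_iff)
    then have fin': "finite Z1" "finite Zm" "finite {y. poly f y = 0}"
      using fin f0 by (auto simp: Z1_def poly_roots_finite intro: finite_subset)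
    have "p ^ n = card (gf n :: 'k set)" using gf_card n by simp
    also have "\<dots> \<le> card (Z1 \<union> Zm \<union> {y. poly f y = 0})"
      using fin' sub by (intro card_mono) auto
    also have "\<dots> \<le> card Z1 + card Zm + card {y. poly f y = 0}"
      using card_Un_le[of "Z1 \<union> Zm" "{y. poly f y = 0}"] card_Un_le[of Z1 Zm] by linarith
    also have "card {y. poly f y = 0} \<le> 2 * q"
      using card_poly_roots_bound[OF f0] fp(2) by (simp add: q_def)
    finally show ?thesis by simp
  qed
  moreover have "q \<le> q * R" using oddR by (simp add: odd_pos Suc_leI)
  \<comment> \<open>After doubling, \<open>stepanov_bound\<close> with m = 2q costs 8 q R and the at
    most 2q roots of \<open>f\<close> cost 4q <= 4 q R, together 12 q R.\<close>
  ultimately have Z1: "p ^ n \<le> 2 * card Z1 + 12 * q * R" using RQ by linarith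
  have two: "2 \<le> card {x \<in> F. x + a / x = T y}" if y: "y \<in> Z1" for y
  proof -
    define u where "u = poly f y"
    have yn: "y \<in> gf n" and u1: "u ^ ((R * R - 1) div 2) = 1" using y by (auto simp: Z1_def u_def)
    obtain v where v: "v\<^sup>2 = u" using nth_root_exists[of 2 u] by auto
    have e: "R * R - 1 = 2 * ((R * R - 1) div 2)" "R * R = Suc (R * R - 1)"
      using oddR by (auto simp: odd_pos)
    have "(R * R - 1) div 2 > 0" using qR q mult_le_mono[of 2 R 2 R] by auto
    then have "u \<noteq> 0" using u1 by (metis power_0_left zero_neq_one less_numeral_extra(3))
    then have v0: "v \<noteq> 0" using v by auto
    have "v ^ (R * R - 1) = 1" using u1 v e(1) by (metis power_mult)
    then have vn: "v \<in> gf n" unfolding gf_iff RQ[symmetric] using e(2) by (metis mult_1 power_Suc2)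
    have Tn: "T y \<in> gf n" unfolding T_def by (intro gf_diff gf_power yn)
    have uT: "v * v = T y * T y - 4 * a" using v fp(1)[of y] by (simp add: u_def T_def q_def power2_eq_square)
    define x1 x2 where "x1 = (T y + v) / 2" and "x2 = (T y - v) / 2"
    have x12: "x1 + x2 = T y" "x1 * x2 = a"
    proof -
      show "x1 + x2 = T y" using two_neq_zero by (simp add: x1_def x2_def flip: add_divide_distrib)
      have "x1 * x2 = (T y * T y - v * v) / 4" by (simp add: x1_def x2_def algebra_simps)
      then show "x1 * x2 = a" using uT four_neq_zero by simp
    qed
    have "x1 - x2 = v" using two_neq_zero by (simp add: x1_def x2_def flip: diff_divide_distrib)
    then have ne: "x1 \<noteq> x2" using v0 by auto
    have nz: "x1 \<noteq> 0" "x2 \<noteq> 0" using x12 a by auto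
    have "x1 \<in> gf n" "x2 \<in> gf n" unfolding x1_def x2_def by (auto intro!: gf_divide gf_add gf_diff Tn vn gf_numeral)
    moreover have "a / x1 = x2" "a / x2 = x1" using nz x12 by (auto simp: field_simps)
    ultimately have "{x1, x2} \<subseteq> {x \<in> F. x + a / x = T y}" using nz x12 by (auto simp: F_def add.commute)
    then have "card {x1, x2} \<le> card {x \<in> F. x + a / x = T y}" using fin by (intro card_mono) auto
    then show ?thesis using ne by simp
  qed
  have xt: "x + a / x \<in> gf n" if "x \<in> F" for x using that an by (auto simp: F_def intro: gf_add gf_divide)
  have "2 * card Z1 = (\<Sum>y\<in>Z1. 2)" by simp
  also have "\<dots> \<le> (\<Sum>y\<in>Z1. card {x \<in> F. x + a / x = T y})" by (intro sum_mono two)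
  also have "\<dots> \<le> (\<Sum>y\<in>gf n. card {x \<in> F. x + a / x = T y})"
    by (rule sum_mono2) (use fin in \<open>auto simp: Z1_def\<close>)
  also have "\<dots> = (\<Sum>x\<in>F. card {y \<in> gf n. T y = x + a / x})"
  proof -
    have "(\<Sum>y\<in>gf n. card {x \<in> F. x + a / x = T y}) = (\<Sum>y\<in>gf n. \<Sum>x\<in>F. if x + a / x = T y then 1 else 0)"
      using fin by (simp add: sum.If_cases Int_def)
    also have "\<dots> = (\<Sum>x\<in>F. \<Sum>y\<in>gf n. if x + a / x = T y then 1 else 0)" by (rule sum.swap)
    also have "\<dots> = (\<Sum>x\<in>F. card {y \<in> gf n. T y = x + a / x})"
      using fin by (simp add: sum.If_cases Int_def eq_commute)
    finally show ?thesis .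
  qed
  finally have "real (2 * card Z1) \<le> (\<Sum>x\<in>F. real (card {y \<in> gf n. T y = x + a / x}))" by (simp flip: of_nat_sum)
  also have "\<dots> \<le> (\<Sum>x\<in>F. Re (\<Sum>\<kappa>\<in>gf m. gf_char n (\<kappa> * (x + a / x))))"
  proof (rule sum_mono)
    fix x assume "x \<in> F"
    from subfield_char_sum[OF m(1) _ xt[OF this]] m(2)
    show "real (card {y \<in> gf n. T y = x + a / x}) \<le> Re (\<Sum>\<kappa>\<in>gf m. gf_char n (\<kappa> * (x + a / x)))"
      by (simp add: T_def q_def n_def)
  qed
  also have "\<dots> = Re (\<Sum>\<kappa>\<in>gf m. kloosterman n \<kappa> a)"
    unfolding kloosterman_def F_def[symmetric] by (subst sum.swap) simp
  finally have "real (2 * card Z1) \<le> (\<Sum>\<kappa>\<in>gf m. Re (kloosterman n \<kappa> a))" by simp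
  moreover have "real (p ^ n) \<le> real (2 * card Z1) + 12 * real q * real R"
    using of_nat_mono[OF Z1, where 'a=real] by simp
  ultimately show ?thesis unfolding q_def R_def by linarith
qed

text \<open>With \<open>p\<^sub>j = - kloosterman\<close> at level \<open>m 2\<^sup>j\<close>, the doubling formula reads \<open>p\<^sub>j\<^sub>+\<^sub>1 = p\<^sub>j\<^sup>2 - 2 Q\<^sub>j\<close>; if the
  normalised value ever exceeds 2 it blows up, while all the other summands of the lower bound stay
  above \<open>-2\<close>.\<close>
theorem weil_kloosterman:
  assumes m: "m > 0" and k0: "\<kappa>0 \<in> gf m" "\<kappa>0 \<noteq> 0" and a: "a \<in> gf m" "a \<noteq> 0"
  shows "(norm (kloosterman m \<kappa>0 a))\<^sup>2 \<le> 4 * real (p ^ m)"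
proof (rule ccontr)
  assume contr: "\<not> ?thesis"
  define N where "N j = m * 2 ^ j" for j :: nat
  define Q where "Q j = real (p ^ N j)" for j
  define P where "P j \<kappa> = - Re (kloosterman (N j) \<kappa> a)" for j \<kappa>
  define \<delta> where "\<delta> j = (P j \<kappa>0)\<^sup>2 / Q j" for j
  define q where "q = real (p ^ m)"
  have N: "N j > 0" "N (Suc j) = 2 * N j" "m dvd N j" for j using m by (auto simp: N_def)
  have Qpos: "Q j > 0" for j using p_gt by (simp add: Q_def)
  have QSuc: "Q (Suc j) = Q j * Q j" for j by (simp add: Q_def N(2) mult_2 power_add)
  have gfN: "x \<in> gf (N j)" if "x \<in> gf m" for x :: 'k and j using gf_mono[OF N(3) that] .
  have PSuc: "P (Suc j) \<kappa> = (P j \<kappa>)\<^sup>2 - 2 * Q j" if "\<kappa> \<in> gf m" "\<kappa> \<noteq> 0" for j \<kappa>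
  proof -
    have "kloosterman (2 * N j) \<kappa> a + (kloosterman (N j) \<kappa> a)\<^sup>2 = 2 * of_nat (p ^ N j)"
      by (rule kloosterman_double) (use that a gfN N in auto)
    moreover have "kloosterman (N j) \<kappa> a = of_real (- P j \<kappa>)"
      using kloosterman_real[OF N(1), of \<kappa> j a] that a gfN by (simp add: P_def)
    moreover have "kloosterman (2 * N j) \<kappa> a = of_real (- P (Suc j) \<kappa>)"
      using kloosterman_real[OF N(1), of \<kappa> "Suc j" a] that a gfN[of _ "Suc j"] by (simp add: P_def N(2))
    ultimately have "of_real (- P (Suc j) \<kappa> + (P j \<kappa>)\<^sup>2) = (of_real (2 * Q j) :: complex)"
      by (simp add: Q_def)
    then have "- P (Suc j) \<kappa> + (P j \<kappa>)\<^sup>2 = 2 * Q j" by (simp only: of_real_eq_iff)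
    then show ?thesis by simp
  qed
  \<comment> \<open>For the normalised squares the recursion is the map (\<delta> - 2)^2, whose
    fixed point 4 is repelling: a positive distance to 4 at least quadruples. Only linear growth is
    extracted, enough to exceed a bound that does not depend on j.\<close>
  have dSuc: "\<delta> (Suc j) = (\<delta> j - 2)\<^sup>2" for j
    using Qpos[of j] by (simp add: \<delta>_def PSuc[OF k0] QSuc field_simps power2_eq_square)
  have "kloosterman (N 0) \<kappa>0 a = of_real (- P 0 \<kappa>0)"
    using kloosterman_real[OF N(1), of \<kappa>0 0 a] k0 a gfN by (simp add: P_def)
  then have "(P 0 \<kappa>0)\<^sup>2 > 4 * Q 0" using contr by (simp add: N_def Q_def)
  then have d0: "\<delta> 0 > 4" using Qpos[of 0] by (simp add: \<delta>_def field_simps)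
  define e where "e = \<delta> 0 - 4"
  have e: "e > 0" using d0 by (simp add: e_def)
  have dlow: "\<delta> j \<ge> 4 + real j * e" for j
  proof (induction j)
    case (Suc j)
    have "\<delta> (Suc j) = 4 + 4 * (\<delta> j - 4) + (\<delta> j - 4)\<^sup>2" by (simp add: dSuc power2_eq_square algebra_simps)
    moreover have "(\<delta> j - 4)\<^sup>2 \<ge> 0" by simp
    moreover have "4 * (real j * e) \<le> 4 * (\<delta> j - 4)" using Suc by simp
    ultimately have *: "\<delta> (Suc j) \<ge> 4 + 4 * (real j * e)" by linarith
    have "\<delta> (Suc j) \<ge> 4 + real (Suc j) * e" if "j \<ge> 1"
    proof -
      have "1 * e \<le> real j * e" using that e by (intro mult_right_mono) auto
      then have "4 * (real j * e) \<ge> real (Suc j) * e" using e by (simp add: algebra_simps)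
      with * show ?thesis by linarith
    qed
    moreover have "\<delta> (Suc j) \<ge> 4 + real (Suc j) * e" if "j = 0"
    proof -
      have "\<delta> 0 - 2 = 2 + e" by (simp add: e_def)
      then have "\<delta> (Suc 0) = (2 + e)\<^sup>2" by (simp add: dSuc)
      also have "\<dots> = 4 + 4 * e + e\<^sup>2" by (simp add: power2_eq_square algebra_simps)
      finally have "\<delta> (Suc 0) = 4 + 4 * e + e\<^sup>2" .
      moreover have "e\<^sup>2 \<ge> 0" by simp
      ultimately have "\<delta> (Suc 0) \<ge> 4 + e" using e by linarith
      then show ?thesis using that by simp
    qed
    ultimately show ?case by (cases "j = 0") (simp, metis One_nat_def Suc_leI not_gr_zero)
  next
    case 0
    show ?case using d0 by simp
  qed
  \<comment> \<open>The twist \<open>\<kappa> = 0\<close> absorbs the main term Q(j+1). By the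
    recursion every other twist contributes at most 2 Q(j), so at most (12 + 2) q Q(j) remains for
    \<open>\<kappa>0\<close>; undoing one recursion step adds the final 2. The restriction j >= 2
    guarantees 4q <= Q(j), from 4 <= p^2 and 2 + m <= 4m.\<close>
  have dup: "\<delta> j \<le> 14 * q + 2" if j: "j \<ge> 2" for j
  proof -
    have big: "4 * p ^ m \<le> p ^ N j"
    proof -
      have "4 * p ^ m \<le> p ^ 2 * p ^ m" using p_gt mult_le_mono[of 2 p 2 p] by (simp add: power2_eq_square)
      also have "\<dots> \<le> p ^ N j"
      proof -
        have "2 + m \<le> m * 4" using m by simp
        also have "\<dots> \<le> m * 2 ^ j" using j power_increasing[of 2 j "2::nat"] by simp
        finally have "p ^ (2 + m) \<le> p ^ N j"
          unfolding N_def using p_gt by (intro power_increasing) auto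
        then show ?thesis by (simp only: power_add)
      qed
      finally show ?thesis .
    qed
    have "Q (Suc j) - 12 * q * Q j \<le> (\<Sum>\<kappa>\<in>gf m. Re (kloosterman (N (Suc j)) \<kappa> a))"
      using kloosterman_sum_lower[OF m N(3) a big] by (simp add: Q_def N(2) q_def)
    also have "\<dots> = Re (kloosterman (N (Suc j)) 0 a) + (\<Sum>\<kappa>\<in>gf m - {0}. - P (Suc j) \<kappa>)"
      using gf_card[OF m] by (subst sum.remove[of _ 0]) (auto simp: gf_0 P_def)
    also have "Re (kloosterman (N (Suc j)) 0 a) \<le> Q (Suc j)"
    proof -
      have "kloosterman (N (Suc j)) 0 a = of_nat (card (gf (N (Suc j)) - {0 :: 'k}))"
        by (simp add: kloosterman_def gf_char_0)
      then have "Re (kloosterman (N (Suc j)) 0 a) = real (card (gf (N (Suc j)) - {0 :: 'k}))" by simp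
      also have "\<dots> \<le> real (card (gf (N (Suc j)) :: 'k set))"
        by (intro of_nat_mono card_mono) (use gf_card[OF N(1)[of "Suc j"]] in auto)
      finally show ?thesis using gf_card[OF N(1)[of "Suc j"]] by (simp add: Q_def)
    qed
    also have "(\<Sum>\<kappa>\<in>gf m - {0}. - P (Suc j) \<kappa>) = - P (Suc j) \<kappa>0 + (\<Sum>\<kappa>\<in>gf m - {0} - {\<kappa>0}. - P (Suc j) \<kappa>)"
      using gf_card[OF m] k0 by (subst sum.remove[of _ \<kappa>0]) auto
    also have "(\<Sum>\<kappa>\<in>gf m - {0} - {\<kappa>0}. - P (Suc j) \<kappa>) \<le> (\<Sum>\<kappa>\<in>gf m - {0} - {\<kappa>0}. 2 * Q j)"
      by (rule sum_mono) (simp add: PSuc)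
    also have "\<dots> \<le> (\<Sum>\<kappa>\<in>(gf m :: 'k set). 2 * Q j)"
      by (rule sum_mono2) (use gf_card[OF m] Qpos[of j] in auto)
    also have "\<dots> = 2 * q * Q j" using gf_card[OF m] by (simp add: q_def)
    finally have "P (Suc j) \<kappa>0 \<le> 14 * q * Q j" by simp
    then have "(P j \<kappa>0)\<^sup>2 \<le> (14 * q + 2) * Q j" using PSuc[OF k0, of j] by (simp add: algebra_simps)
    then show ?thesis using Qpos[of j] by (simp add: \<delta>_def field_simps)
  qed
  obtain j :: nat where j: "real j > (14 * q + 2) / e" using reals_Archimedean2 by blast
  have "14 * q + 2 < real j * e" using j e by (simp add: pos_divide_less_eq)
  also have "\<dots> \<le> real (max j 2) * e" using e by (intro mult_right_mono) auto
  finally have "real (max j 2) * e > 14 * q + 2" .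
  then show False using dlow[of "max j 2"] dup[of "max j 2"] by simp
qed

end

section \<open>Transfer of the Kloosterman bound to an arbitrary finite field\<close>

lemma finite_field_power_card:
  fixes x :: "'a::{finite,field}"
  shows "x ^ CARD('a) = x"
proof (cases "x = 0")
  case False
  have "x ^ card (UNIV - {0::'a}) * (\<Prod>y\<in>UNIV - {0}. y) = (\<Prod>y\<in>UNIV - {0}. x * y)"
    by (simp add: prod.distrib)
  also have "\<dots> = (\<Prod>y\<in>UNIV - {0}. y)"
    by (rule prod.reindex_bij_witness[of _ "\<lambda>y. y / x" "\<lambda>y. x * y"]) (use False in auto)
  finally have "x ^ card (UNIV - {0::'a}) = 1" by simp
  moreover have "CARD('a) = Suc (card (UNIV - {0::'a}))" by (simp add: card_gt_0_iff)
  ultimately show ?thesis by (metis mult.right_neutral power_Suc)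
qed (simp add: card_gt_0_iff)

lemma CHAR_finite_field:
  assumes "prime p" "CARD('a::{finite,field}) = p ^ m"
  shows "CHAR('a) = p"
proof -
  have "CHAR('a) > 0" by (rule finite_imp_CHAR_pos) simp
  then have pr: "prime CHAR('a)" by (rule prime_CHAR_semidom)
  have "(\<Sum>x\<in>(UNIV::'a set). x) = (\<Sum>x\<in>UNIV. x + 1)"
    by (rule sum.reindex_bij_witness[of _ "\<lambda>x. x + 1" "\<lambda>x. x - 1"]) auto
  then have "of_nat (CARD('a)) = (0::'a)" by (simp add: sum.distrib)
  then have "CHAR('a) dvd p ^ m" unfolding of_nat_eq_0_iff_char_dvd assms(2) .
  then have "CHAR('a) dvd p" using pr prime_dvd_power by blast
  then show ?thesis using pr assms(1) by (simp add: primes_dvd_imp_eq)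
qed

text \<open>The field embeds into its algebraic closure; its image consists of solutions of x^(p^m)
  = x and therefore fills \<open>gf m\<close> by cardinality. One character suffices, since
  rescaling x brings r x + D/x with r nonzero into the form x + a/x.\<close>

theorem exists_character_with_weil_bound:
  assumes "prime p" "odd p" "m > 0" "CARD('a::{finite,field}) = p ^ m"
  obtains \<chi> :: "'a::{finite,field} \<Rightarrow> complex"
  where "\<And>x y. \<chi> (x + y) = \<chi> x * \<chi> y" "\<And>x. norm (\<chi> x) = 1" "\<exists>x. \<chi> x \<noteq> 1"
    "\<And>a. a \<noteq> 0 \<Longrightarrow> norm (\<Sum>x\<in>UNIV - {0}. \<chi> (x + a / x)) \<le> 2 * sqrt (real CARD('a))"
proof -
  have ch: "CHAR('a) = p" by (rule CHAR_finite_field[OF assms(1,4)])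
  interpret odd_char_field p "TYPE('a alg_closure)"
    by unfold_locales (use ch assms in auto)
  define \<chi> :: "'a \<Rightarrow> complex" where "\<chi> x = gf_char m (to_ac x)" for x
  have mem: "to_ac x \<in> gf m" for x :: 'a
    using finite_field_power_card[of x] assms(4) by (simp add: gf_iff flip: to_ac_power)
  have range: "range to_ac = (gf m :: 'a alg_closure set)"
  proof (rule card_subset_eq)
    show "finite (gf m :: 'a alg_closure set)" using gf_card assms by auto
    show "range to_ac \<subseteq> (gf m :: 'a alg_closure set)" using mem by auto
    show "card (range to_ac :: 'a alg_closure set) = card (gf m :: 'a alg_closure set)"
      using gf_card assms by (simp add: card_image inj_to_ac)
  qed
  show thesis
  proof (rule that[of \<chi>])
    show "\<chi> (x + y) = \<chi> x * \<chi> y" for x y by (simp add: \<chi>_def gf_char_add mem)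
    show "norm (\<chi> x) = 1" for x by (simp add: \<chi>_def norm_gf_char)
    obtain z :: "'a alg_closure" where "z \<in> gf m" "gf_char m z \<noteq> 1"
      using gf_char_nontrivial[OF assms(3) gf_1] by auto
    then show "\<exists>x. \<chi> x \<noteq> 1" unfolding range[symmetric] by (auto simp: \<chi>_def)
  next
    fix a :: 'a assume a: "a \<noteq> 0"
    have img: "gf m - {0} = to_ac ` (UNIV - {0::'a})" unfolding range[symmetric] by auto
    have "kloosterman m 1 (to_ac a) = (\<Sum>x\<in>UNIV - {0}. \<chi> (x + a / x))"
      unfolding kloosterman_def img \<chi>_def
      by (subst sum.reindex) (auto intro: inj_on_subset[OF inj_to_ac])
    moreover have "(norm (kloosterman m 1 (to_ac a)))\<^sup>2 \<le> 4 * real (p ^ m)"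
      by (rule weil_kloosterman) (use assms a mem gf_1 in auto)
    ultimately have "(norm (\<Sum>x\<in>UNIV - {0}. \<chi> (x + a / x)))\<^sup>2 \<le> (2 * sqrt (real CARD('a)))\<^sup>2"
      by (simp add: assms(4) power_mult_distrib)
    then show "norm (\<Sum>x\<in>UNIV - {0}. \<chi> (x + a / x)) \<le> 2 * sqrt (real CARD('a))"
      by (rule power2_le_imp_le) simp
  qed
qed

section \<open>Gauss and Salie sums\<close>

lemma fvecs_Suc: "fvecs (Suc d) = (\<lambda>(x, c). x(d := c)) ` (fvecs d \<times> UNIV)"
proof (rule Set.set_eqI, rule iffI)
  fix x :: "nat \<Rightarrow> 'a" assume x: "x \<in> fvecs (Suc d)"
  then have "x(d := 0) \<in> fvecs d"
    by (auto simp: fvecs_def)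
  moreover have "x = (x(d := 0))(d := x d)" by auto
  ultimately show "x \<in> (\<lambda>(x, c). x(d := c)) ` (fvecs d \<times> UNIV)"
    by (intro image_eqI[of _ _ "(x(d := 0), x d)"]) auto
qed (auto simp: fvecs_def)

lemma inj_fvecs_Suc: "inj_on (\<lambda>(x, c). x(d := c)) (fvecs d \<times> UNIV)"
proof (rule inj_onI, clarify)
  fix x y :: "nat \<Rightarrow> 'a" and b c
  assume xy: "x \<in> fvecs d" "y \<in> fvecs d" "x(d := b) = y(d := c)"
  have "x i = y i" for i
    using fun_cong[OF xy(3), of i] xy(1,2) by (cases "i = d") (auto simp: fvecs_def)
  then show "x = y \<and> b = c" using fun_cong[OF xy(3), of d] by auto
qed

lemma fvecs_0: "fvecs 0 = {\<lambda>_. 0}"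
  by (auto simp: fvecs_def)

lemma finite_fvecs: "finite (fvecs d :: (nat \<Rightarrow> 'a::{finite,zero}) set)"
  by (induction d) (auto simp: fvecs_0 fvecs_Suc)

lemma sum_fvecs_Suc:
  fixes f :: "(nat \<Rightarrow> 'a::{finite,zero}) \<Rightarrow> 'b::comm_monoid_add"
  shows "(\<Sum>x\<in>fvecs (Suc d). f x) = (\<Sum>x\<in>fvecs d. \<Sum>c\<in>UNIV. f (x(d := c)))"
  unfolding fvecs_Suc
  by (subst sum.reindex[OF inj_fvecs_Suc]) (simp add: sum.cartesian_product case_prod_beta)

lemma sum_fvecs_prod:
  fixes g :: "nat \<Rightarrow> 'a::{finite,zero} \<Rightarrow> 'b::comm_semiring_1"
  shows "(\<Sum>x\<in>fvecs d. \<Prod>i<d. g i (x i)) = (\<Prod>i<d. \<Sum>c\<in>UNIV. g i c)"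
proof (induction d)
  case (Suc d)
  have "(\<Sum>x\<in>fvecs (Suc d). \<Prod>i<Suc d. g i (x i)) = (\<Sum>x\<in>fvecs d. \<Sum>c\<in>UNIV. (\<Prod>i<d. g i (x i)) * g d c)"
    unfolding sum_fvecs_Suc by (intro sum.cong refl) (auto intro!: prod.cong arg_cong2[of _ _ _ _ "(*)"])
  then show ?case by (simp add: Suc flip: sum_distrib_left sum_distrib_right)
qed (simp add: fvecs_0)

lemma square_sum_le:
  fixes c :: "'b \<Rightarrow> real"
  assumes "finite I"
  shows "(\<Sum>i\<in>I. c i)\<^sup>2 \<le> real (card I) * (\<Sum>i\<in>I. (c i)\<^sup>2)"
proof (cases "I = {}")
  case False
  define N \<mu> where "N = real (card I)" and "\<mu> = (\<Sum>i\<in>I. c i) / real (card I)"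
  have N: "N > 0" using assms False by (simp add: N_def card_gt_0_iff)
  have \<mu>: "(\<Sum>i\<in>I. c i) = N * \<mu>" using N by (simp add: \<mu>_def N_def)
  have "0 \<le> (\<Sum>i\<in>I. (c i - \<mu>)\<^sup>2)" by (simp add: sum_nonneg)
  also have "\<dots> = (\<Sum>i\<in>I. (c i)\<^sup>2 - 2 * \<mu> * c i + \<mu>\<^sup>2)"
    by (intro sum.cong refl) (simp add: power2_eq_square algebra_simps)
  also have "\<dots> = (\<Sum>i\<in>I. (c i)\<^sup>2) - 2 * \<mu> * (N * \<mu>) + N * \<mu>\<^sup>2"
    by (simp only: sum.distrib sum_subtractf sum_distrib_left[symmetric] \<mu>) (simp add: N_def)
  finally have "N * \<mu>\<^sup>2 \<le> (\<Sum>i\<in>I. (c i)\<^sup>2)" by (simp add: power2_eq_square algebra_simps)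
  then have "N * (N * \<mu>\<^sup>2) \<le> N * (\<Sum>i\<in>I. (c i)\<^sup>2)" using N by (intro mult_left_mono) auto
  then show ?thesis unfolding \<mu> N_def[symmetric] by (simp add: power2_eq_square mult_ac)
qed simp

section \<open>Gauss sums and the quadratic character\<close>

locale additive_character =
  fixes \<chi> :: "'a::{finite,field} \<Rightarrow> complex"
  assumes add: "\<chi> (x + y) = \<chi> x * \<chi> y"
    and norm_one: "norm (\<chi> x) = 1"
    and nontrivial: "\<exists>x. \<chi> x \<noteq> 1"
    and two_neq_0: "(2::'a) \<noteq> 0"
begin

definition q :: nat where "q = CARD('a)"

definition gauss :: "'a \<Rightarrow> complex" where
  "gauss c = (\<Sum>x\<in>UNIV. \<chi> (c * x\<^sup>2))"

definition \<eta> :: "'a \<Rightarrow> complex" where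
  "\<eta> x = (if x = 0 then 0 else if \<exists>y. x = y\<^sup>2 then 1 else - 1)"

definition ft :: "('a \<Rightarrow> complex) \<Rightarrow> 'a \<Rightarrow> complex" where
  "ft f r = (\<Sum>x\<in>UNIV. f x * \<chi> (r * x))"

lemma q_pos: "q > 0" by (simp add: q_def card_gt_0_iff)

lemma four_neq_0: "(4::'a) \<noteq> 0"
  using two_neq_0 by (metis mult_2 mult_eq_0_iff numeral_Bit0 one_add_one)

lemma chi_0 [simp]: "\<chi> 0 = 1"
  using add[of 0 0] norm_one[of 0] by auto

lemma chi_neq_0 [simp]: "\<chi> x \<noteq> 0"
  using norm_one[of x] by auto

lemma chi_minus: "\<chi> (- x) = cnj (\<chi> x)"
proof -
  have "\<chi> x * \<chi> (- x) = 1" using add[of x "- x"] by simp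
  moreover have "\<chi> x * cnj (\<chi> x) = 1" by (simp add: complex_norm_square[symmetric] norm_one)
  ultimately show ?thesis by (metis chi_neq_0 mult_cancel_left)
qed

lemma chi_sum: "\<chi> (sum f I) = (\<Prod>i\<in>I. \<chi> (f i))"
  by (induction I rule: infinite_finite_induct) (auto simp: add)

lemma sum_shift: "(\<Sum>x\<in>UNIV. f (x + c)) = (\<Sum>x\<in>UNIV. f x)" for c :: 'a
  by (rule sum.reindex_bij_witness[of _ "\<lambda>x. x - c" "\<lambda>x. x + c"]) auto

lemma sum_scale: "c \<noteq> 0 \<Longrightarrow> (\<Sum>x\<in>UNIV. f (c * x)) = (\<Sum>x\<in>UNIV. f x)" for c :: 'a
  by (rule sum.reindex_bij_witness[of _ "\<lambda>x. x / c" "\<lambda>x. c * x"]) auto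

lemma sum_uminus: "(\<Sum>x\<in>UNIV. f (- x)) = (\<Sum>x\<in>UNIV. f (x::'a))"
  by (rule sum.reindex_bij_witness[of _ uminus uminus]) auto

lemma sum_inverse: "(\<Sum>x\<in>UNIV. f (inverse x)) = (\<Sum>x\<in>UNIV. f (x::'a))"
  by (rule sum.reindex_bij_witness[of _ inverse inverse]) auto

lemma orthogonality: "(\<Sum>x\<in>UNIV. \<chi> (c * x)) = (if c = 0 then of_nat q else 0)"
proof (cases "c = 0")
  case False
  obtain y where y: "\<chi> y \<noteq> 1" using nontrivial by auto
  have "(\<Sum>x\<in>UNIV. \<chi> x) = (\<Sum>x\<in>UNIV. \<chi> (x + y))" by (simp add: sum_shift)
  also have "\<dots> = (\<Sum>x\<in>UNIV. \<chi> x) * \<chi> y" by (simp add: add sum_distrib_right)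
  finally have "(\<Sum>x\<in>UNIV. \<chi> x) = 0" using y by simp
  then show ?thesis using False sum_scale[OF False, of \<chi>] by simp
qed (simp add: q_def)

lemma cnj_gauss: "cnj (gauss c) = gauss (- c)"
  by (simp add: gauss_def flip: chi_minus)

lemma complete_square:
  assumes "c \<noteq> 0"
  shows "(\<Sum>x\<in>UNIV. \<chi> (c * x\<^sup>2 + b * x)) = gauss c * \<chi> (- (b\<^sup>2 / (4 * c)))"
proof -
  define e where "e = b / (2 * c)"
  have b: "b = 2 * c * e" using assms two_neq_0 by (simp add: e_def)
  have "b\<^sup>2 = 4 * c * (c * e\<^sup>2)" unfolding b by (simp add: power2_eq_square algebra_simps)
  then have e: "b\<^sup>2 / (4 * c) = c * e\<^sup>2" using assms four_neq_0 by simp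
  have "(\<Sum>x\<in>UNIV. \<chi> (c * x\<^sup>2 + b * x)) = (\<Sum>x\<in>UNIV. \<chi> (c * (x + e)\<^sup>2 + - (c * e\<^sup>2)))"
    unfolding b by (intro sum.cong refl arg_cong[of _ _ \<chi>]) (simp add: power2_eq_square algebra_simps)
  also have "\<dots> = (\<Sum>x\<in>UNIV. \<chi> (c * x\<^sup>2 + - (c * e\<^sup>2)))"
    by (rule sum_shift[of "\<lambda>x. \<chi> (c * x\<^sup>2 + - (c * e\<^sup>2))"])
  finally show ?thesis by (simp only: e gauss_def add sum_distrib_right)
qed

lemma gauss_times_minus:
  assumes "c \<noteq> 0"
  shows "gauss c * gauss (- c) = of_nat q"
proof -
  have "gauss c * gauss (- c) = (\<Sum>x\<in>UNIV. \<Sum>y\<in>UNIV. \<chi> (c * x\<^sup>2) * \<chi> (- c * y\<^sup>2))"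
    by (simp only: gauss_def sum_product)
  also have "\<dots> = (\<Sum>y\<in>UNIV. \<Sum>x\<in>UNIV. \<chi> (c * x\<^sup>2 + - c * y\<^sup>2))"
    by (subst sum.swap) (simp only: add)
  also have "\<dots> = (\<Sum>y\<in>UNIV. \<Sum>h\<in>UNIV. \<chi> (c * (h + y)\<^sup>2 + - c * y\<^sup>2))"
    by (intro sum.cong refl sum_shift[symmetric])
  also have "\<dots> = (\<Sum>h\<in>UNIV. \<Sum>y\<in>UNIV. \<chi> (c * h\<^sup>2) * \<chi> (2 * c * h * y))"
    by (subst sum.swap) (simp add: power2_eq_square algebra_simps flip: add)
  also have "\<dots> = (\<Sum>h\<in>UNIV. \<chi> (c * h\<^sup>2) * (if 2 * c * h = 0 then of_nat q else 0))"
    by (simp only: sum_distrib_left[symmetric] orthogonality)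
  also have "\<dots> = (\<Sum>h\<in>(UNIV::'a set). if h = 0 then of_nat q else 0)"
    using assms two_neq_0 by (intro sum.cong) auto
  finally show ?thesis by simp
qed

lemma norm_gauss: "c \<noteq> 0 \<Longrightarrow> norm (gauss c) = sqrt q"
proof -
  assume "c \<noteq> 0"
  then have "of_real ((norm (gauss c))\<^sup>2) = (of_real q :: complex)"
    unfolding complex_norm_square cnj_gauss using gauss_times_minus[of c] by simp
  then have "(norm (gauss c))\<^sup>2 = q" by (simp only: of_real_eq_iff)
  then show ?thesis by (metis norm_ge_zero real_sqrt_unique)
qed

lemma card_square_roots: "of_nat (card {x. x\<^sup>2 = y}) = 1 + \<eta> y"
proof (cases "\<exists>x. y = x\<^sup>2")
  case True
  then obtain x where x: "y = x\<^sup>2" by auto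
  have eq: "{z. z\<^sup>2 = y} = {x, - x}" by (auto simp: x power2_eq_iff)
  show ?thesis
  proof (cases "x = 0")
    case False
    then have "x \<noteq> - x" using two_neq_0 by (metis add_eq_0_iff mult_2 mult_eq_0_iff)
    then show ?thesis unfolding eq using False x True by (simp add: \<eta>_def)
  qed (use x eq in \<open>simp add: \<eta>_def\<close>)
next
  case False
  then have "{x. x\<^sup>2 = y} = {}" by auto
  moreover have "y \<noteq> 0" using False by (metis power_zero_numeral)
  ultimately show ?thesis using False by (auto simp: \<eta>_def)
qed

lemma sum_squares: "(\<Sum>x\<in>UNIV. f (x\<^sup>2)) = (\<Sum>y\<in>UNIV. (1 + \<eta> y) * f y)"
proof -
  have "(\<Sum>x\<in>UNIV. f (x\<^sup>2)) = (\<Sum>y\<in>UNIV. \<Sum>x\<in>{x \<in> UNIV. x\<^sup>2 = y}. f (x\<^sup>2))"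
    by (rule sum.group[symmetric]) auto
  also have "\<dots> = (\<Sum>y\<in>UNIV. of_nat (card {x. x\<^sup>2 = y}) * f y)"
    by (intro sum.cong refl) simp
  finally show ?thesis by (simp add: card_square_roots)
qed

lemma eta_sq: "x \<noteq> 0 \<Longrightarrow> \<eta> x * \<eta> x = 1" by (simp add: \<eta>_def)

lemma norm_eta: "norm (\<eta> x) \<le> 1" by (simp add: \<eta>_def)

lemma sum_eta: "(\<Sum>y\<in>UNIV. \<eta> y) = 0"
  using sum_squares[of "\<lambda>_. 1"] by (simp add: sum.distrib)

text \<open>Only two nonsquares need an argument, and it is a count. Nonzero squares and nonsquares
  are equally many because \<open>\<eta>\<close> sums to zero, so multiplication by a nonsquare x
  carries the nonzero squares onto all nonsquares. The product of x with another nonsquare must then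
  be a square.\<close>

lemma eta_mult: "\<eta> (x * y) = \<eta> x * \<eta> y"
proof (cases "x = 0 \<or> y = 0")
  case False
  have sq: "\<eta> (a * b) = \<eta> b" if a: "\<exists>z. a = z\<^sup>2" "a \<noteq> 0" for a b
  proof -
    obtain z where "a = z\<^sup>2" using a(1) by auto
    with a have z: "a = z\<^sup>2" "z \<noteq> 0" by auto
    have "(\<exists>w. a * b = w\<^sup>2) \<longleftrightarrow> (\<exists>w. b = w\<^sup>2)"
    proof
      assume "\<exists>w. a * b = w\<^sup>2"
      then obtain w where "a * b = w\<^sup>2" by auto
      then have "b = (w / z)\<^sup>2" using z by (simp add: field_simps)
      then show "\<exists>w. b = w\<^sup>2" by blast
    next
      assume "\<exists>w. b = w\<^sup>2"
      then show "\<exists>w. a * b = w\<^sup>2" using z by (metis power_mult_distrib)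
    qed
    then show ?thesis using that by (simp add: \<eta>_def)
  qed
  show ?thesis
  proof (cases "(\<exists>z. x = z\<^sup>2) \<or> (\<exists>z. y = z\<^sup>2)")
    case True
    then show ?thesis
    proof
      assume x: "\<exists>z. x = z\<^sup>2"
      then have "\<eta> x = 1" using False by (simp add: \<eta>_def)
      then show ?thesis using sq[OF x, of y] False by simp
    next
      assume y: "\<exists>z. y = z\<^sup>2"
      then have "\<eta> y = 1" using False by (simp add: \<eta>_def)
      then show ?thesis using sq[OF y, of x] False by (simp add: mult.commute)
    qed
  next
    case nonsq: False
    define S where "S = {y. \<eta> y = 1}"
    define N where "N = {y. \<eta> y = - 1}"
    have "(\<Sum>y\<in>UNIV. \<eta> y) = (\<Sum>y\<in>UNIV. of_bool (y \<in> S) - of_bool (y \<in> N))"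
      by (intro sum.cong) (auto simp: S_def N_def \<eta>_def)
    also have "\<dots> = of_nat (card S) - of_nat (card N)"
      by (simp add: sum_subtractf of_bool_def sum.If_cases)
    finally have "card S = card N" using sum_eta by simp
    have etaS: "s \<in> S \<longleftrightarrow> s \<noteq> 0 \<and> (\<exists>z. s = z\<^sup>2)" for s by (auto simp: S_def \<eta>_def)
    have etaN: "s \<in> N \<longleftrightarrow> s \<noteq> 0 \<and> \<not> (\<exists>z. s = z\<^sup>2)" for s by (auto simp: N_def \<eta>_def)
    have "(*) x ` S \<subseteq> N"
    proof
      fix w assume "w \<in> (*) x ` S"
      then obtain s where s: "w = s * x" "s \<in> S" by (auto simp: mult.commute)
      have "\<eta> w = \<eta> x" unfolding s(1) by (rule sq) (use s etaS in auto)
      then show "w \<in> N" using nonsq False by (simp add: N_def \<eta>_def)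
    qed
    moreover have "card ((*) x ` S) = card N"
      using False \<open>card S = card N\<close> by (subst card_image) (auto simp: inj_on_def)
    ultimately have eq: "(*) x ` S = N" by (intro card_subset_eq) auto
    have "x * y \<notin> N"
    proof
      assume "x * y \<in> N"
      then obtain s where "x * y = x * s" "s \<in> S" using eq by auto
      then have "y \<in> S" using False by auto
      then show False using nonsq etaS by auto
    qed
    then have "\<eta> (x * y) = 1" using False etaN[of "x * y"] by (simp add: \<eta>_def)
    moreover have "\<eta> x = - 1" "\<eta> y = - 1" using nonsq False by (auto simp: \<eta>_def)
    ultimately show ?thesis by simp
  qed
qed (auto simp: \<eta>_def)

lemma gauss_eq_eta_sum:
  assumes "c \<noteq> 0"
  shows "gauss c = (\<Sum>y\<in>UNIV. \<eta> y * \<chi> (c * y))"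
  using sum_squares[of "\<lambda>y. \<chi> (c * y)"] assms
  by (simp add: gauss_def distrib_right sum.distrib orthogonality)

lemma gauss_mult:
  assumes "a \<noteq> 0" "b \<noteq> 0"
  shows "gauss (a * b) = \<eta> a * gauss b"
proof -
  have "gauss (a * b) = (\<Sum>y\<in>UNIV. \<eta> y * \<chi> (b * (a * y)))"
    using assms by (simp add: gauss_eq_eta_sum mult_ac)
  also have "\<dots> = (\<Sum>y\<in>UNIV. \<eta> a * \<eta> (a * y) * \<chi> (b * (a * y)))"
    by (intro sum.cong refl) (simp add: eta_mult eta_sq[OF assms(1)] flip: mult.assoc)
  also have "\<dots> = (\<Sum>y\<in>UNIV. \<eta> a * \<eta> y * \<chi> (b * y))"
    by (rule sum_scale[OF assms(1), of "\<lambda>z. \<eta> a * \<eta> z * \<chi> (b * z)"])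
  also have "\<dots> = \<eta> a * gauss b" using assms by (simp add: gauss_eq_eta_sum sum_distrib_left mult.assoc)
  finally show ?thesis .
qed

lemma gauss_sq: "c \<noteq> 0 \<Longrightarrow> (gauss c)\<^sup>2 = \<eta> (- 1) * of_nat q"
proof -
  assume c: "c \<noteq> 0"
  have "gauss (- c) = \<eta> (- 1) * gauss c" using gauss_mult[of "- 1" c] c by simp
  then have "\<eta> (- 1) * (gauss c)\<^sup>2 = of_nat q"
    using gauss_times_minus[OF c] by (simp add: power2_eq_square mult_ac)
  then have "\<eta> (- 1) * \<eta> (- 1) * (gauss c)\<^sup>2 = \<eta> (- 1) * of_nat q" by (simp add: mult.assoc)
  then show ?thesis by (simp add: eta_sq)
qed

lemma eta_inverse: "\<eta> (inverse w) = \<eta> w"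
proof (cases "w = 0")
  case False
  have "\<exists>y. (1::'a) = y\<^sup>2" by (rule exI[of _ 1]) simp
  then have "\<eta> 1 = 1" by (simp add: \<eta>_def)
  then have "\<eta> w * \<eta> (inverse w) = \<eta> w * \<eta> w" using False eta_sq[OF False] by (simp flip: eta_mult)
  then show ?thesis using eta_sq[OF False] by (metis mult_cancel_left mult_zero_left zero_neq_one)
qed auto

text \<open>The Salie sum, evaluated through \<open>w + 1/w \<plusminus> 2 = (w \<plusminus> 1)\<^sup>2 / w\<close>.\<close>
lemma salie_normalized:
  fixes f :: "'a \<Rightarrow> complex"
  shows "(\<Sum>w\<in>UNIV - {0}. \<eta> w * f (w + 1 / w)) = (\<Sum>t\<in>UNIV. (\<eta> (t - 2) + \<eta> (t + 2)) * f t)"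
proof -
  have "(\<Sum>w\<in>UNIV - {0}. \<eta> w * f (w + 1 / w))
      = (\<Sum>t\<in>UNIV. \<Sum>w\<in>{w \<in> UNIV - {0}. w + 1 / w = t}. \<eta> w * f (w + 1 / w))"
    by (rule sum.group[symmetric]) auto
  also have "\<dots> = (\<Sum>t\<in>UNIV. (\<Sum>w\<in>{w \<in> UNIV - {0}. w + 1 / w = t}. \<eta> w) * f t)"
    by (intro sum.cong refl) (simp add: sum_distrib_right)
  also have "\<dots> = (\<Sum>t\<in>UNIV. (\<eta> (t - 2) + \<eta> (t + 2)) * f t)"
  proof (intro sum.cong refl)
    fix t :: 'a
    let ?W = "{w \<in> UNIV - {0}. w + 1 / w = t}"
    have m2: "t - 2 = (w - 1)\<^sup>2 * inverse w" and p2: "t + 2 = (w + 1)\<^sup>2 * inverse w" if "w \<in> ?W" for w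
      using that by (auto simp: field_simps power2_eq_square)
    note inv = eta_inverse
    have sq1: "\<eta> (z\<^sup>2) = 1" if "z \<noteq> 0" for z using that by (auto simp: \<eta>_def)
    have em: "\<eta> (t - 2) = \<eta> w" if "w \<in> ?W" "w \<noteq> 1" for w
      unfolding m2[OF that(1)] using that by (simp add: eta_mult sq1 inv)
    have ep: "\<eta> (t + 2) = \<eta> w" if "w \<in> ?W" "w \<noteq> - 1" for w
      unfolding p2[OF that(1)] using that sq1[of "w + 1"] by (simp add: eta_mult inv add_eq_0_iff2)
    have one_ne: "(1::'a) \<noteq> - 1" using two_neq_0 by (metis add_eq_0_iff one_add_one)
    have "(\<Sum>w\<in>?W. \<eta> w) = \<eta> (t - 2) + \<eta> (t + 2)"
    proof (cases "?W = {}")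
      \<comment> \<open>With an empty fibre t^2 - 4 cannot be a square v^2, since (t + v)/2 would
        lie in the fibre. Hence \<open>\<eta>\<close> takes opposite values at t - 2 and t +
        2.\<close>
      case True
      have "\<eta> (t - 2) = - \<eta> (t + 2)"
      proof -
        have "\<not> (\<exists>v. (t - 2) * (t + 2) = v\<^sup>2)"
        proof
          assume "\<exists>v. (t - 2) * (t + 2) = v\<^sup>2"
          then obtain v where v: "v * v = t * t - 4" by (auto simp: power2_eq_square algebra_simps)
          define w where "w = (t + v) / 2"
          have "w * ((t - v) / 2) = (t * t - v * v) / 4" by (simp add: w_def algebra_simps)
          then have w1: "w * ((t - v) / 2) = 1" using v four_neq_0 by simp
          then have "w \<noteq> 0" by auto
          then have "1 / w = (t - v) / 2" using w1 by (metis nonzero_mult_div_cancel_left)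
          note \<open>w \<noteq> 0\<close> this
          moreover have "w + (t - v) / 2 = t" using two_neq_0 by (simp add: w_def flip: add_divide_distrib)
          ultimately have "w \<in> ?W" by (metis (mono_tags, lifting) DiffI UNIV_I mem_Collect_eq singletonD)
          then show False using True by blast
        qed
        then have "(t - 2) * (t + 2) \<noteq> 0" "\<eta> ((t - 2) * (t + 2)) = - 1"
          by (auto simp: \<eta>_def)
        then show ?thesis unfolding eta_mult by (auto simp: \<eta>_def split: if_splits)
      qed
      then show ?thesis unfolding True by simp
    next
      case False
      then obtain w where w: "w \<in> ?W" by blast
      then have w0: "w \<noteq> 0" "t = w + 1 / w" by auto
      have W: "?W = {w, 1 / w}"
      proof (rule Set.set_eqI, rule iffI)
        fix x assume "x \<in> ?W"
        then have "x \<noteq> 0" "x + 1 / x = w + 1 / w" using w0 by auto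
        then have "(x - w) * (x - 1 / w) = 0" using w0 by (simp add: field_simps)
        then show "x \<in> {w, 1 / w}" by auto
      qed (use w0 in auto)
      show ?thesis
      proof (cases "w = 1 / w")
        \<comment> \<open>The ramified values t = 2 and t = -2: the fibre is a single point and
          exactly one of the two \<open>\<eta>\<close> terms vanishes.\<close>
        case True
        then have "w * w = 1" using w0 by (metis nonzero_eq_divide_eq)
        then have "w = 1 \<or> w = - 1" by (simp add: square_eq_1_iff)
        then show ?thesis
        proof
          assume "w = 1"
          then have "?W = {1}" "t - 2 = 0" using W w0 by auto
          then show ?thesis using ep[OF w] \<open>w = 1\<close> one_ne by (simp add: \<eta>_def)
        next
          assume "w = - 1"
          then have "?W = {- 1}" "t + 2 = 0" using W w0 by auto
          then show ?thesis using em[OF w] \<open>w = - 1\<close> one_ne by (simp add: \<eta>_def)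
        qed
      next
        case False
        then have "w \<noteq> 1" "w \<noteq> - 1" by auto
        then show ?thesis unfolding W using False em[OF w] ep[OF w] inv[of w]
          by (simp add: inverse_eq_divide)
      qed
    qed
    then show "(\<Sum>w\<in>?W. \<eta> w) * f t = (\<eta> (t - 2) + \<eta> (t + 2)) * f t" by simp
  qed
  finally show ?thesis .
qed

text \<open>If just one of r and D vanishes, this is a Gauss sum. If D/r = c^2 is a nonzero square,
  rescaling by c reduces to \<open>salie_normalized\<close>, which produces two shifted Gauss sums.
  If D/r is not a square, the substitution w -> D/(r w) preserves the phase and reverses the sign of
  \<open>\<eta>\<close>, so the sum is zero.\<close>

lemma norm_salie: "norm (\<Sum>w\<in>UNIV - {0}. \<eta> w * \<chi> (r * w + D / w)) \<le> 2 * sqrt q"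
proof -
  have full: "(\<Sum>w\<in>UNIV - {0}. \<eta> w * f w) = (\<Sum>w\<in>UNIV. \<eta> w * f w)" for f
    by (rule sum.mono_neutral_left) (auto simp: \<eta>_def)
  note inv = eta_inverse
  have g: "norm (gauss c) \<le> 2 * sqrt q" if "c \<noteq> 0" for c using norm_gauss[OF that] by simp
  consider "r = 0" "D = 0" | "r = 0" "D \<noteq> 0" | "r \<noteq> 0" "D = 0" | "r \<noteq> 0" "D \<noteq> 0" by blast
  then show ?thesis
  proof cases
    case 1
    then show ?thesis unfolding full by (simp add: sum_eta)
  next
    case 2
    have "(\<Sum>w\<in>UNIV. \<eta> w * \<chi> (r * w + D / w)) = (\<Sum>w\<in>UNIV. \<eta> (inverse w) * \<chi> (D * inverse w))"
      using 2 by (simp add: inv divide_inverse)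
    also have "\<dots> = gauss D" using 2 by (subst sum_inverse[of "\<lambda>w. \<eta> w * \<chi> (D * w)"]) (simp add: gauss_eq_eta_sum)
    finally show ?thesis unfolding full using g 2 by simp
  next
    case 3
    then show ?thesis unfolding full using g[of r] gauss_eq_eta_sum[of r] by simp
  next
    case 4
    show ?thesis
    proof (cases "\<exists>c. D / r = c\<^sup>2")
      case True
      then obtain c where c: "D / r = c\<^sup>2" by auto
      then have c0: "c \<noteq> 0" "D = r * c\<^sup>2" using 4 by (auto simp: field_simps)
      have "(\<Sum>w\<in>UNIV - {0}. \<eta> w * \<chi> (r * w + D / w)) = (\<Sum>w\<in>UNIV - {0}. \<eta> (c * w) * \<chi> (r * (c * w) + D / (c * w)))"
        by (rule sum.reindex_bij_witness[of _ "\<lambda>w. c * w" "\<lambda>w. w / c"]) (use c0 in auto)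
      also have "\<dots> = \<eta> c * (\<Sum>w\<in>UNIV - {0}. \<eta> w * \<chi> (r * c * (w + 1 / w)))"
        unfolding sum_distrib_left
      proof (intro sum.cong refl)
        fix w :: 'a assume "w \<in> UNIV - {0}"
        then have "r * (c * w) + D / (c * w) = r * c * (w + 1 / w)"
          using c0 by (simp add: field_simps power2_eq_square)
        then show "\<eta> (c * w) * \<chi> (r * (c * w) + D / (c * w)) = \<eta> c * (\<eta> w * \<chi> (r * c * (w + 1 / w)))"
          by (simp add: eta_mult)
      qed
      also have "(\<Sum>w\<in>UNIV - {0}. \<eta> w * \<chi> (r * c * (w + 1 / w)))
          = (\<Sum>t\<in>UNIV. \<eta> (t + - 2) * \<chi> (r * c * t)) + (\<Sum>t\<in>UNIV. \<eta> (t + 2) * \<chi> (r * c * t))"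
        using salie_normalized[of "\<lambda>t. \<chi> (r * c * t)"] by (simp add: distrib_right sum.distrib)
      also have "(\<Sum>t\<in>UNIV. \<eta> (t + - 2) * \<chi> (r * c * t)) = gauss (r * c) * \<chi> (r * c * 2)"
      proof -
        have "(\<Sum>t\<in>UNIV. \<eta> (t + - 2) * \<chi> (r * c * t)) = (\<Sum>t\<in>UNIV. \<eta> (t + - 2) * \<chi> (r * c * ((t + - 2) + 2)))" by simp
        also have "\<dots> = (\<Sum>t\<in>UNIV. \<eta> t * \<chi> (r * c * (t + 2)))" by (rule sum_shift)
        finally show ?thesis using 4 c0 by (simp add: gauss_eq_eta_sum distrib_left add sum_distrib_right mult.assoc)
      qed
      also have "(\<Sum>t\<in>UNIV. \<eta> (t + 2) * \<chi> (r * c * t)) = gauss (r * c) * \<chi> (r * c * - 2)"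
      proof -
        have "(\<Sum>t\<in>UNIV. \<eta> (t + 2) * \<chi> (r * c * t)) = (\<Sum>t\<in>UNIV. \<eta> (t + 2) * \<chi> (r * c * ((t + 2) + - 2)))" by simp
        also have "\<dots> = (\<Sum>t\<in>UNIV. \<eta> t * \<chi> (r * c * (t + - 2)))" by (rule sum_shift)
        finally show ?thesis using 4 c0 by (simp only: gauss_eq_eta_sum distrib_left add sum_distrib_right mult.assoc mult_eq_0_iff simp_thms)
      qed
      finally have "norm (\<Sum>w\<in>UNIV - {0}. \<eta> w * \<chi> (r * w + D / w))
          = norm (\<eta> c) * norm (gauss (r * c) * \<chi> (r * c * 2) + gauss (r * c) * \<chi> (r * c * - 2))"
        by (simp only: norm_mult)
      also have "\<dots> \<le> 1 * (norm (gauss (r * c) * \<chi> (r * c * 2)) + norm (gauss (r * c) * \<chi> (r * c * - 2)))"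
        by (intro mult_mono norm_eta norm_triangle_ineq) auto
      also have "\<dots> = 2 * sqrt q" using 4 c0 by (simp add: norm_mult norm_one norm_gauss)
      finally show ?thesis .
    next
      case False
      have "\<eta> (D / r) = - 1" using False 4 by (simp add: \<eta>_def)
      have "(\<Sum>w\<in>UNIV - {0}. \<eta> w * \<chi> (r * w + D / w)) = (\<Sum>w\<in>UNIV - {0}. \<eta> ((D / r) * inverse w) * \<chi> (r * ((D / r) * inverse w) + D / ((D / r) * inverse w)))"
        by (rule sum.reindex_bij_witness[of _ "\<lambda>w. (D / r) * inverse w" "\<lambda>w. (D / r) * inverse w"]) (use 4 in \<open>auto simp: field_simps\<close>)
      also have "\<dots> = (\<Sum>w\<in>UNIV - {0}. - (\<eta> w * \<chi> (r * w + D / w)))"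
      proof (intro sum.cong refl)
        fix w :: 'a assume "w \<in> UNIV - {0}"
        then have "r * ((D / r) * inverse w) + D / ((D / r) * inverse w) = r * w + D / w"
          using 4 by (simp add: field_simps)
        then show "\<eta> ((D / r) * inverse w) * \<chi> (r * ((D / r) * inverse w) + D / ((D / r) * inverse w)) = - (\<eta> w * \<chi> (r * w + D / w))"
          by (simp only: eta_mult[of "D / r"] \<open>\<eta> (D / r) = - 1\<close> inv) simp
      qed
      finally have "(\<Sum>w\<in>UNIV - {0}. \<eta> w * \<chi> (r * w + D / w)) = 0" by (simp add: sum_negf)
      then show ?thesis by simp
    qed
  qed
qed

section \<open>Exponential sums over vectors and the Fourier transform\<close>

lemma quadratic_vector_sum:
  assumes "s \<noteq> 0"
  shows "(\<Sum>x\<in>fvecs d. \<chi> (s * qnorm d x + (\<Sum>i<d. b i * x i)))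
    = gauss s ^ d * \<chi> (- (qnorm d b / (4 * s)))"
proof -
  have "(\<Sum>x\<in>fvecs d. \<chi> (s * qnorm d x + (\<Sum>i<d. b i * x i)))
      = (\<Sum>x\<in>fvecs d. \<Prod>i<d. \<chi> (s * (x i)\<^sup>2 + b i * x i))"
    by (intro sum.cong refl) (simp add: qnorm_def sum_distrib_left flip: chi_sum sum.distrib)
  also have "\<dots> = (\<Prod>i<d. \<Sum>c\<in>UNIV. \<chi> (s * c\<^sup>2 + b i * c))"
    by (rule sum_fvecs_prod)
  also have "\<dots> = (\<Prod>i<d. gauss s * \<chi> (- ((b i)\<^sup>2 / (4 * s))))"
    by (simp add: complete_square[OF assms])
  also have "\<dots> = gauss s ^ d * \<chi> (- (qnorm d b / (4 * s)))"
    by (simp add: prod.distrib qnorm_def sum_divide_distrib flip: chi_sum sum_negf)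
  finally show ?thesis .
qed

lemma linear_vector_sum:
  "(\<Sum>x\<in>fvecs d. \<chi> (\<Sum>i<d. b i * x i)) = (if \<forall>i<d. b i = 0 then of_nat q ^ d else 0)"
proof -
  have "(\<Sum>x\<in>fvecs d. \<chi> (\<Sum>i<d. b i * x i)) = (\<Sum>x\<in>fvecs d. \<Prod>i<d. \<chi> (b i * x i))"
    by (simp add: chi_sum)
  also have "\<dots> = (\<Prod>i<d. \<Sum>c\<in>UNIV. \<chi> (b i * c))" by (rule sum_fvecs_prod)
  also have "\<dots> = (\<Prod>i<d. if b i = 0 then of_nat q else 0)" by (simp add: orthogonality)
  also have "\<dots> = (if \<forall>i<d. b i = 0 then of_nat q ^ d else 0)" by auto
  finally show ?thesis .
qed

lemma ft_inversion: "f w = (\<Sum>r\<in>UNIV. ft f (- r) * \<chi> (r * w)) / of_nat q"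
proof -
  have "(\<Sum>r\<in>UNIV. ft f (- r) * \<chi> (r * w)) = (\<Sum>r\<in>UNIV. \<Sum>x\<in>UNIV. f x * \<chi> ((w - x) * r))"
    unfolding ft_def sum_distrib_right
    by (intro sum.cong refl) (simp add: mult.assoc algebra_simps flip: add)
  also have "\<dots> = (\<Sum>x\<in>UNIV. f x * (\<Sum>r\<in>UNIV. \<chi> ((w - x) * r)))"
    by (subst sum.swap) (simp add: sum_distrib_left)
  also have "\<dots> = (\<Sum>x\<in>UNIV. if x = w then f w * of_nat q else 0)"
    unfolding orthogonality by (intro sum.cong) auto
  also have "\<dots> = f w * of_nat q" by simp
  finally show ?thesis using q_pos by simp
qed

lemma parseval_complex: "(\<Sum>r\<in>UNIV. ft f r * cnj (ft f r)) = of_nat q * (\<Sum>x\<in>UNIV. f x * cnj (f x))"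
proof -
  have "(\<Sum>r\<in>UNIV. ft f r * cnj (ft f r)) = (\<Sum>r\<in>UNIV. \<Sum>x\<in>UNIV. \<Sum>y\<in>UNIV. f x * cnj (f y) * \<chi> ((x - y) * r))"
    unfolding ft_def cnj_sum sum_product
    by (intro sum.cong refl) (simp add: algebra_simps flip: add chi_minus)
  also have "\<dots> = (\<Sum>x\<in>UNIV. \<Sum>y\<in>UNIV. \<Sum>r\<in>UNIV. f x * cnj (f y) * \<chi> ((x - y) * r))"
    by (rule trans[OF sum.swap], rule sum.cong[OF refl], rule sum.swap)
  also have "\<dots> = (\<Sum>x\<in>UNIV. \<Sum>y\<in>UNIV. if y = x then f x * cnj (f x) * of_nat q else 0)"
    unfolding sum_distrib_left[symmetric] orthogonality by (intro sum.cong refl) auto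
  also have "\<dots> = of_nat q * (\<Sum>x\<in>UNIV. f x * cnj (f x))" by (simp add: sum_distrib_left mult_ac)
  finally show ?thesis .
qed

lemma parseval: "(\<Sum>r\<in>UNIV. (norm (ft f r))\<^sup>2) = real q * (\<Sum>x\<in>UNIV. (norm (f x))\<^sup>2)"
proof -
  have "complex_of_real (\<Sum>r\<in>UNIV. (norm (ft f r))\<^sup>2) = complex_of_real (real q * (\<Sum>x\<in>UNIV. (norm (f x))\<^sup>2))"
    unfolding of_real_mult of_real_sum complex_norm_square parseval_complex by simp
  then show ?thesis by (simp only: of_real_eq_iff)
qed

text \<open>Additive characters diagonalise the form: it equals the average over r of
  \<open>ft k (- r)\<close> times \<open>(ft h r)\<^sup>2\<close>, and Parseval applies once the
  eigenvalues are bounded by M. The zero frequency gets its own allowance M0, since its eigenvalue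
  may be far larger and is then weighted by the mean of h alone.\<close>

lemma convolution_form_bound:
  assumes "\<And>r. r \<noteq> 0 \<Longrightarrow> norm (ft k r) \<le> M" "norm (ft k 0) \<le> M + M0"
  shows "norm (\<Sum>u\<in>UNIV. \<Sum>v\<in>UNIV. h u * h v * k (u + v))
    \<le> M * (\<Sum>u\<in>UNIV. (norm (h u))\<^sup>2) + M0 * (norm (ft h 0))\<^sup>2 / q"
proof -
  have "(\<Sum>u\<in>UNIV. \<Sum>v\<in>UNIV. h u * h v * k (u + v))
      = (\<Sum>u\<in>UNIV. \<Sum>v\<in>UNIV. \<Sum>r\<in>UNIV. ft k (- r) * ((h u * \<chi> (r * u)) * (h v * \<chi> (r * v))) / of_nat q)"
    by (subst ft_inversion[of k]) (simp add: sum_divide_distrib sum_distrib_left distrib_left add mult_ac)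
  also have "\<dots> = (\<Sum>r\<in>UNIV. \<Sum>u\<in>UNIV. \<Sum>v\<in>UNIV. ft k (- r) * ((h u * \<chi> (r * u)) * (h v * \<chi> (r * v))) / of_nat q)"
    by (rule trans[OF _ sum.swap], rule sum.cong[OF refl], rule sum.swap)
  also have "\<dots> = (\<Sum>r\<in>UNIV. ft k (- r) * (ft h r)\<^sup>2 / of_nat q)"
    unfolding ft_def[of h] power2_eq_square sum_product
    by (simp add: sum_distrib_left sum_divide_distrib)
  finally have "norm (\<Sum>u\<in>UNIV. \<Sum>v\<in>UNIV. h u * h v * k (u + v)) \<le> (\<Sum>r\<in>UNIV. norm (ft k (- r) * (ft h r)\<^sup>2 / of_nat q))"
    by (simp only: norm_sum)
  also have "\<dots> \<le> (\<Sum>r\<in>UNIV. (M * (norm (ft h r))\<^sup>2 + (if r = 0 then M0 * (norm (ft h 0))\<^sup>2 else 0)) / q)"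
  proof (rule sum_mono)
    fix r
    have "norm (ft k (- r)) * (norm (ft h r))\<^sup>2 \<le> M * (norm (ft h r))\<^sup>2 + (if r = 0 then M0 * (norm (ft h 0))\<^sup>2 else 0)"
      using mult_right_mono[OF assms(1)[of "- r"], of "(norm (ft h r))\<^sup>2"]
        mult_right_mono[OF assms(2), of "(norm (ft h 0))\<^sup>2"] by (auto simp: algebra_simps)
    then show "norm (ft k (- r) * (ft h r)\<^sup>2 / of_nat q) \<le> (M * (norm (ft h r))\<^sup>2 + (if r = 0 then M0 * (norm (ft h 0))\<^sup>2 else 0)) / q"
      by (simp add: norm_mult norm_divide norm_power divide_right_mono)
  qed
  also have "\<dots> = (M * (\<Sum>r\<in>UNIV. (norm (ft h r))\<^sup>2) + M0 * (norm (ft h 0))\<^sup>2) / q"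
    by (simp add: sum_divide_distrib[symmetric] sum.distrib sum_distrib_left)
  also have "\<dots> = M * (\<Sum>u\<in>UNIV. (norm (h u))\<^sup>2) + M0 * (norm (ft h 0))\<^sup>2 / q"
    unfolding parseval using q_pos by (simp add: field_simps)
  finally show ?thesis .
qed

section \<open>Second moments over the centre of a sphere\<close>

definition pdist :: "nat \<Rightarrow> (nat \<Rightarrow> 'a) \<Rightarrow> (nat \<Rightarrow> 'a) \<Rightarrow> 'a" where
  "pdist d a b = qnorm d (\<lambda>i. a i - b i)"

text \<open>As a function of b the exponent is quadratic with leading coefficient -(s + s').
  Completing the square about the weighted centre of a and a' leaves the reduced coefficient s s'/(s
  + s') on their distance. If s + s' = 0 only a linear phase remains, and it averages to zero unless
  a = a'.\<close>

lemma two_sphere_sum: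
  assumes "a \<in> fvecs d" "a' \<in> fvecs d"
  shows "s + s' \<noteq> 0 \<Longrightarrow> (\<Sum>b\<in>fvecs d. \<chi> (- (s * pdist d a b) - s' * pdist d a' b))
      = gauss (- (s + s')) ^ d * \<chi> (- (s * s' / (s + s') * pdist d a a'))"
    and "s \<noteq> 0 \<Longrightarrow> (\<Sum>b\<in>fvecs d. \<chi> (- (s * pdist d a b) - (- s) * pdist d a' b)) = (if a = a' then of_nat q ^ d else 0)"
proof -
  define e where "e s' i = 2 * (s * a i + s' * a' i)" for s' i
  have expand: "- (s * pdist d a b) - s' * pdist d a' b
      = (- (s + s') * qnorm d b + (\<Sum>i<d. e s' i * b i)) + (- (s * qnorm d a) - s' * qnorm d a')" for b s'
    unfolding pdist_def qnorm_def e_def sum_distrib_left sum_negf[symmetric] sum_subtractf[symmetric] sum.distrib[symmetric]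
    by (intro sum.cong refl) (simp add: power2_eq_square algebra_simps)
  {
    assume ss: "s + s' \<noteq> 0"
    have "(\<Sum>b\<in>fvecs d. \<chi> (- (s * pdist d a b) - s' * pdist d a' b))
        = gauss (- (s + s')) ^ d * \<chi> (- (qnorm d (e s') / (4 * - (s + s')))) * \<chi> (- (s * qnorm d a) - s' * qnorm d a')"
      unfolding expand add[of "_ + _" "_ - _"] sum_distrib_right[symmetric]
      by (subst quadratic_vector_sum) (use ss in \<open>auto simp: add_eq_0_iff\<close>)
    also have "\<dots> = gauss (- (s + s')) ^ d * \<chi> (- (qnorm d (e s') / (4 * - (s + s'))) + (- (s * qnorm d a) - s' * qnorm d a'))"
      by (simp only: add mult.assoc)
    also have "- (qnorm d (e s') / (4 * - (s + s'))) + (- (s * qnorm d a) - s' * qnorm d a')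
        = - (s * s' / (s + s') * pdist d a a')"
    proof -
      have "qnorm d (e s') = 4 * (\<Sum>i<d. (s * a i + s' * a' i)\<^sup>2)"
        by (simp add: qnorm_def e_def power2_eq_square sum_distrib_left algebra_simps)
      then have "- (qnorm d (e s') / (4 * - (s + s'))) = (\<Sum>i<d. (s * a i + s' * a' i)\<^sup>2) / (s + s')"
        using mult_divide_mult_cancel_left[OF four_neq_0, of "\<Sum>i<d. (s * a i + s' * a' i)\<^sup>2" "- (s + s')"]
        by (simp only: divide_minus_right minus_minus)
      moreover have "(\<Sum>i<d. (s * a i + s' * a' i)\<^sup>2) = (s + s') * (s * qnorm d a + s' * qnorm d a') - s * s' * pdist d a a'"
        unfolding qnorm_def pdist_def sum_distrib_left sum_subtractf[symmetric] sum.distrib[symmetric]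
        by (intro sum.cong refl) (simp add: power2_eq_square algebra_simps)
      ultimately show ?thesis using ss by (simp add: diff_divide_distrib)
    qed
    finally show "(\<Sum>b\<in>fvecs d. \<chi> (- (s * pdist d a b) - s' * pdist d a' b))
      = gauss (- (s + s')) ^ d * \<chi> (- (s * s' / (s + s') * pdist d a a'))" .
  }
  {
    assume s: "s \<noteq> 0"
    have "(\<Sum>b\<in>fvecs d. \<chi> (- (s * pdist d a b) - (- s) * pdist d a' b))
        = (if \<forall>i<d. e (- s) i = 0 then of_nat q ^ d else 0) * \<chi> (- (s * qnorm d a) - (- s) * qnorm d a')"
      unfolding expand add[of "_ + _" "_ - _"] sum_distrib_right[symmetric]
      by (simp add: linear_vector_sum)
    also have "(\<forall>i<d. e (- s) i = 0) \<longleftrightarrow> a = a'"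
    proof
      assume "\<forall>i<d. e (- s) i = 0"
      then have "a i = a' i" if "i < d" for i using that s two_neq_0 by (auto simp: e_def)
      moreover have "a i = a' i" if "\<not> i < d" for i using that assms by (auto simp: fvecs_def)
      ultimately show "a = a'" by blast
    qed (auto simp: e_def)
    finally show "(\<Sum>b\<in>fvecs d. \<chi> (- (s * pdist d a b) - (- s) * pdist d a' b)) = (if a = a' then of_nat q ^ d else 0)"
      by auto
  }
qed

lemma ft_pos_neg: "ft (\<lambda>t. of_real (g t)) (- s) = cnj (ft (\<lambda>t. of_real (g t)) s)"
  by (simp add: ft_def flip: chi_minus)

text \<open>In the variables \<open>u = 1/s\<close>, \<open>v = 1/s'\<close> the phase \<open>s s'/(s + s')\<close> becomes \<open>1/(u + v)\<close>, so the
  quadratic form in \<open>g\<close> is a convolution form.\<close>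
lemma spherical_second_moment:
  fixes g :: "'a \<Rightarrow> real" and \<zeta> :: "'a \<Rightarrow> complex" and K :: "'a \<Rightarrow> 'a \<Rightarrow> complex"
  assumes A: "A \<subseteq> fvecs d" and g0: "(\<Sum>t\<in>UNIV. g t) = 0"
    and \<zeta>: "\<And>u. norm (\<zeta> u) \<le> 1"
    and K: "\<And>D u v. u \<noteq> 0 \<Longrightarrow> v \<noteq> 0 \<Longrightarrow> u + v \<noteq> 0 \<Longrightarrow>
        gauss (- ((u + v) / (u * v))) ^ d * \<chi> (- (D / (u + v))) = \<zeta> u * \<zeta> v * K D (u + v)"
      "\<And>D. K D 0 = 0"
    and M: "\<And>D r. r \<noteq> 0 \<Longrightarrow> norm (ft (K D) r) \<le> M" "\<And>D. norm (ft (K D) 0) \<le> M + M0"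
  defines "h \<equiv> \<lambda>u. ft (\<lambda>t. of_real (g t)) (inverse u) * \<zeta> u"
  shows "real q ^ 2 * (\<Sum>b\<in>fvecs d. (\<Sum>a\<in>A. g (pdist d a b))\<^sup>2)
    \<le> real q ^ (d + 1) * card A * (\<Sum>t\<in>UNIV. (g t)\<^sup>2)
      + (card A)\<^sup>2 * (M * (q * (\<Sum>t\<in>UNIV. (g t)\<^sup>2)) + M0 * (norm (ft h 0))\<^sup>2 / q)"
proof -
  have M_pos: "M \<ge> 0" using order.trans[OF norm_ge_zero M(1)[of 1 0]] by simp
  define G where "G = (\<lambda>t. complex_of_real (g t))"
  define gh where "gh = ft G"
  have h_eq: "h = (\<lambda>u. gh (inverse u) * \<zeta> u)" by (simp add: h_def gh_def G_def)
  \<comment> \<open>The mean of g being zero disposes of frequency 0. Since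
    \<open>inverse 0 = 0\<close>, the later substitution by inverses can thus run over the whole
    field.\<close>
  have gh0: "gh 0 = 0" using g0 by (simp add: gh_def ft_def G_def flip: of_real_sum)
  have finA: "finite A" using A finite_fvecs by (rule finite_subset)
  define S where "S a b = pdist d a b" for a b
  define W where "W s s' a a' = (\<Sum>b\<in>fvecs d. \<chi> (- (s * S a b) - s' * S a' b))" for s s' a a'
  define G2 where "G2 = (\<Sum>t\<in>UNIV. (g t)\<^sup>2)"
  have inv: "of_nat q * G t = (\<Sum>s\<in>UNIV. gh s * \<chi> (- (s * t)))" for t
  proof -
    have "of_nat q * G t = (\<Sum>r\<in>UNIV. gh (- r) * \<chi> (r * t))"
      using ft_inversion[of G t] q_pos by (simp add: gh_def field_simps)
    also have "\<dots> = (\<Sum>r\<in>UNIV. gh (- r) * \<chi> (- (- r * t)))" by simp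
    also have "\<dots> = (\<Sum>s\<in>UNIV. gh s * \<chi> (- (s * t)))" by (rule sum_uminus)
    finally show ?thesis .
  qed
  have F: "of_nat q * complex_of_real (\<Sum>a\<in>A. g (S a b)) = (\<Sum>s\<in>UNIV. \<Sum>a\<in>A. gh s * \<chi> (- (s * S a b)))" for b
  proof -
    have "of_nat q * complex_of_real (\<Sum>a\<in>A. g (S a b)) = (\<Sum>a\<in>A. of_nat q * G (S a b))"
      by (simp add: G_def sum_distrib_left)
    also have "\<dots> = (\<Sum>a\<in>A. \<Sum>s\<in>UNIV. gh s * \<chi> (- (s * S a b)))" by (simp only: inv)
    finally show ?thesis by (subst (asm) sum.swap)
  qed
  have add_minus: "\<chi> (- x - y) = \<chi> (- x) * \<chi> (- y)" for x y
    by (metis add diff_conv_add_uminus)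
  have "complex_of_real (real q ^ 2 * (\<Sum>b\<in>fvecs d. (\<Sum>a\<in>A. g (S a b))\<^sup>2))
      = (\<Sum>b\<in>fvecs d. (of_nat q * of_real (\<Sum>a\<in>A. g (S a b)))\<^sup>2)"
    unfolding power_mult_distrib sum_distrib_left[symmetric] by simp
  also have "\<dots> = (\<Sum>b\<in>fvecs d. \<Sum>s\<in>UNIV. \<Sum>s'\<in>UNIV. \<Sum>a\<in>A. \<Sum>a'\<in>A. gh s * gh s' * \<chi> (- (s * S a b) - s' * S a' b))"
    unfolding F power2_eq_square sum_product
    by (intro sum.cong refl) (simp only: add_minus mult_ac)
  also have "\<dots> = (\<Sum>s\<in>UNIV. \<Sum>s'\<in>UNIV. \<Sum>a\<in>A. \<Sum>a'\<in>A. \<Sum>b\<in>fvecs d. gh s * gh s' * \<chi> (- (s * S a b) - s' * S a' b))"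
    by (simp only: sum.swap[of _ _ "fvecs d"])
  also have "\<dots> = (\<Sum>s\<in>UNIV. \<Sum>s'\<in>UNIV. gh s * gh s' * (\<Sum>a\<in>A. \<Sum>a'\<in>A. W s s' a a'))"
    by (simp add: W_def sum_distrib_left)
  also have "\<dots> = (\<Sum>u\<in>UNIV. \<Sum>v\<in>UNIV. gh (inverse u) * gh (inverse v) * (\<Sum>a\<in>A. \<Sum>a'\<in>A. W (inverse u) (inverse v) a a'))"
    by (subst sum_inverse[symmetric], rule sum.cong[OF refl], rule sum_inverse[symmetric])
  also have "\<dots> = (\<Sum>u\<in>UNIV. \<Sum>v\<in>UNIV. (\<Sum>a\<in>A. \<Sum>a'\<in>A. h u * h v * K (S a a') (u + v))
      + (if v = - u then gh (inverse u) * gh (- inverse u) * (of_nat q ^ d * of_nat (card A)) else 0))"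
  proof (intro sum.cong refl)
    fix u v :: 'a
    show "gh (inverse u) * gh (inverse v) * (\<Sum>a\<in>A. \<Sum>a'\<in>A. W (inverse u) (inverse v) a a')
      = (\<Sum>a\<in>A. \<Sum>a'\<in>A. h u * h v * K (S a a') (u + v))
      + (if v = - u then gh (inverse u) * gh (- inverse u) * (of_nat q ^ d * of_nat (card A)) else 0)"
    proof (cases "u = 0 \<or> v = 0")
      case True
      then show ?thesis by (auto simp: gh0 h_eq)
    next
      case False
      show ?thesis
      proof (cases "u + v = 0")
        \<comment> \<open>Opposite frequencies: only a = a' survives, which gives the diagonal term
          q^d |A|. It is booked separately because \<open>K\<close> is set to 0 at 0.\<close>
        case True
        then have v: "v = - u" by (simp add: eq_neg_iff_add_eq_0 add.commute)
        have "(\<Sum>a\<in>A. \<Sum>a'\<in>A. W (inverse u) (inverse v) a a') = (\<Sum>a\<in>A. \<Sum>a'\<in>A. if a = a' then of_nat q ^ d else 0)"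
        proof (intro sum.cong refl)
          fix a a' assume "a \<in> A" "a' \<in> A"
          then have "a \<in> fvecs d" "a' \<in> fvecs d" using A by auto
          from two_sphere_sum(2)[OF this, of "inverse u"] False
          show "W (inverse u) (inverse v) a a' = (if a = a' then of_nat q ^ d else 0)"
            by (simp add: W_def v S_def)
        qed
        also have "\<dots> = of_nat q ^ d * of_nat (card A)" using finA by simp
        finally show ?thesis using True v by (simp add: K(2))
      next
        case uv: False
        then have "v \<noteq> - u" by auto
        have s: "inverse u + inverse v = (u + v) / (u * v)" using False by (simp add: field_simps)
        then have s0: "inverse u + inverse v \<noteq> 0" using uv False by auto
        have "inverse u * inverse v / (inverse u + inverse v) = 1 / (u + v)"
          unfolding s using False uv by (simp add: field_simps)
        then have W: "W (inverse u) (inverse v) a a' = \<zeta> u * \<zeta> v * K (S a a') (u + v)" if "a \<in> A" "a' \<in> A" for a a'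
          using two_sphere_sum(1)[OF _ _ s0, of a d a'] that A K(1)[of u v "S a a'"] False uv
          by (auto simp: W_def S_def s)
        show ?thesis using \<open>v \<noteq> - u\<close>
          by (simp add: W h_eq sum_distrib_left mult_ac cong: sum.cong)
      qed
    qed
  qed
  also have "\<dots> = (\<Sum>a\<in>A. \<Sum>a'\<in>A. \<Sum>u\<in>UNIV. \<Sum>v\<in>UNIV. h u * h v * K (S a a') (u + v))
      + (\<Sum>u\<in>UNIV. gh (inverse u) * gh (- inverse u)) * (of_nat q ^ d * of_nat (card A))"
  proof -
    have "(\<Sum>u\<in>UNIV. \<Sum>v\<in>UNIV. \<Sum>a\<in>A. \<Sum>a'\<in>A. h u * h v * K (S a a') (u + v))
        = (\<Sum>a\<in>A. \<Sum>a'\<in>A. \<Sum>u\<in>UNIV. \<Sum>v\<in>UNIV. h u * h v * K (S a a') (u + v))"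
      by (simp only: sum.swap[of _ A UNIV])
    then show ?thesis by (simp add: sum.distrib sum_distrib_right)
  qed
  also have "(\<Sum>u\<in>UNIV. gh (inverse u) * gh (- inverse u)) = of_real (q * G2)"
  proof -
    have "(\<Sum>u\<in>UNIV. gh (inverse u) * gh (- inverse u)) = (\<Sum>s\<in>UNIV. gh s * gh (- s))"
      by (rule sum_inverse[of "\<lambda>s. gh s * gh (- s)"])
    also have "\<dots> = of_nat q * (\<Sum>x\<in>UNIV. G x * cnj (G x))"
      using parseval_complex[of G] by (simp add: gh_def G_def ft_pos_neg)
    finally show ?thesis by (simp add: G2_def G_def power2_eq_square)
  qed
  finally have main: "complex_of_real (real q ^ 2 * (\<Sum>b\<in>fvecs d. (\<Sum>a\<in>A. g (S a b))\<^sup>2))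
      = (\<Sum>a\<in>A. \<Sum>a'\<in>A. \<Sum>u\<in>UNIV. \<Sum>v\<in>UNIV. h u * h v * K (S a a') (u + v)) + of_real (q * G2 * (real q ^ d * real (card A)))"
    by simp
  have h2: "(\<Sum>u\<in>UNIV. (norm (h u))\<^sup>2) \<le> q * G2"
  proof -
    have "(\<Sum>u\<in>UNIV. (norm (h u))\<^sup>2) \<le> (\<Sum>u\<in>UNIV. (norm (gh (inverse u)))\<^sup>2)"
    proof (rule sum_mono)
      fix u
      have "norm (gh (inverse u)) * norm (\<zeta> u) \<le> norm (gh (inverse u)) * 1"
        by (intro mult_left_mono \<zeta>) auto
      then show "(norm (h u))\<^sup>2 \<le> (norm (gh (inverse u)))\<^sup>2"
        by (simp add: h_eq norm_mult power_mono)
    qed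
    also have "\<dots> = (\<Sum>s\<in>UNIV. (norm (gh s))\<^sup>2)" by (rule sum_inverse)
    also have "\<dots> = q * G2" by (simp add: gh_def parseval G2_def G_def)
    finally show ?thesis .
  qed
  define B where "B = M * (q * G2) + M0 * (norm (ft h 0))\<^sup>2 / q"
  have "norm (\<Sum>a\<in>A. \<Sum>a'\<in>A. \<Sum>u\<in>UNIV. \<Sum>v\<in>UNIV. h u * h v * K (S a a') (u + v)) \<le> (\<Sum>a\<in>A. \<Sum>a'\<in>A. B)"
  proof (rule order.trans[OF norm_sum], rule sum_mono, rule order.trans[OF norm_sum], rule sum_mono)
    fix a a'
    have "norm (\<Sum>u\<in>UNIV. \<Sum>v\<in>UNIV. h u * h v * K (S a a') (u + v))
        \<le> M * (\<Sum>u\<in>UNIV. (norm (h u))\<^sup>2) + M0 * (norm (ft h 0))\<^sup>2 / q"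
      by (rule convolution_form_bound) (use M in auto)
    also have "\<dots> \<le> B" unfolding B_def using mult_left_mono[OF h2 M_pos] by simp
    finally show "norm (\<Sum>u\<in>UNIV. \<Sum>v\<in>UNIV. h u * h v * K (S a a') (u + v)) \<le> B" .
  qed
  also have "\<dots> = (card A)\<^sup>2 * B" by (simp add: power2_eq_square)
  finally have bound: "norm (\<Sum>a\<in>A. \<Sum>a'\<in>A. \<Sum>u\<in>UNIV. \<Sum>v\<in>UNIV. h u * h v * K (S a a') (u + v)) \<le> (card A)\<^sup>2 * B" .
  have "real q ^ 2 * (\<Sum>b\<in>fvecs d. (\<Sum>a\<in>A. g (S a b))\<^sup>2)
      = Re (\<Sum>a\<in>A. \<Sum>a'\<in>A. \<Sum>u\<in>UNIV. \<Sum>v\<in>UNIV. h u * h v * K (S a a') (u + v)) + q * G2 * (real q ^ d * real (card A))"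
    using arg_cong[OF main, of Re] by simp
  also have "\<dots> \<le> (card A)\<^sup>2 * B + q * G2 * (real q ^ d * real (card A))"
    using order.trans[OF complex_Re_le_cmod bound] by simp
  finally show ?thesis unfolding S_def B_def G2_def by (simp add: algebra_simps)
qed

lemma sum_ft_inverse: "(\<Sum>u\<in>UNIV. ft f (inverse u)) = of_nat q * f 0"
proof -
  have "(\<Sum>u\<in>UNIV. ft f (inverse u)) = (\<Sum>s\<in>UNIV. ft f s)" by (rule sum_inverse)
  also have "\<dots> = (\<Sum>s\<in>UNIV. ft f (- s))" by (rule sum_uminus[symmetric])
  also have "\<dots> = of_nat q * f 0" using ft_inversion[of f 0] q_pos by simp
  finally show ?thesis .
qed

lemma gauss_pow_even: "even d \<Longrightarrow> c \<noteq> 0 \<Longrightarrow> gauss c ^ d = gauss 1 ^ d"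
  by (auto simp: power_mult gauss_sq elim!: evenE)

lemma norm_gauss_pow: "c \<noteq> 0 \<Longrightarrow> norm (gauss c ^ d) = sqrt q ^ d"
  by (simp add: norm_power norm_gauss)

lemma eta_pow_odd: "odd d \<Longrightarrow> \<eta> x ^ d = \<eta> x"
  by (auto simp: \<eta>_def odd_pos)

text \<open>An even power of a Gauss sum does not depend on its nonzero argument, so no twist is
  required (\<open>\<zeta> = 1\<close>) and the kernel transforms are Kloosterman sums. At r = 0 and
  D = 0 there is no cancellation; the trivial bound q enters through M0, multiplied by the transform
  of h at 0, which is q g(0).\<close>

lemma second_moment_even:
  fixes g :: "'a \<Rightarrow> real"
  assumes weil: "\<And>a. a \<noteq> 0 \<Longrightarrow> norm (\<Sum>x\<in>UNIV - {0}. \<chi> (x + a / x)) \<le> 2 * sqrt q"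
    and d: "even d" and A: "A \<subseteq> fvecs d" and g0: "(\<Sum>t\<in>UNIV. g t) = 0"
  shows "real q ^ 2 * (\<Sum>b\<in>fvecs d. (\<Sum>a\<in>A. g (pdist d a b))\<^sup>2)
    \<le> real q ^ (d + 1) * card A * (\<Sum>t\<in>UNIV. (g t)\<^sup>2)
      + (card A)\<^sup>2 * (2 * sqrt q ^ (d + 1) * (q * (\<Sum>t\<in>UNIV. (g t)\<^sup>2)) + sqrt q ^ d * (real q)\<^sup>2 * (g 0)\<^sup>2)"
proof -
  define K where "K D w = (if w = 0 then 0 else gauss 1 ^ d * \<chi> (- (D / w)))" for D w
  have ft_K: "ft (K D) r = gauss 1 ^ d * (\<Sum>w\<in>UNIV - {0}. \<chi> (r * w + - D / w))" for D r
  proof -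
    have "ft (K D) r = (\<Sum>w\<in>UNIV - {0}. K D w * \<chi> (r * w))"
      unfolding ft_def by (rule sum.mono_neutral_right) (auto simp: K_def)
    also have "\<dots> = (\<Sum>w\<in>UNIV - {0}. gauss 1 ^ d * \<chi> (r * w + - D / w))"
    proof (intro sum.cong refl)
      fix w :: 'a assume "w \<in> UNIV - {0}"
      then show "K D w * \<chi> (r * w) = gauss 1 ^ d * \<chi> (r * w + - D / w)"
        by (simp only: K_def add) simp
    qed
    finally show ?thesis by (simp add: sum_distrib_left)
  qed
  have q1: "1 \<le> 2 * sqrt q" using q_pos by (simp add: real_le_rsqrt order_trans[of 1 "sqrt q"])
  have klo: "norm (\<Sum>w\<in>UNIV - {0}. \<chi> (r * w + - D / w)) \<le> 2 * sqrt q" if r: "r \<noteq> 0" for r D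
  proof (cases "D = 0")
    case True
    have "(\<Sum>w\<in>UNIV. \<chi> (r * w)) = 1 + (\<Sum>w\<in>UNIV - {0}. \<chi> (r * w))"
      by (subst sum.remove[of _ 0]) auto
    then have "(\<Sum>w\<in>UNIV - {0}. \<chi> (r * w)) = - 1" using r by (simp add: orthogonality eq_neg_iff_add_eq_0 add.commute)
    then show ?thesis using True q1 by simp
  next
    case False
    have "(\<Sum>w\<in>UNIV - {0}. \<chi> (r * w + - D / w)) = (\<Sum>x\<in>UNIV - {0}. \<chi> (x + (- D * r) / x))"
      by (rule sum.reindex_bij_witness[of _ "\<lambda>x. x / r" "\<lambda>w. r * w"]) (use r in auto)
    then show ?thesis using weil[of "- D * r"] False r by simp
  qed
  have triv: "norm (\<Sum>w\<in>UNIV - {0}. \<chi> (r * w + - D / w)) \<le> real q" for r D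
  proof -
    have "norm (\<Sum>w\<in>UNIV - {0}. \<chi> (r * w + - D / w)) \<le> (\<Sum>w\<in>UNIV - {0::'a}. 1)"
      by (rule order.trans[OF norm_sum]) (simp add: norm_one)
    also have "\<dots> \<le> real q" by (simp add: q_def)
    finally show ?thesis .
  qed
  have "real q ^ 2 * (\<Sum>b\<in>fvecs d. (\<Sum>a\<in>A. g (pdist d a b))\<^sup>2)
    \<le> real q ^ (d + 1) * card A * (\<Sum>t\<in>UNIV. (g t)\<^sup>2)
      + (card A)\<^sup>2 * (2 * sqrt q ^ (d + 1) * (q * (\<Sum>t\<in>UNIV. (g t)\<^sup>2))
        + (sqrt q ^ d * q) * (norm (ft (\<lambda>u. ft (\<lambda>t. of_real (g t)) (inverse u) * 1) 0))\<^sup>2 / q)"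
  proof (rule spherical_second_moment[OF A g0, where K = K and \<zeta> = "\<lambda>_. 1"])
    fix D u v :: 'a assume "u \<noteq> 0" "v \<noteq> 0" "u + v \<noteq> 0"
    then show "gauss (- ((u + v) / (u * v))) ^ d * \<chi> (- (D / (u + v))) = 1 * 1 * K D (u + v)"
      using gauss_pow_even[OF d, of "- ((u + v) / (u * v))"] by (simp add: K_def)
  next
    fix D r :: 'a assume "r \<noteq> 0"
    show "norm (ft (K D) r) \<le> 2 * sqrt q ^ (d + 1)"
      unfolding ft_K norm_mult norm_gauss_pow[OF one_neq_zero]
      using mult_left_mono[OF klo[OF \<open>r \<noteq> 0\<close>, of D], of "sqrt q ^ d"] by (simp add: mult_ac)
  next
    fix D :: 'a
    have "norm (ft (K D) 0) \<le> sqrt q ^ d * q"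
      unfolding ft_K norm_mult norm_gauss_pow[OF one_neq_zero] by (intro mult_left_mono triv) auto
    moreover have "0 \<le> 2 * sqrt q ^ (d + 1)" by simp
    ultimately show "norm (ft (K D) 0) \<le> 2 * sqrt q ^ (d + 1) + sqrt q ^ d * q" by linarith
  qed (auto simp: K_def)
  also have "ft (\<lambda>u. ft (\<lambda>t. of_real (g t)) (inverse u) * 1) 0 = of_nat q * of_real (g 0)"
    by (subst ft_def) (simp add: sum_ft_inverse)
  finally show ?thesis using q_pos by (simp add: norm_mult power_mult_distrib mult_ac)
qed

text \<open>An odd power keeps one factor \<open>\<eta>\<close>. It splits multiplicatively: the
  values at u and v go into the twists \<open>\<zeta>\<close>, the value at u + v into the kernel,
  whose transforms become Salie sums. These are small at the zero frequency too, so M0 = 0.\<close>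

lemma second_moment_odd:
  fixes g :: "'a \<Rightarrow> real"
  assumes d: "odd d" and A: "A \<subseteq> fvecs d" and g0: "(\<Sum>t\<in>UNIV. g t) = 0"
  shows "real q ^ 2 * (\<Sum>b\<in>fvecs d. (\<Sum>a\<in>A. g (pdist d a b))\<^sup>2)
    \<le> real q ^ (d + 1) * card A * (\<Sum>t\<in>UNIV. (g t)\<^sup>2)
      + (card A)\<^sup>2 * (2 * sqrt q ^ (d + 1) * (q * (\<Sum>t\<in>UNIV. (g t)\<^sup>2)))"
proof -
  define K where "K D w = (if w = 0 then 0 else gauss (- w) ^ d * \<chi> (- (D / w)))" for D w
  have ft_K: "ft (K D) r = gauss (- 1) ^ d * (\<Sum>w\<in>UNIV - {0}. \<eta> w * \<chi> (r * w + - D / w))" for D r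
  proof -
    have "ft (K D) r = (\<Sum>w\<in>UNIV - {0}. K D w * \<chi> (r * w))"
      unfolding ft_def by (rule sum.mono_neutral_right) (auto simp: K_def)
    also have "\<dots> = (\<Sum>w\<in>UNIV - {0}. gauss (- 1) ^ d * (\<eta> w * \<chi> (r * w + - D / w)))"
    proof (intro sum.cong refl)
      fix w :: 'a assume "w \<in> UNIV - {0}"
      then have "w \<noteq> 0" by simp
      then have "gauss (- w) ^ d = \<eta> w * gauss (- 1) ^ d"
        using gauss_mult[of w "- 1"] eta_pow_odd[OF d] by (simp add: power_mult_distrib)
      then show "K D w * \<chi> (r * w) = gauss (- 1) ^ d * (\<eta> w * \<chi> (r * w + - D / w))"
        using \<open>w \<noteq> 0\<close> by (simp only: K_def add) simp
    qed
    finally show ?thesis by (simp add: sum_distrib_left)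
  qed
  have M: "norm (ft (K D) r) \<le> 2 * sqrt q ^ (d + 1)" for D r
  proof -
    have "norm (ft (K D) r) = sqrt q ^ d * norm (\<Sum>w\<in>UNIV - {0}. \<eta> w * \<chi> (r * w + - D / w))"
      unfolding ft_K norm_mult by (subst norm_gauss_pow) auto
    also have "\<dots> \<le> sqrt q ^ d * (2 * sqrt q)" by (intro mult_left_mono norm_salie) auto
    finally show ?thesis by (simp add: mult_ac)
  qed
  have "real q ^ 2 * (\<Sum>b\<in>fvecs d. (\<Sum>a\<in>A. g (pdist d a b))\<^sup>2)
    \<le> real q ^ (d + 1) * card A * (\<Sum>t\<in>UNIV. (g t)\<^sup>2)
      + (card A)\<^sup>2 * (2 * sqrt q ^ (d + 1) * (q * (\<Sum>t\<in>UNIV. (g t)\<^sup>2))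
        + 0 * (norm (ft (\<lambda>u. ft (\<lambda>t. of_real (g t)) (inverse u) * \<eta> u) 0))\<^sup>2 / q)"
  proof (rule spherical_second_moment[OF A g0, where K = K and \<zeta> = \<eta>])
    fix D u v :: 'a assume uv: "u \<noteq> 0" "v \<noteq> 0" "u + v \<noteq> 0"
    have "- ((u + v) / (u * v)) = inverse (u * v) * - (u + v)"
      by (metis divide_inverse mult.commute mult_minus_left)
    then have "gauss (- ((u + v) / (u * v))) = \<eta> (inverse (u * v)) * gauss (- (u + v))"
      using uv gauss_mult[of "inverse (u * v)" "- (u + v)"] by (simp add: add_eq_0_iff)
    also have "\<eta> (inverse (u * v)) = \<eta> u * \<eta> v" by (simp only: eta_inverse eta_mult)
    finally have "gauss (- ((u + v) / (u * v))) ^ d = \<eta> u * \<eta> v * gauss (- (u + v)) ^ d"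
      using eta_pow_odd[OF d] by (simp only: power_mult_distrib)
    then show "gauss (- ((u + v) / (u * v))) ^ d * \<chi> (- (D / (u + v))) = \<eta> u * \<eta> v * K D (u + v)"
      using uv by (simp add: K_def)
  qed (use M norm_eta in \<open>auto simp: K_def\<close>)
  then show ?thesis by simp
qed

section \<open>The regime of small A\<close>

lemma dist_set_eq: "dist_set d A B = (\<lambda>(a, b). pdist d a b) ` (A \<times> B)"
  by (auto simp: dist_set_def pdist_def)

text \<open>With \<delta> the density of the distance set, every b in B gives the sum of g over A
  the value |A| (1 - \<delta>). Comparison with the second moment over all centres bounds |A||B| (1
  - \<delta>)^2; the size condition on A makes the contribution of its pairs at most twice that of
  the diagonal.\<close>

lemma card_dist_set_small:
  fixes A B :: "(nat \<Rightarrow> 'a) set"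
  assumes weil: "\<And>a. a \<noteq> 0 \<Longrightarrow> norm (\<Sum>x\<in>UNIV - {0}. \<chi> (x + a / x)) \<le> 2 * sqrt q"
    and A: "A \<subseteq> fvecs d" "real (card A) \<le> sqrt q ^ (d - 1)" and B: "B \<subseteq> fvecs d" and d: "d > 0"
    and AB: "real (card A) * real (card B) \<ge> (if even d then 16 else 4) * real q ^ d"
  shows "real (card (dist_set d A B)) \<ge> real q / 2"
proof -
  define \<Delta> where "\<Delta> = dist_set d A B"
  define \<delta> where "\<delta> = real (card \<Delta>) / q"
  define g where "g t = of_bool (t \<in> \<Delta>) - \<delta>" for t
  define \<alpha> where "\<alpha> = real (card A)"
  define \<beta> where "\<beta> = real (card B)"
  have q0: "real q > 0" using q_pos by simp
  have card_le: "card \<Delta> \<le> q" unfolding q_def by (rule card_mono) auto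
  have \<delta>: "0 \<le> \<delta>" "\<delta> \<le> 1" using card_le q0 by (auto simp: \<delta>_def)
  have card\<Delta>: "(\<Sum>t\<in>UNIV. of_bool (t \<in> \<Delta>)) = q * \<delta>"
    using q0 by (simp add: \<delta>_def of_bool_def sum.If_cases)
  have g0: "(\<Sum>t\<in>UNIV. g t) = 0"
    unfolding g_def sum_subtractf card\<Delta> by (simp add: q_def)
  have G2: "(\<Sum>t\<in>UNIV. (g t)\<^sup>2) = q * \<delta> * (1 - \<delta>)"
  proof -
    have "(\<Sum>t\<in>UNIV. (g t)\<^sup>2) = (\<Sum>t\<in>UNIV. (1 - 2 * \<delta>) * of_bool (t \<in> \<Delta>) + \<delta>\<^sup>2)"
      by (intro sum.cong refl) (auto simp: g_def power2_eq_square algebra_simps)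
    also have "\<dots> = (1 - 2 * \<delta>) * (q * \<delta>) + q * \<delta>\<^sup>2"
      by (simp only: sum.distrib sum_distrib_left[symmetric] card\<Delta>) (simp add: q_def)
    finally show ?thesis by (simp add: power2_eq_square algebra_simps)
  qed
  have g0sq: "(g 0)\<^sup>2 \<le> 1" using \<delta> by (auto simp: g_def abs_square_le_1)
  have "\<beta> * (\<alpha> * (1 - \<delta>))\<^sup>2 = (\<Sum>b\<in>B. (\<Sum>a\<in>A. g (pdist d a b))\<^sup>2)"
  proof -
    have "(\<Sum>a\<in>A. g (pdist d a b)) = \<alpha> * (1 - \<delta>)" if "b \<in> B" for b
    proof -
      have "(\<Sum>a\<in>A. g (pdist d a b)) = (\<Sum>a\<in>A. 1 - \<delta>)"
        using that by (intro sum.cong refl) (auto simp: g_def \<Delta>_def dist_set_eq)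
      then show ?thesis by (simp add: \<alpha>_def)
    qed
    then show ?thesis by (simp add: \<beta>_def)
  qed
  also have "\<dots> \<le> (\<Sum>b\<in>fvecs d. (\<Sum>a\<in>A. g (pdist d a b))\<^sup>2)"
    using B by (intro sum_mono2 finite_fvecs) auto
  finally have low: "(real q)\<^sup>2 * (\<beta> * (\<alpha> * (1 - \<delta>))\<^sup>2) \<le> (real q)\<^sup>2 * (\<Sum>b\<in>fvecs d. (\<Sum>a\<in>A. g (pdist d a b))\<^sup>2)"
    by (rule mult_left_mono) simp
  define E where "E = (if even d then sqrt q ^ d else 0)"
  have "(real q)\<^sup>2 * (\<beta> * (\<alpha> * (1 - \<delta>))\<^sup>2)
      \<le> real q ^ (d + 1) * \<alpha> * (q * \<delta> * (1 - \<delta>)) + \<alpha>\<^sup>2 * (2 * sqrt q ^ (d + 1) * (q * (q * \<delta> * (1 - \<delta>))) + E * (real q)\<^sup>2)"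
  proof (cases "even d")
    case True
    have "\<alpha>\<^sup>2 * (2 * sqrt q ^ (d + 1) * (q * (q * \<delta> * (1 - \<delta>))) + sqrt q ^ d * (real q)\<^sup>2 * (g 0)\<^sup>2)
        \<le> \<alpha>\<^sup>2 * (2 * sqrt q ^ (d + 1) * (q * (q * \<delta> * (1 - \<delta>))) + sqrt q ^ d * (real q)\<^sup>2 * 1)"
      by (intro mult_left_mono add_left_mono g0sq) auto
    with second_moment_even[OF weil True A(1) g0] low show ?thesis
      unfolding G2 E_def \<alpha>_def using True by simp
  next
    case False
    with second_moment_odd[OF False A(1) g0] low show ?thesis
      unfolding G2 E_def \<alpha>_def by simp
  qed
  also have "\<dots> = (real q)\<^sup>2 * \<alpha> * (real q ^ d * (\<delta> * (1 - \<delta>)) + \<alpha> * (2 * sqrt q ^ (d + 1) * (\<delta> * (1 - \<delta>)) + E))"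
    by (simp add: power2_eq_square algebra_simps)
  finally have "(real q)\<^sup>2 * \<alpha> * (\<alpha> * \<beta> * (1 - \<delta>)\<^sup>2)
      \<le> (real q)\<^sup>2 * \<alpha> * (real q ^ d * (\<delta> * (1 - \<delta>)) + \<alpha> * (2 * sqrt q ^ (d + 1) * (\<delta> * (1 - \<delta>)) + E))"
    by (simp add: power2_eq_square algebra_simps)
  moreover have "\<alpha> > 0"
  proof (rule ccontr)
    assume "\<not> \<alpha> > 0"
    then have "\<alpha> = 0" by (simp add: \<alpha>_def)
    moreover have "(if even d then 16 else 4) * real q ^ d > 0" using q0 by simp
    ultimately show False using AB by (simp add: \<alpha>_def)
  qed
  ultimately have key: "\<alpha> * \<beta> * (1 - \<delta>)\<^sup>2 \<le> real q ^ d * (\<delta> * (1 - \<delta>)) + \<alpha> * (2 * sqrt q ^ (d + 1) * (\<delta> * (1 - \<delta>)) + E)"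
    using q0 by (simp add: mult_le_cancel_left_pos)
  have sq: "sqrt q ^ (d - 1) * sqrt q ^ (d + 1) = real q ^ d"
  proof -
    have "(d - 1) + (d + 1) = 2 * d" using d by simp
    then have "sqrt q ^ (d - 1) * sqrt q ^ (d + 1) = sqrt q ^ (2 * d)" by (metis power_add)
    then show ?thesis by (simp add: power_mult)
  qed
  have s1: "sqrt q \<ge> 1" using q_pos by simp
  have "\<alpha> * (2 * sqrt q ^ (d + 1) * (\<delta> * (1 - \<delta>))) \<le> sqrt q ^ (d - 1) * (2 * sqrt q ^ (d + 1) * (\<delta> * (1 - \<delta>)))"
    using A(2) \<delta> by (intro mult_right_mono) (auto simp: \<alpha>_def)
  also have "\<dots> = 2 * real q ^ d * (\<delta> * (1 - \<delta>))" using sq by (simp add: mult_ac)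
  finally have t1: "\<alpha> * (2 * sqrt q ^ (d + 1) * (\<delta> * (1 - \<delta>))) \<le> 2 * real q ^ d * (\<delta> * (1 - \<delta>))" .
  \<comment> \<open>The zero-frequency term is really a factor \<open>sqrt q\<close> below q^d; that
    factor is given away.\<close>
  have "\<alpha> * sqrt q ^ d \<le> sqrt q ^ (d - 1) * sqrt q ^ (d + 1)"
    using A(2) s1 by (intro mult_mono power_increasing) (auto simp: \<alpha>_def)
  then have t2: "\<alpha> * E \<le> (if even d then 1 else 0) * real q ^ d" using sq by (simp add: E_def)
  define c where "c = (if even d then 16 else 4 :: real)"
  define c' where "c' = (if even d then 1 else 0 :: real)"
  have "c * real q ^ d * (1 - \<delta>)\<^sup>2 \<le> \<alpha> * \<beta> * (1 - \<delta>)\<^sup>2"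
    using AB by (intro mult_right_mono) (auto simp: \<alpha>_def \<beta>_def c_def)
  also have "\<dots> \<le> real q ^ d * (3 * (\<delta> * (1 - \<delta>)) + c')"
    using key t1 t2 by (simp add: c'_def algebra_simps)
  finally have "real q ^ d * (c * (1 - \<delta>)\<^sup>2) \<le> real q ^ d * (3 * (\<delta> * (1 - \<delta>)) + c')" by (simp add: mult_ac)
  then have fin: "c * (1 - \<delta>)\<^sup>2 \<le> 3 * (\<delta> * (1 - \<delta>)) + c'" using q0 by simp
  \<comment> \<open>Otherwise x = 1 - \<delta> satisfies x > 1/2 and x^2 > x/2. This contradicts 7
    x^2 <= 3 x for odd d and 19 x^2 <= 3 x + 1 for even d, the forms that the inequality takes for
    the constants 4 and 16.\<close>
  have "\<delta> \<ge> 1 / 2"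
  proof (rule ccontr)
    assume "\<not> \<delta> \<ge> 1 / 2"
    define x where "x = 1 - \<delta>"
    have x: "1 / 2 < x" "x \<le> 1" using \<open>\<not> \<delta> \<ge> 1 / 2\<close> \<delta> by (auto simp: x_def)
    have xx: "x * x > 1 / 2 * x" using x by (intro mult_strict_right_mono) auto
    have "c * (x * x) \<le> 3 * (x - x * x) + c'" using fin by (simp add: x_def power2_eq_square algebra_simps)
    then show False using x xx by (cases "even d") (auto simp: c_def c'_def)
  qed
  then show ?thesis using q0 by (simp add: \<delta>_def \<Delta>_def field_simps)
qed

section \<open>Points on the paraboloid\<close>

text \<open>Cauchy-Schwarz on the fibre sizes of f, followed by Parseval for the function that
  records these sizes.\<close>

lemma image_card_bound:
  fixes f :: "'b \<Rightarrow> 'a"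
  assumes "finite B"
  shows "real q * (real (card B))\<^sup>2 \<le> real (card (f ` B)) * (\<Sum>s\<in>UNIV. (norm (\<Sum>b\<in>B. \<chi> (s * f b)))\<^sup>2)"
proof -
  define c where "c t = real (card {b \<in> B. f b = t})" for t
  have ft: "ft (\<lambda>t. of_real (c t)) s = (\<Sum>b\<in>B. \<chi> (s * f b))" for s
  proof -
    have "(\<Sum>b\<in>B. \<chi> (s * f b)) = (\<Sum>t\<in>UNIV. \<Sum>b\<in>{b \<in> B. f b = t}. \<chi> (s * f b))"
      by (rule sum.group[symmetric]) (use assms in auto)
    also have "\<dots> = (\<Sum>t\<in>UNIV. of_real (c t) * \<chi> (s * t))"
      by (intro sum.cong refl) (simp add: c_def)
    finally show ?thesis by (simp add: ft_def)
  qed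
  have "real (card B) = (\<Sum>t\<in>f ` B. c t)"
  proof -
    have "card B = (\<Sum>t\<in>f ` B. card {b \<in> B. f b = t})"
      using sum.group[of B "f ` B" f "\<lambda>_. 1::nat"] assms by simp
    then show ?thesis by (simp add: c_def)
  qed
  then have "(real (card B))\<^sup>2 = (\<Sum>t\<in>f ` B. c t)\<^sup>2" by simp
  also have "\<dots> \<le> real (card (f ` B)) * (\<Sum>t\<in>f ` B. (c t)\<^sup>2)"
    using assms by (intro square_sum_le) auto
  also have "\<dots> \<le> real (card (f ` B)) * (\<Sum>t\<in>UNIV. (c t)\<^sup>2)"
    by (intro mult_left_mono sum_mono2) auto
  finally have "real q * (real (card B))\<^sup>2 \<le> real (card (f ` B)) * (real q * (\<Sum>t\<in>UNIV. (c t)\<^sup>2))"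
    using q_pos by (simp add: mult_ac)
  also have "real q * (\<Sum>t\<in>UNIV. (c t)\<^sup>2) = (\<Sum>s\<in>UNIV. (norm (\<Sum>b\<in>B. \<chi> (s * f b)))\<^sup>2)"
    using parseval[of "\<lambda>t. of_real (c t)"] by (simp add: ft)
  finally show ?thesis .
qed

definition lift_pt :: "nat \<Rightarrow> (nat \<Rightarrow> 'a) \<Rightarrow> nat \<Rightarrow> 'a" where
  "lift_pt n u = u(n := qnorm n u)"

lemma paraboloid_eq: "paraboloid (Suc n) = lift_pt n ` fvecs n"
proof (rule Set.set_eqI, rule iffI)
  fix x :: "nat \<Rightarrow> 'a" assume x: "x \<in> paraboloid (Suc n)"
  then have "x(n := 0) \<in> fvecs n" by (auto simp: paraboloid_def fvecs_def)
  moreover have "x = lift_pt n (x(n := 0))"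
    using x by (auto simp: paraboloid_def lift_pt_def qnorm_def intro!: sum.cong)
  ultimately show "x \<in> lift_pt n ` fvecs n" by blast
next
  fix x :: "nat \<Rightarrow> 'a" assume "x \<in> lift_pt n ` fvecs n"
  then show "x \<in> paraboloid (Suc n)"
    by (auto simp: paraboloid_def lift_pt_def qnorm_def fvecs_def)
qed

lemma inj_lift_pt: "inj_on (lift_pt n) (fvecs n)"
proof (rule inj_onI)
  fix x y :: "nat \<Rightarrow> 'a"
  assume xy: "x \<in> fvecs n" "y \<in> fvecs n" "lift_pt n x = lift_pt n y"
  show "x = y"
  proof
    fix i
    show "x i = y i" using fun_cong[OF xy(3), of i] xy(1,2)
      by (cases "i = n") (auto simp: lift_pt_def fvecs_def)
  qed
qed

text \<open>On the paraboloid the phase \<open>s (\<parallel>a - b\<parallel> - \<parallel>a - b'\<parallel>)\<close> is \<open>s\<close> times a quadratic polynomial in the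
  free coordinates, so after completing the square only a phase linear in \<open>s\<close> survives.\<close>
lemma paraboloid_pair_sum:
  fixes b b' :: "nat \<Rightarrow> 'a"
  assumes b: "b \<in> fvecs (Suc n)" "b' \<in> fvecs (Suc n)"
    and Y: "\<And>c e. e \<noteq> 0 \<Longrightarrow> Re (\<Sum>s\<in>UNIV - {0}. gauss (s * e) ^ n * \<chi> (s * c)) \<le> Y" "Y \<ge> 0"
  shows "Re (\<Sum>s\<in>UNIV - {0}. \<Sum>u\<in>fvecs n. \<chi> (s * (pdist (Suc n) (lift_pt n u) b - pdist (Suc n) (lift_pt n u) b')))
    \<le> (if b = b' then real q ^ Suc n else 0) + Y"
proof -
  define c0 where "c0 = qnorm (Suc n) b - qnorm (Suc n) b'"
  define e where "e i = - (2 * (b i - b' i))" for i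
  have expand: "s * (pdist (Suc n) (lift_pt n u) b - pdist (Suc n) (lift_pt n u) b')
      = s * c0 + (s * e n * qnorm n u + (\<Sum>i<n. s * e i * u i))" for s u
  proof -
    have "pdist (Suc n) (lift_pt n u) b - pdist (Suc n) (lift_pt n u) b'
        = (\<Sum>i<n. (u i - b i)\<^sup>2 - (u i - b' i)\<^sup>2) + ((qnorm n u - b n)\<^sup>2 - (qnorm n u - b' n)\<^sup>2)"
      by (simp add: pdist_def qnorm_def lift_pt_def sum_subtractf)
    also have "(\<Sum>i<n. (u i - b i)\<^sup>2 - (u i - b' i)\<^sup>2) = (\<Sum>i<n. ((b i)\<^sup>2 - (b' i)\<^sup>2) + e i * u i)"
      by (intro sum.cong refl) (simp add: e_def power2_eq_square algebra_simps)
    also have "\<dots> = (\<Sum>i<n. (b i)\<^sup>2) - (\<Sum>i<n. (b' i)\<^sup>2) + (\<Sum>i<n. e i * u i)"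
      by (simp add: sum.distrib sum_subtractf)
    also have "(qnorm n u - b n)\<^sup>2 - (qnorm n u - b' n)\<^sup>2 = (b n)\<^sup>2 - (b' n)\<^sup>2 + e n * qnorm n u"
      by (simp add: e_def power2_eq_square algebra_simps)
    finally have "pdist (Suc n) (lift_pt n u) b - pdist (Suc n) (lift_pt n u) b'
        = c0 + (e n * qnorm n u + (\<Sum>i<n. e i * u i))"
      by (simp add: c0_def qnorm_def)
    then show ?thesis by (simp only: distrib_left sum_distrib_left mult.assoc)
  qed
  show ?thesis
  proof (cases "b = b'")
    case True
    have "(\<Sum>s\<in>UNIV - {0}. \<Sum>u\<in>fvecs n. \<chi> (s * (pdist (Suc n) (lift_pt n u) b - pdist (Suc n) (lift_pt n u) b')))
        = (\<Sum>s\<in>UNIV - {0::'a}. of_nat (card (fvecs n :: (nat \<Rightarrow> 'a) set)))"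
      using True by simp
    also have "of_nat (card (fvecs n :: (nat \<Rightarrow> 'a) set)) = (of_nat q ^ n :: complex)"
      using linear_vector_sum[where d = n and b = "\<lambda>_. 0"] by simp
    also have "(\<Sum>s\<in>UNIV - {0::'a}. of_nat q ^ n) = (of_nat ((q - 1) * q ^ n) :: complex)"
      by (simp add: q_def card_Diff_singleton)
    finally have "Re (\<Sum>s\<in>UNIV - {0}. \<Sum>u\<in>fvecs n. \<chi> (s * (pdist (Suc n) (lift_pt n u) b - pdist (Suc n) (lift_pt n u) b')))
        = real ((q - 1) * q ^ n)" by simp
    also have "\<dots> \<le> real (q * q ^ n)" by (intro of_nat_mono mult_le_mono1) simp
    finally show ?thesis using True Y(2) by simp
  next
    case False
    show ?thesis
    proof (cases "e n = 0")
      \<comment> \<open>Equal last coordinates: the quadratic part disappears, and as b and b'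
        differ earlier, the remaining linear phase is nontrivial and sums to zero.\<close>
      case True
      have "\<exists>i<n. e i \<noteq> 0"
      proof (rule ccontr)
        assume "\<not> ?thesis"
        then have "b i = b' i" if "i < Suc n" for i
          using that True two_neq_0 by (cases "i = n") (auto simp: e_def)
        moreover have "b i = b' i" if "\<not> i < Suc n" for i using that b by (auto simp: fvecs_def)
        ultimately show False using \<open>b \<noteq> b'\<close> by blast
      qed
      have "(\<Sum>u\<in>fvecs n. \<chi> (s * (pdist (Suc n) (lift_pt n u) b - pdist (Suc n) (lift_pt n u) b'))) = 0"
        if s: "s \<in> UNIV - {0}" for s
      proof -
        have "(\<Sum>u\<in>fvecs n. \<chi> (s * (pdist (Suc n) (lift_pt n u) b - pdist (Suc n) (lift_pt n u) b')))
            = \<chi> (s * c0) * (\<Sum>u\<in>fvecs n. \<chi> (\<Sum>i<n. s * e i * u i))"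
          unfolding expand True by (simp only: mult_zero_right mult_zero_left add_0 add[of "s * c0"] sum_distrib_left)
        also have "\<dots> = 0" using \<open>\<exists>i<n. e i \<noteq> 0\<close> s by (auto simp: linear_vector_sum)
        finally show ?thesis .
      qed
      then show ?thesis using Y(2) by simp
    next
      case en: False
      define c1 where "c1 = c0 - qnorm n e / (4 * e n)"
      have "(\<Sum>u\<in>fvecs n. \<chi> (s * (pdist (Suc n) (lift_pt n u) b - pdist (Suc n) (lift_pt n u) b')))
          = gauss (s * e n) ^ n * \<chi> (s * c1)" if s: "s \<in> UNIV - {0}" for s
      proof -
        have "(\<Sum>u\<in>fvecs n. \<chi> (s * (pdist (Suc n) (lift_pt n u) b - pdist (Suc n) (lift_pt n u) b')))
            = \<chi> (s * c0) * (\<Sum>u\<in>fvecs n. \<chi> (s * e n * qnorm n u + (\<Sum>i<n. s * e i * u i)))"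
          unfolding expand by (simp only: add[of "s * c0"] sum_distrib_left)
        also have "\<dots> = \<chi> (s * c0) * (gauss (s * e n) ^ n * \<chi> (- (qnorm n (\<lambda>i. s * e i) / (4 * (s * e n)))))"
          by (subst quadratic_vector_sum) (use s en in auto)
        also have "\<dots> = gauss (s * e n) ^ n * \<chi> (s * c0 + - (qnorm n (\<lambda>i. s * e i) / (4 * (s * e n))))"
          by (simp only: add mult_ac)
        also have "qnorm n (\<lambda>i. s * e i) / (4 * (s * e n)) = s * (qnorm n e / (4 * e n))"
        proof -
          have "qnorm n (\<lambda>i. s * e i) = s * (s * qnorm n e)"
            by (simp add: qnorm_def power2_eq_square sum_distrib_left mult_ac)
          moreover have "4 * (s * e n) = s * (4 * e n)" by (simp add: mult_ac)
          ultimately show ?thesis using s by simp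
        qed
        finally show ?thesis by (simp add: c1_def right_diff_distrib)
      qed
      then have "Re (\<Sum>s\<in>UNIV - {0}. \<Sum>u\<in>fvecs n. \<chi> (s * (pdist (Suc n) (lift_pt n u) b - pdist (Suc n) (lift_pt n u) b')))
          = Re (\<Sum>s\<in>UNIV - {0}. gauss (s * e n) ^ n * \<chi> (s * c1))" by simp
      also have "\<dots> \<le> Y" by (rule Y(1)[OF en])
      finally show ?thesis using False by simp
    qed
  qed
qed

text \<open>Summing \<open>image_card_bound\<close> over A, the frequency s = 0 is kept on A, where
  it costs only |A||B|^2; the others are nonnegative and may be extended to the paraboloid. They
  cost q^d |B| <= |A||B|^2 / 4 from equal pairs and Y |B|^2 <= |A||B|^2 from the rest. The total is
  at most 3 |A||B|^2, whence q/3.\<close>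

lemma card_dist_set_large:
  fixes A B :: "(nat \<Rightarrow> 'a) set"
  assumes A: "A \<subseteq> paraboloid (Suc n)" and B: "B \<subseteq> fvecs (Suc n)"
    and Y: "\<And>c e. e \<noteq> 0 \<Longrightarrow> Re (\<Sum>s\<in>UNIV - {0}. gauss (s * e) ^ n * \<chi> (s * c)) \<le> Y" "Y \<ge> 0"
    and AY: "Y \<le> real (card A)"
    and AB: "real (card A) * real (card B) \<ge> 4 * real q ^ Suc n"
  shows "real (card (dist_set (Suc n) A B)) \<ge> real q / 3"
proof -
  define S where "S s a = (\<Sum>b\<in>B. \<chi> (s * pdist (Suc n) a b))" for s a
  define \<Delta> where "\<Delta> = real (card (dist_set (Suc n) A B))"
  define \<alpha> where "\<alpha> = real (card A)"
  define \<beta> where "\<beta> = real (card B)"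
  have q0: "real q > 0" using q_pos by simp
  have finP: "finite (paraboloid (Suc n) :: (nat \<Rightarrow> 'a) set)" unfolding paraboloid_eq by (intro finite_imageI finite_fvecs)
  have fin: "finite A" "finite B" using A B finite_fvecs finP by (auto intro: finite_subset)
  have "\<alpha> * (real q * \<beta>\<^sup>2) = (\<Sum>a\<in>A. real q * \<beta>\<^sup>2)" by (simp add: \<alpha>_def)
  also have "\<dots> \<le> (\<Sum>a\<in>A. \<Delta> * (\<Sum>s\<in>UNIV. (norm (S s a))\<^sup>2))"
  proof (rule sum_mono)
    fix a assume a: "a \<in> A"
    have "real q * \<beta>\<^sup>2 \<le> real (card (pdist (Suc n) a ` B)) * (\<Sum>s\<in>UNIV. (norm (S s a))\<^sup>2)"
      using image_card_bound[OF fin(2), of "pdist (Suc n) a"] by (simp add: S_def \<beta>_def)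
    also have "\<dots> \<le> \<Delta> * (\<Sum>s\<in>UNIV. (norm (S s a))\<^sup>2)"
      unfolding \<Delta>_def dist_set_eq
      by (intro mult_right_mono of_nat_mono card_mono sum_nonneg) (use a in auto)
    finally show "real q * \<beta>\<^sup>2 \<le> \<Delta> * (\<Sum>s\<in>UNIV. (norm (S s a))\<^sup>2)" .
  qed
  also have "\<dots> = \<Delta> * (\<Sum>a\<in>A. \<Sum>s\<in>UNIV. (norm (S s a))\<^sup>2)" by (simp add: sum_distrib_left)
  also have "(\<Sum>a\<in>A. \<Sum>s\<in>UNIV. (norm (S s a))\<^sup>2) = \<alpha> * \<beta>\<^sup>2 + (\<Sum>a\<in>A. \<Sum>s\<in>UNIV - {0}. (norm (S s a))\<^sup>2)"
  proof -
    have "(\<Sum>s\<in>UNIV. (norm (S s a))\<^sup>2) = \<beta>\<^sup>2 + (\<Sum>s\<in>UNIV - {0}. (norm (S s a))\<^sup>2)" for a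
      by (subst sum.remove[of _ 0]) (auto simp: S_def \<beta>_def)
    then show ?thesis by (simp add: sum.distrib \<alpha>_def)
  qed
  finally have 1: "\<alpha> * (real q * \<beta>\<^sup>2) \<le> \<Delta> * (\<alpha> * \<beta>\<^sup>2 + (\<Sum>a\<in>A. \<Sum>s\<in>UNIV - {0}. (norm (S s a))\<^sup>2))" .
  have "(\<Sum>a\<in>A. \<Sum>s\<in>UNIV - {0}. (norm (S s a))\<^sup>2) \<le> (\<Sum>a\<in>paraboloid (Suc n). \<Sum>s\<in>UNIV - {0}. (norm (S s a))\<^sup>2)"
    by (rule sum_mono2[OF finP A]) (auto intro: sum_nonneg)
  also have "\<dots> = (\<Sum>u\<in>fvecs n. \<Sum>s\<in>UNIV - {0}. (norm (S s (lift_pt n u)))\<^sup>2)"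
    unfolding paraboloid_eq by (subst sum.reindex[OF inj_lift_pt]) simp
  also have "\<dots> = (\<Sum>b\<in>B. \<Sum>b'\<in>B. Re (\<Sum>s\<in>UNIV - {0}. \<Sum>u\<in>fvecs n. \<chi> (s * (pdist (Suc n) (lift_pt n u) b - pdist (Suc n) (lift_pt n u) b'))))"
  proof -
    have nS: "complex_of_real ((norm (S s a))\<^sup>2) = (\<Sum>b\<in>B. \<Sum>b'\<in>B. \<chi> (s * (pdist (Suc n) a b - pdist (Suc n) a b')))" for s a
      unfolding complex_norm_square S_def cnj_sum sum_product
      by (intro sum.cong refl) (simp add: right_diff_distrib add[symmetric] flip: chi_minus)
    have "complex_of_real (\<Sum>u\<in>fvecs n. \<Sum>s\<in>UNIV - {0}. (norm (S s (lift_pt n u)))\<^sup>2)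
        = (\<Sum>u\<in>fvecs n. \<Sum>s\<in>UNIV - {0}. \<Sum>b\<in>B. \<Sum>b'\<in>B. \<chi> (s * (pdist (Suc n) (lift_pt n u) b - pdist (Suc n) (lift_pt n u) b')))"
      by (simp only: of_real_sum nS)
    also have "\<dots> = (\<Sum>b\<in>B. \<Sum>b'\<in>B. \<Sum>s\<in>UNIV - {0}. \<Sum>u\<in>fvecs n. \<chi> (s * (pdist (Suc n) (lift_pt n u) b - pdist (Suc n) (lift_pt n u) b')))"
      by (simp only: sum.swap[of _ B "UNIV - {0}"] sum.swap[of _ B "fvecs n"] sum.swap[of _ "UNIV - {0}" "fvecs n"])
    finally have "Re (complex_of_real (\<Sum>u\<in>fvecs n. \<Sum>s\<in>UNIV - {0}. (norm (S s (lift_pt n u)))\<^sup>2))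
        = Re (\<Sum>b\<in>B. \<Sum>b'\<in>B. \<Sum>s\<in>UNIV - {0}. \<Sum>u\<in>fvecs n. \<chi> (s * (pdist (Suc n) (lift_pt n u) b - pdist (Suc n) (lift_pt n u) b')))"
      by (rule arg_cong)
    then show ?thesis by (simp only: Re_complex_of_real Re_sum)
  qed
  also have "\<dots> \<le> (\<Sum>b\<in>B. \<Sum>b'\<in>B. (if b = b' then real q ^ Suc n else 0) + Y)"
  proof (rule sum_mono, rule sum_mono)
    fix b b' assume "b \<in> B" "b' \<in> B"
    then show "Re (\<Sum>s\<in>UNIV - {0}. \<Sum>u\<in>fvecs n. \<chi> (s * (pdist (Suc n) (lift_pt n u) b - pdist (Suc n) (lift_pt n u) b')))
        \<le> (if b = b' then real q ^ Suc n else 0) + Y"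
      by (intro paraboloid_pair_sum Y) (use B in auto)
  qed
  also have "\<dots> = real q ^ Suc n * \<beta> + Y * \<beta>\<^sup>2"
    using fin by (simp add: sum.distrib \<beta>_def power2_eq_square algebra_simps)
  finally have 2: "(\<Sum>a\<in>A. \<Sum>s\<in>UNIV - {0}. (norm (S s a))\<^sup>2) \<le> real q ^ Suc n * \<beta> + Y * \<beta>\<^sup>2" .
  have "0 < 4 * real q ^ Suc n" using q0 by simp
  then have "0 < \<alpha> * \<beta>" using AB unfolding \<alpha>_def \<beta>_def by linarith
  moreover have "0 \<le> \<alpha>" "0 \<le> \<beta>" by (simp_all add: \<alpha>_def \<beta>_def)
  ultimately have pos: "\<alpha> > 0" "\<beta> > 0" by (auto simp: zero_less_mult_iff)
  have 3: "real q ^ Suc n * \<beta> \<le> \<alpha> * \<beta>\<^sup>2 / 4"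
    using mult_right_mono[OF AB, of \<beta>] pos by (simp add: \<alpha>_def \<beta>_def power2_eq_square)
  have 4: "Y * \<beta>\<^sup>2 \<le> \<alpha> * \<beta>\<^sup>2" using AY by (intro mult_right_mono) (auto simp: \<alpha>_def)
  have "\<alpha> * (real q * \<beta>\<^sup>2) \<le> \<Delta> * (3 * (\<alpha> * \<beta>\<^sup>2))"
  proof -
    have "0 < \<alpha> * \<beta>\<^sup>2" using pos by simp
    then have "\<alpha> * \<beta>\<^sup>2 + (\<Sum>a\<in>A. \<Sum>s\<in>UNIV - {0}. (norm (S s a))\<^sup>2) \<le> 3 * (\<alpha> * \<beta>\<^sup>2)" using 2 3 4 by linarith
    then have "\<Delta> * (\<alpha> * \<beta>\<^sup>2 + (\<Sum>a\<in>A. \<Sum>s\<in>UNIV - {0}. (norm (S s a))\<^sup>2)) \<le> \<Delta> * (3 * (\<alpha> * \<beta>\<^sup>2))"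
      by (intro mult_left_mono) (auto simp: \<Delta>_def)
    with 1 show ?thesis by linarith
  qed
  then have "(\<alpha> * \<beta>\<^sup>2) * real q \<le> (\<alpha> * \<beta>\<^sup>2) * (3 * \<Delta>)" by (simp add: mult_ac)
  then have "real q \<le> 3 * \<Delta>" using pos by simp
  then show ?thesis by (simp add: \<Delta>_def)
qed

text \<open>For odd n the dependence on s is just \<open>\<eta> s\<close>, so the sum over s is
  another Gauss sum, of size at most \<open>sqrt q\<close> in place of q.\<close>

lemma gauss_phase_sum_odd:
  assumes n: "odd n" and e: "e \<noteq> 0"
  shows "Re (\<Sum>s\<in>UNIV - {0}. gauss (s * e) ^ n * \<chi> (s * c)) \<le> sqrt q ^ Suc n"
proof -
  have "(\<Sum>s\<in>UNIV - {0}. gauss (s * e) ^ n * \<chi> (s * c)) = (\<Sum>s\<in>UNIV - {0}. gauss e ^ n * (\<eta> s * \<chi> (c * s)))"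
    using e eta_pow_odd[OF n] by (intro sum.cong refl) (simp add: gauss_mult power_mult_distrib mult_ac)
  also have "\<dots> = gauss e ^ n * (\<Sum>s\<in>UNIV. \<eta> s * \<chi> (c * s))"
    unfolding sum_distrib_left[symmetric]
    by (subst sum.mono_neutral_left[of UNIV "UNIV - {0}"]) (auto simp: \<eta>_def)
  finally have eq: "(\<Sum>s\<in>UNIV - {0}. gauss (s * e) ^ n * \<chi> (s * c)) = gauss e ^ n * (\<Sum>s\<in>UNIV. \<eta> s * \<chi> (c * s))" .
  have "norm (\<Sum>s\<in>UNIV. \<eta> s * \<chi> (c * s)) \<le> sqrt q"
    by (cases "c = 0") (simp_all add: sum_eta norm_gauss flip: gauss_eq_eta_sum)
  then have "norm (\<Sum>s\<in>UNIV - {0}. gauss (s * e) ^ n * \<chi> (s * c)) \<le> sqrt q ^ n * sqrt q"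
    unfolding eq norm_mult norm_gauss_pow[OF e] by (intro mult_left_mono) auto
  from order.trans[OF complex_Re_le_cmod this] show ?thesis by (simp add: mult.commute)
qed

text \<open>Here the square of a Gauss sum is -q, and its odd power -q^j does not depend on s. The
  sum is thus q^(n/2) for c nonzero and negative for c = 0, the only place where its modulus is
  large.\<close>

lemma gauss_phase_sum_3_mod_4:
  assumes n: "n = 2 * j" "odd j" and q: "q mod 4 = 3" and e: "e \<noteq> 0"
  shows "Re (\<Sum>s\<in>UNIV - {0}. gauss (s * e) ^ n * \<chi> (s * c)) \<le> sqrt q ^ n"
proof -
  have nsq: "\<eta> (- 1) = - 1"
  proof -
    have "\<not> (\<exists>i::'a. - 1 = i\<^sup>2)"
    proof
      assume "\<exists>i::'a. - 1 = i\<^sup>2"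
      then obtain i :: 'a where i: "i\<^sup>2 = - 1" by metis
      \<comment> \<open>As (q - 1)/2 is odd, a square root i of -1 would satisfy i^q = -i, against
        i^q = i.\<close>
      obtain l where l: "q = 2 * (2 * l + 1) + 1"
      proof
        show "q = 2 * (2 * (q div 4) + 1) + 1" using q by presburger
      qed
      have "i = i ^ q" using finite_field_power_card[of i] by (simp add: q_def)
      also have "\<dots> = (i\<^sup>2) ^ (2 * l + 1) * i" unfolding l by (simp only: power_add power_mult power_one_right)
      also have "\<dots> = - i" by (simp add: i)
      finally have "i + i = i + - i" by (rule arg_cong)
      then have "2 * i = 0" by (simp only: mult_2 add.right_inverse)
      then have "i = 0" using two_neq_0 by simp
      then show False using i by simp
    qed
    then show ?thesis by (simp add: \<eta>_def)
  qed
  have g: "gauss (s * e) ^ n = - of_real (sqrt q ^ n)" if "s \<noteq> 0" for s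
  proof -
    have "gauss (s * e) ^ n = ((gauss (s * e))\<^sup>2) ^ j" by (simp add: n power_mult)
    also have "\<dots> = (- of_nat q) ^ j" using that e by (simp add: gauss_sq nsq)
    also have "\<dots> = - (of_nat q ^ j)" using n by simp
    also have "of_nat q ^ j = complex_of_real (sqrt q ^ n)" by (simp add: n power_mult)
    finally show ?thesis .
  qed
  have "(\<Sum>s\<in>UNIV - {0}. gauss (s * e) ^ n * \<chi> (s * c)) = (\<Sum>s\<in>UNIV - {0}. - of_real (sqrt q ^ n) * \<chi> (c * s))"
    by (intro sum.cong refl) (simp add: g mult.commute)
  also have "\<dots> = - of_real (sqrt q ^ n) * (\<Sum>s\<in>UNIV - {0}. \<chi> (c * s))"
    by (simp only: sum_distrib_left)
  also have "(\<Sum>s\<in>UNIV - {0}. \<chi> (c * s)) = (if c = 0 then of_nat q else 0) - 1"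
    using sum.remove[of "UNIV :: 'a set" 0 "\<lambda>s. \<chi> (c * s)"] by (simp add: orthogonality eq_diff_eq add.commute)
  also have "- of_real (sqrt q ^ n) * ((if c = 0 then of_nat q else 0) - 1)
      = complex_of_real (sqrt q ^ n * (1 - (if c = 0 then real q else 0)))"
    by (simp add: algebra_simps)
  finally have eq: "(\<Sum>s\<in>UNIV - {0}. gauss (s * e) ^ n * \<chi> (s * c))
      = of_real (sqrt q ^ n * (1 - (if c = 0 then real q else 0)))" .
  have "sqrt q ^ n * (1 - (if c = 0 then real q else 0)) \<le> sqrt q ^ n * 1"
    by (intro mult_left_mono) auto
  then show ?thesis unfolding eq by simp
qed

end

section \<open>Combination of the two regimes\<close>

lemma sqrt_power_eq_powr: "x > 0 \<Longrightarrow> sqrt x ^ k = x powr (real k / 2)"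
  by (simp add: powr_half_sqrt[symmetric] powr_realpow[symmetric] powr_powr)

theorem theorem1p17:
  fixes A B :: "(nat \<Rightarrow> 'a::{finite,field}) set" and p m d :: nat
  assumes "prime p" and "odd p" and "m > 0" and "CARD('a) = p ^ m"
    and "A \<subseteq> paraboloid d" and "B \<subseteq> fvecs d"
  shows "((\<exists>k::nat. k > 0 \<and> d = 4 * k - 1) \<and> CARD('a) mod 4 = 3
            \<and> card A * card B \<ge> 4 * CARD('a) ^ d
          \<longrightarrow> real (card (dist_set d A B)) \<ge> real CARD('a) / 3)
       \<and> ((d \<ge> 4 \<and> even d \<and> card A * card B \<ge> 16 * CARD('a) ^ d
            \<and> (real (card A) \<le> real CARD('a) powr ((real d - 1) / 2)
               \<or> real (card A) \<ge> real CARD('a) powr (real d / 2)))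
          \<longrightarrow> real (card (dist_set d A B)) \<ge> real CARD('a) / 144)"
proof -
  obtain \<chi> :: "'a \<Rightarrow> complex"
    where \<chi>: "\<And>x y. \<chi> (x + y) = \<chi> x * \<chi> y" "\<And>x. norm (\<chi> x) = 1" "\<exists>x. \<chi> x \<noteq> 1"
    and weil: "\<And>a. a \<noteq> 0 \<Longrightarrow> norm (\<Sum>x\<in>UNIV - {0}. \<chi> (x + a / x)) \<le> 2 * sqrt (real CARD('a))"
    by (rule exists_character_with_weil_bound[OF assms(1-4)]) (rule that)
  have "(2::'a) \<noteq> 0"
  proof
    assume "(2::'a) = 0"
    then have "of_nat 2 = (0::'a)" by simp
    then have "p dvd 2" unfolding of_nat_eq_0_iff_char_dvd CHAR_finite_field[OF assms(1,4)] .
    then have "p \<le> 2" by (rule dvd_imp_le) simp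
    then show False using assms(1,2) prime_ge_2_nat[of p] by (cases "p = 2") auto
  qed
  then interpret additive_character \<chi>
    by unfold_locales (use \<chi> in auto)
  have q0: "real q > 0" using q_pos by simp
  have AF: "A \<subseteq> fvecs d" using assms(5) by (auto simp: paraboloid_def)
  note weil' = weil[folded q_def]
  have conv: "real (card A) * real (card B) \<ge> real c * real q ^ d" if "card A * card B \<ge> c * CARD('a) ^ d" for c
    using of_nat_mono[OF that, where 'a = real] by (simp add: q_def)
  show ?thesis unfolding q_def[symmetric]
  proof (intro conjI impI)
    assume asm: "(\<exists>k::nat. k > 0 \<and> d = 4 * k - 1) \<and> q mod 4 = 3 \<and> card A * card B \<ge> 4 * q ^ d"
    then obtain k where k: "k > 0" "d = 4 * k - 1" by auto
    define n where "n = d - 1"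
    have d: "d = Suc n" "n = 2 * (2 * k - 1)" "odd (2 * k - 1)" "odd d" using k by (auto simp: n_def)
    have AB: "real (card A) * real (card B) \<ge> 4 * real q ^ d" using conv[of 4] asm by (simp add: q_def)
    show "real (card (dist_set d A B)) \<ge> real q / 3"
    \<comment> \<open>Here n = d - 1, so Y = \<open>sqrt q ^ n\<close> is the very threshold of the
      small regime and every A is covered.\<close>
    proof (cases "real (card A) \<le> sqrt q ^ (d - 1)")
      case True
      have "real (card (dist_set d A B)) \<ge> real q / 2"
        by (rule card_dist_set_small[OF weil' AF True assms(6)]) (use d AB in auto)
      then show ?thesis using q0 by linarith
    next
      case False
      show ?thesis unfolding d(1)
      proof (rule card_dist_set_large[where Y = "sqrt q ^ n"])
        show "Re (\<Sum>s\<in>UNIV - {0}. gauss (s * e) ^ n * \<chi> (s * c)) \<le> sqrt q ^ n" if "e \<noteq> 0" for c e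
          by (rule gauss_phase_sum_3_mod_4[OF d(2,3) _ that]) (use asm in auto)
      qed (use assms(5,6) d(1) AB False in auto)
    qed
  next
    assume asm: "d \<ge> 4 \<and> even d \<and> card A * card B \<ge> 16 * q ^ d
      \<and> (real (card A) \<le> real q powr ((real d - 1) / 2) \<or> real (card A) \<ge> real q powr (real d / 2))"
    define n where "n = d - 1"
    have d: "d = Suc n" "odd n" using asm by (auto simp: n_def)
    have AB: "real (card A) * real (card B) \<ge> 16 * real q ^ d" using conv[of 16] asm by (simp add: q_def)
    \<comment> \<open>Beyond the first alternative, the second one gives |A| >= q^(d/2), which is
      the Y available for odd n. Both regimes yield more than the q/144 that is claimed.\<close>
    have "real (card (dist_set d A B)) \<ge> real q / 3"
    proof (cases "real (card A) \<le> real q powr ((real d - 1) / 2)")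
      case True
      have "real q powr ((real d - 1) / 2) = sqrt q ^ (d - 1)"
        using sqrt_power_eq_powr[OF q0, of "d - 1"] d by simp
      then have le: "real (card A) \<le> sqrt q ^ (d - 1)" using True by simp
      have "real (card (dist_set d A B)) \<ge> real q / 2"
        by (rule card_dist_set_small[OF weil' AF le assms(6)]) (use asm AB in auto)
      then show ?thesis using q0 by linarith
    next
      case False
      then have ge: "real (card A) \<ge> sqrt q ^ d" using asm sqrt_power_eq_powr[OF q0, of d] by simp
      have "16 * real q ^ d \<ge> 4 * real q ^ d" using q0 by simp
      then have AB4: "real (card A) * real (card B) \<ge> 4 * real q ^ d" using AB by linarith
      show ?thesis unfolding d(1)
      proof (rule card_dist_set_large[where Y = "sqrt q ^ Suc n"])
        show "Re (\<Sum>s\<in>UNIV - {0}. gauss (s * e) ^ n * \<chi> (s * c)) \<le> sqrt q ^ Suc n" if "e \<noteq> 0" for c e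
          by (rule gauss_phase_sum_odd[OF d(2) that])
      qed (use assms(5,6) d(1) AB4 ge in auto)
    qed
    then show "real (card (dist_set d A B)) \<ge> real q / 144" using q0 by linarith
  qed
qed

end
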